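(* Let $X=\mathcal A^{\mathbb N}$ and $Y=\mathcal D^{\mathbb N}$ be two full shifts over finite alphabets, with left shifts $T$ and $S$, and let $\pi:X\to Y$ be a one-block factor map. Let $\mathbf a=(a,b)\in\mathbb R^2$ with $a>0$ and $b\ge0$. Then for each fully supported measure $\eta\in\mathcal M(X,T)$ and each $n\in\mathbb N$, there is a unique measure $\mu=\mu(\mathbf a,\eta,n)$ in $\mathcal M(X,T)$ attaining the supremum $$\sup\{a h_\mu(T)+b h_{\mu\circ\pi^{-1}}(S):\ \mu\in\mathcal M(X,T),\ \mu(I)=\eta(I)\text{ for all }I\in\mathcal A^n\}.$$ Furthermore, $\mu(\mathbf a,\eta,n)$ is the $\mathbf a$-weighted equilibrium state of a certain $\Phi\in\mathcal C_{aa}(X,T)$ with the bounded distortion property, and hence $\mu(\mathbf a,\eta,n)$ is a fully supported quasi-Bernoulli measure.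
   Context: A one-block factor map $\pi:X\to Y$ is a continuous surjection with $\pi T=S\pi$ induced letter by letter by a map $\mathcal A\to\mathcal D$. $[I]$ is the cylinder of sequences beginning with the word $I$, and $\mu(I):=\mu([I])$. $\mathcal M(X,T)$ is the set of $T$-invariant Borel probability measures; $h_\mu(T)$ is measure-theoretic entropy. $\mathcal C_{aa}(X,T)$ is the set of almost additive potentials: sequences $\Phi=(\log\phi_n)_{n\ge1}$ with each $\phi_n:X\to(0,\infty)$ continuous and some $c>0$ with $c^{-1}\phi_n(x)\phi_m(T^nx)\le\phi_{n+m}(x)\le c\,\phi_n(x)\phi_m(T^nx)$ for all $x\in X$, $n,m\in\mathbb N$. $\Phi$ has the bounded distortion property if there is $c>0$ such that $c^{-1}\phi_n(y)\le\phi_n(x)\le c\,\phi_n(y)$ for all $n$ whenever $x,y$ lie in the same $n$-th cylinder. $\Phi_*(\eta)=\lim_n\frac1n\int\log\phi_n\,d\eta$. $P^{\mathbf a}(T,\Phi)=\sup\{\Phi_*(\eta)+a h_\eta(T)+b h_{\eta\circ\pi^{-1}}(S):\eta\in\mathcal M(X,T)\}$; an $\mathbf a$-weighted equilibrium state of $\Phi$ is an $\eta\in\mathcal M(X,T)$ attaining the supremum (for almost additive potentials with bounded distortion on full shifts it is unique). A fully supported Borel probability measure $\mu$ on $\mathcal A^{\mathbb N}$ is quasi-Bernoulli if there is $c>0$ with $c^{-1}\le\mu(IJ)/(\mu(I)\mu(J))\le c$ for all $I,J\in\bigcup_{n\ge1}\mathcal A^n$. *)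

theory Defs
  imports "HOL-Probability.Probability"
begin

section \<open>Invariant measures and Kolmogorov--Sinai entropy\<close>

definition invariant_measures :: "('x::topological_space \<Rightarrow> 'x) \<Rightarrow> 'x measure set" where
  "invariant_measures T =
     {M. sets M = sets borel \<and> prob_space M \<and> T \<in> borel_measurable borel \<and> distr M borel T = M}"

definition fully_supported :: "'x::topological_space measure \<Rightarrow> bool" where
  "fully_supported M \<longleftrightarrow> (\<forall>U. open U \<and> U \<noteq> {} \<longrightarrow> measure M U > 0)"

definition partition_entropy :: "'x measure \<Rightarrow> 'x set set \<Rightarrow> real" where
  "partition_entropy M P = - (\<Sum>A\<in>P. measure M A * ln (measure M A))"

definition preimage_partition :: "'x measure \<Rightarrow> ('x \<Rightarrow> 'x) \<Rightarrow> 'x set set \<Rightarrow> 'x set set" where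
  "preimage_partition M f P = (\<lambda>A. f -` A \<inter> space M) ` P"

definition dynamical_join :: "'x measure \<Rightarrow> ('x \<Rightarrow> 'x) \<Rightarrow> 'x set set \<Rightarrow> nat \<Rightarrow> 'x set set" where
  "dynamical_join M T P n = common_refinement ((\<lambda>i. preimage_partition M (T ^^ i) P) ` {..<n})"

definition entropy_wrt_partition :: "'x measure \<Rightarrow> ('x \<Rightarrow> 'x) \<Rightarrow> 'x set set \<Rightarrow> real" where
  "entropy_wrt_partition M T P = lim (\<lambda>n. partition_entropy M (dynamical_join M T P n) / real n)"

text \<open>The limit above exists whenever \<open>M\<close> is a \<open>T\<close>-invariant probability measure and \<open>P\<close> is a
  finite measurable partition. The supremum is taken in the extended reals, since for a general
  system it may be infinite.\<close>

definition measure_entropy :: "'x measure \<Rightarrow> ('x \<Rightarrow> 'x) \<Rightarrow> ereal" where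
  "measure_entropy M T =
     (SUP P \<in> {P. finite P \<and> P \<subseteq> sets M \<and> partition_on (space M) P}.
        ereal (entropy_wrt_partition M T P))"

section \<open>Full shifts\<close>

text \<open>The full shift over an alphabet is the type \<open>nat \<Rightarrow> 'a\<close> with its product topology, where
  \<open>'a\<close> is finite and carries the discrete topology. Words are lists.\<close>

definition left_shift :: "(nat \<Rightarrow> 'a) \<Rightarrow> nat \<Rightarrow> 'a" where
  "left_shift x = (\<lambda>i. x (Suc i))"

definition cylinder :: "'a list \<Rightarrow> (nat \<Rightarrow> 'a) set" where
  "cylinder I = {x. \<forall>i < length I. x i = I ! i}"

definition one_block_factor_map ::
  "((nat \<Rightarrow> 'a::topological_space) \<Rightarrow> (nat \<Rightarrow> 'd::topological_space)) \<Rightarrow> bool" where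
  "one_block_factor_map \<pi> \<longleftrightarrow>
     continuous_on UNIV \<pi> \<and> surj \<pi> \<and> \<pi> \<circ> left_shift = left_shift \<circ> \<pi> \<and>
     (\<exists>f. \<forall>x i. \<pi> x i = f (x i))"

definition quasi_bernoulli :: "(nat \<Rightarrow> 'a) measure \<Rightarrow> bool" where
  "quasi_bernoulli M \<longleftrightarrow>
     (\<exists>c>0. \<forall>I J. I \<noteq> [] \<and> J \<noteq> [] \<longrightarrow>
        1 / c \<le> measure M (cylinder (I @ J)) / (measure M (cylinder I) * measure M (cylinder J)) \<and>
        measure M (cylinder (I @ J)) / (measure M (cylinder I) * measure M (cylinder J)) \<le> c)"

section \<open>Almost additive potentials\<close>

text \<open>A potential \<open>\<Phi> = (log \<phi>\<^sub>n)\<close>, \<open>n \<ge> 1\<close>, is represented by the sequence \<open>\<phi>\<close>; the value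
  \<open>\<phi> 0\<close> is irrelevant.\<close>

definition almost_additive ::
  "('x::topological_space \<Rightarrow> 'x) \<Rightarrow> (nat \<Rightarrow> 'x \<Rightarrow> real) \<Rightarrow> bool" where
  "almost_additive T \<phi> \<longleftrightarrow>
     (\<forall>n\<ge>1. continuous_on UNIV (\<phi> n) \<and> (\<forall>x. \<phi> n x > 0)) \<and>
     (\<exists>c>0. \<forall>x. \<forall>n\<ge>1. \<forall>m\<ge>1.
        1 / c * \<phi> n x * \<phi> m ((T ^^ n) x) \<le> \<phi> (n + m) x \<and>
        \<phi> (n + m) x \<le> c * \<phi> n x * \<phi> m ((T ^^ n) x))"

definition bounded_distortion :: "(nat \<Rightarrow> (nat \<Rightarrow> 'a) \<Rightarrow> real) \<Rightarrow> bool" where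
  "bounded_distortion \<phi> \<longleftrightarrow>
     (\<exists>c>0. \<forall>n\<ge>1. \<forall>I. length I = n \<longrightarrow> (\<forall>x\<in>cylinder I. \<forall>y\<in>cylinder I.
        1 / c * \<phi> n y \<le> \<phi> n x \<and> \<phi> n x \<le> c * \<phi> n y))"

definition potential_average :: "(nat \<Rightarrow> 'x \<Rightarrow> real) \<Rightarrow> 'x measure \<Rightarrow> real" where
  "potential_average \<phi> M = lim (\<lambda>n. (\<integral>x. ln (\<phi> n x) \<partial>M) / real n)"

section \<open>Weighted entropy, pressure and equilibrium states\<close>

definition weighted_entropy ::
  "real \<Rightarrow> real \<Rightarrow> ((nat \<Rightarrow> 'a) \<Rightarrow> (nat \<Rightarrow> 'd::topological_space)) \<Rightarrow> (nat \<Rightarrow> 'a) measure \<Rightarrow> ereal"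
where
  "weighted_entropy a b \<pi> M =
     ereal a * measure_entropy M left_shift + ereal b * measure_entropy (distr M borel \<pi>) left_shift"

definition weighted_pressure ::
  "real \<Rightarrow> real \<Rightarrow> ((nat \<Rightarrow> 'a::topological_space) \<Rightarrow> (nat \<Rightarrow> 'd::topological_space)) \<Rightarrow>
   (nat \<Rightarrow> (nat \<Rightarrow> 'a) \<Rightarrow> real) \<Rightarrow> ereal" where
  "weighted_pressure a b \<pi> \<phi> =
     (SUP M \<in> invariant_measures left_shift.
        ereal (potential_average \<phi> M) + weighted_entropy a b \<pi> M)"

definition weighted_equilibrium_state ::
  "real \<Rightarrow> real \<Rightarrow> ((nat \<Rightarrow> 'a::topological_space) \<Rightarrow> (nat \<Rightarrow> 'd::topological_space)) \<Rightarrow>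
   (nat \<Rightarrow> (nat \<Rightarrow> 'a) \<Rightarrow> real) \<Rightarrow> (nat \<Rightarrow> 'a) measure \<Rightarrow> bool" where
  "weighted_equilibrium_state a b \<pi> \<phi> M \<longleftrightarrow>
     M \<in> invariant_measures left_shift \<and>
     ereal (potential_average \<phi> M) + weighted_entropy a b \<pi> M = weighted_pressure a b \<pi> \<phi>"

definition measures_with_marginal ::
  "(nat \<Rightarrow> 'a::topological_space) measure \<Rightarrow> nat \<Rightarrow> (nat \<Rightarrow> 'a) measure set" where
  "measures_with_marginal N n =
     {M \<in> invariant_measures left_shift.
        \<forall>I. length I = n \<longrightarrow> measure M (cylinder I) = measure N (cylinder I)}"

definition maximizes_weighted_entropy ::
  "real \<Rightarrow> real \<Rightarrow> ((nat \<Rightarrow> 'a::topological_space) \<Rightarrow> (nat \<Rightarrow> 'd::topological_space)) \<Rightarrow>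
   (nat \<Rightarrow> 'a) measure \<Rightarrow> nat \<Rightarrow> (nat \<Rightarrow> 'a) measure \<Rightarrow> bool" where
  "maximizes_weighted_entropy a b \<pi> N n M \<longleftrightarrow>
     M \<in> measures_with_marginal N n \<and>
     weighted_entropy a b \<pi> M = (SUP M' \<in> measures_with_marginal N n. weighted_entropy a b \<pi> M')"

end

theory Submission
  imports Defs
begin

text \<open>In terms of its cylinder weights an invariant measure is a function \<open>p\<close>
  on words that is consistent under extension on both sides, and by the Kolmogorov--Sinai theorem its entropy is the limit of the word entropies.

  For a quasi-additive function \<open>s\<close> on words there are explicit weights \<open>exp \<psi>\<close> on \<open>\<A>\<^sup>n\<close>, quasi-Bernoulli
  and with \<open>a \<psi> + b log (\<pi>\<^sub>* exp \<psi>) = s - R\<^sub>n\<close>. Averaging them over periodic orbits and passing to the limit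
  yields a stationary quasi-Bernoulli \<open>\<mu>\<close> comparable to \<open>exp \<psi>\<close>. The defect of any \<open>\<nu>\<close> in the weighted
  variational principle for \<open>s\<close> is then \<open>a\<close> times the relative entropy rate of \<open>\<nu>\<close> with respect to \<open>\<mu>\<close>
  plus a nonnegative term, and a vanishing relative entropy rate forces \<open>\<nu> = \<mu>\<close>. So \<open>\<mu>\<close> is the unique weighted
  equilibrium state of \<open>s\<close>.

  A maximizer of the weighted entropy with prescribed marginal exists by compactness and upper
  semicontinuity. Since \<open>\<eta>\<close> is fully supported, its marginal is in the relative interior of the stationary
  marginals (perturbations are extended to Markov measures), so the constraint has Lagrange multipliers
  \<open>g\<close> on \<open>\<A>\<^sup>n\<close>. Hence every maximizer is a weighted equilibrium state of the Birkhoff sums of \<open>g\<close>,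
  and is therefore the \<open>\<mu>\<close> belonging to that potential.\<close>

section \<open>Words and stationary weights\<close>

text \<open>Entropy is affine on invariant measures, so uniqueness under a marginal constraint
  cannot come from strict concavity of the objective. It is borrowed from the unconstrained problem:
  the multipliers turn constrained maximizers into maximizers of entropy plus energy, where
  uniqueness does hold.

  The weights \<open>exp \<psi>\<close> are chosen so that, on words of each fixed length, energy
  plus weighted entropy is a constant minus two relative entropies; Gibbs' inequality then solves
  the problem exactly at that length. They are not stationary, and the stationary
  \<open>\<mu>\<close> agrees with them only up to a bounded factor. Under the logarithm such
  factors become bounded terms, which disappear on division by the length.

  A vanishing relative entropy rate says little about a general reference measure. It is the lower
  quasi-Bernoulli bound of \<open>\<mu>\<close> that turns it into equality, by making long pasts
  nearly irrelevant.

  Entropy is defined through all finite measurable partitions, so its reduction to letters needs an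
  argument for arbitrary partitions; a Fano-type coding estimate provides it.\<close>

definition words :: "'c set \<Rightarrow> nat \<Rightarrow> 'c list set" where
  "words S n = {w. set w \<subseteq> S \<and> length w = n}"

lemma finite_words [simp, intro]: "finite S \<Longrightarrow> finite (words S n)"
  by (simp add: words_def finite_lists_length_eq)

lemma words_0 [simp]: "words S 0 = {[]}"
  by (auto simp: words_def)

lemma words_set: "w \<in> words S n \<Longrightarrow> w \<in> lists S"
  by (auto simp: words_def)

lemma words_length: "w \<in> words S n \<Longrightarrow> length w = n"
  by (auto simp: words_def)

lemma bij_betw_words_append:
  "bij_betw (\<lambda>(u, v). u @ v) (words S m \<times> words S n) (words S (m + n))"
proof (rule bij_betwI[where g = "\<lambda>w. (take m w, drop m w)"])
  show "(\<lambda>w. (take m w, drop m w)) \<in> words S (m + n) \<rightarrow> words S m \<times> words S n"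
    by (auto simp: words_def dest: in_set_takeD in_set_dropD)
qed (auto simp: words_def)

lemma sum_words_append:
  fixes f :: "'c list \<Rightarrow> real"
  shows "(\<Sum>w\<in>words S (m + n). f w) = (\<Sum>u\<in>words S m. \<Sum>v\<in>words S n. f (u @ v))"
  unfolding sum.cartesian_product
  by (subst sum.reindex_bij_betw[OF bij_betw_words_append, symmetric])
     (simp add: case_prod_unfold)

lemma bij_betw_words_1: "bij_betw (\<lambda>c. [c]) S (words S 1)"
  by (rule bij_betwI[where g = hd]) (auto simp: words_def length_Suc_conv)

lemma words_1: "words S 1 = (\<lambda>c. [c]) ` S"
  using bij_betw_words_1[of S] by (simp add: bij_betw_def)

lemma sum_words_1: "(\<Sum>w\<in>words S (Suc 0). f w) = (\<Sum>c\<in>S. f [c])"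
  using sum.reindex_bij_betw[OF bij_betw_words_1, of f S] by simp

lemma sum_words_snoc:
  fixes f :: "'c list \<Rightarrow> real"
  shows "(\<Sum>w\<in>words S (Suc n). f w) = (\<Sum>w\<in>words S n. \<Sum>c\<in>S. f (w @ [c]))"
  using sum_words_append[of f S n 1] by (simp add: sum_words_1)

lemma sum_words_Cons:
  fixes f :: "'c list \<Rightarrow> real"
  shows "(\<Sum>w\<in>words S (Suc n). f w) = (\<Sum>w\<in>words S n. \<Sum>c\<in>S. f (c # w))"
  using sum_words_append[of f S 1 n] by (simp add: sum_words_1) (rule sum.swap)

text \<open>The alphabet is a set rather than a type so that the cells of a finite measurable
  partition can serve as letters too. Summing over a last letter expresses additivity, summing over
  a first letter shift invariance.\<close>

definition stationary_weights :: "'c set \<Rightarrow> ('c list \<Rightarrow> real) \<Rightarrow> bool" where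
  "stationary_weights S p \<longleftrightarrow> p [] = 1 \<and>
     (\<forall>w\<in>lists S. 0 \<le> p w \<and> (\<Sum>c\<in>S. p (w @ [c])) = p w \<and> (\<Sum>c\<in>S. p (c # w)) = p w)"

lemma stationary_weightsD:
  assumes "stationary_weights S p"
  shows "p [] = 1" "w \<in> lists S \<Longrightarrow> 0 \<le> p w"
    "w \<in> lists S \<Longrightarrow> (\<Sum>c\<in>S. p (w @ [c])) = p w"
    "w \<in> lists S \<Longrightarrow> (\<Sum>c\<in>S. p (c # w)) = p w"
  using assms by (auto simp: stationary_weights_def)

lemma sum_words_extend_right:
  assumes "\<And>w. w \<in> lists S \<Longrightarrow> (\<Sum>c\<in>S. p (w @ [c])) = p w" "w \<in> lists S"
  shows "(\<Sum>v\<in>words S k. p (w @ v)) = (p w :: real)"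
proof (induction k)
  case (Suc k)
  have "(\<Sum>v\<in>words S (Suc k). p (w @ v)) = (\<Sum>v\<in>words S k. \<Sum>c\<in>S. p ((w @ v) @ [c]))"
    by (simp add: sum_words_snoc)
  also have "\<dots> = (\<Sum>v\<in>words S k. p (w @ v))"
    using assms(2) words_set by (intro sum.cong refl assms(1)) auto
  finally show ?case using Suc by simp
qed simp

lemma sum_words_extend_left:
  assumes "\<And>w. w \<in> lists S \<Longrightarrow> (\<Sum>c\<in>S. p (c # w)) = p w" "w \<in> lists S"
  shows "(\<Sum>v\<in>words S k. p (v @ w)) = (p w :: real)"
proof (induction k)
  case (Suc k)
  have "(\<Sum>v\<in>words S (Suc k). p (v @ w)) = (\<Sum>v\<in>words S k. \<Sum>c\<in>S. p (c # (v @ w)))"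
    by (simp add: sum_words_Cons)
  also have "\<dots> = (\<Sum>v\<in>words S k. p (v @ w))"
    using assms(2) words_set by (intro sum.cong refl assms(1)) auto
  finally show ?case using Suc by simp
qed simp

lemma stationary_weights_append_right:
  "stationary_weights S p \<Longrightarrow> w \<in> lists S \<Longrightarrow> (\<Sum>v\<in>words S k. p (w @ v)) = p w"
  by (rule sum_words_extend_right) (auto dest: stationary_weightsD)

lemma stationary_weights_append_left:
  "stationary_weights S p \<Longrightarrow> w \<in> lists S \<Longrightarrow> (\<Sum>v\<in>words S k. p (v @ w)) = p w"
  by (rule sum_words_extend_left) (auto dest: stationary_weightsD)

lemma stationary_weights_sum:
  assumes "stationary_weights S p" shows "(\<Sum>w\<in>words S n. p w) = 1"
  using stationary_weights_append_right[OF assms, of "[]" n] stationary_weightsD(1)[OF assms] by simp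

lemma stationary_weights_nonneg: "stationary_weights S p \<Longrightarrow> w \<in> words S n \<Longrightarrow> 0 \<le> p w"
  using stationary_weightsD(2) words_set by metis

lemma stationary_weights_mono:
  assumes "stationary_weights S p" "finite S" "u \<in> lists S" "v \<in> lists S"
  shows "p (u @ v) \<le> p u" "p (u @ v) \<le> p v"
proof -
  have v: "v \<in> words S (length v)" and u: "u \<in> words S (length u)"
    using assms by (auto simp: words_def)
  have "p (u @ v) \<le> (\<Sum>v\<in>words S (length v). p (u @ v))"
    using assms by (intro member_le_sum v finite_words)
      (auto intro!: stationary_weightsD(2)[OF assms(1)] simp: words_def)
  then show "p (u @ v) \<le> p u" using stationary_weights_append_right[OF assms(1,3)] by simp
  have "p (u @ v) \<le> (\<Sum>u\<in>words S (length u). p (u @ v))"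
    using assms
    by (intro member_le_sum[of u _ "\<lambda>u. p (u @ v)"] u finite_words)
       (auto intro!: stationary_weightsD(2)[OF assms(1)] simp: words_def)
  then show "p (u @ v) \<le> p v" using stationary_weights_append_left[OF assms(1,4)] by simp
qed

lemma stationary_weights_le_1:
  assumes "stationary_weights S p" "finite S" "w \<in> lists S"
  shows "p w \<le> 1"
  using stationary_weights_mono(1)[OF assms(1,2) _ assms(3), of "[]"] stationary_weightsD(1)[OF assms(1)]
  by simp

lemma stationary_weights_convex:
  assumes "stationary_weights S p" "stationary_weights S q" "0 \<le> t" "t \<le> (1::real)"
  shows "stationary_weights S (\<lambda>w. t * p w + (1 - t) * q w)"
  unfolding stationary_weights_def
proof (intro conjI ballI)
  fix w assume "w \<in> lists S"
  then show "0 \<le> t * p w + (1 - t) * q w"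
    "(\<Sum>c\<in>S. t * p (w @ [c]) + (1 - t) * q (w @ [c])) = t * p w + (1 - t) * q w"
    "(\<Sum>c\<in>S. t * p (c # w) + (1 - t) * q (c # w)) = t * p w + (1 - t) * q w"
    using assms stationary_weightsD[OF assms(1)] stationary_weightsD[OF assms(2)]
    by (auto simp: sum.distrib sum_distrib_left[symmetric] intro!: add_nonneg_nonneg mult_nonneg_nonneg)
qed (use assms in \<open>simp add: stationary_weightsD(1)\<close>)

section \<open>Entropy of stationary weights\<close>

text \<open>This is ln x \<le> x - 1 at x = q / j, multiplied by \<open>j\<close>. Written without a
  quotient it also covers \<open>j = 0\<close>; the third hypothesis is absolute continuity.\<close>

lemma gibbs_pointwise:
  fixes j q :: real
  assumes "0 \<le> j" "0 \<le> q" "q = 0 \<Longrightarrow> j = 0"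
  shows "j * ln q + j \<le> j * ln j + q"
proof (cases "j = 0")
  case False
  then have "0 < j" "0 < q" using assms by (auto simp: less_le)
  then have "ln (q / j) \<le> q / j - 1" by (intro ln_le_minus_one) simp
  then have "j * ln (q / j) \<le> j * (q / j - 1)" using \<open>0 < j\<close> by (intro mult_left_mono) auto
  then show ?thesis using \<open>0 < j\<close> \<open>0 < q\<close> by (simp add: ln_div algebra_simps)
qed (use assms in auto)

text \<open>Comparing only the total masses admits a subprobability \<open>q\<close>, as it arises
  from the kernels in the coding argument.\<close>

lemma gibbs_inequality:
  fixes j q :: "'i \<Rightarrow> real"
  assumes "\<And>x. x \<in> A \<Longrightarrow> 0 \<le> j x" "\<And>x. x \<in> A \<Longrightarrow> 0 \<le> q x"
    "\<And>x. x \<in> A \<Longrightarrow> q x = 0 \<Longrightarrow> j x = 0" "sum q A \<le> sum j A"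
  shows "(\<Sum>x\<in>A. j x * ln (q x)) \<le> (\<Sum>x\<in>A. j x * ln (j x))"
proof -
  have "(\<Sum>x\<in>A. j x * ln (q x) + j x) \<le> (\<Sum>x\<in>A. j x * ln (j x) + q x)"
    by (intro sum_mono gibbs_pointwise assms)
  then show ?thesis using assms(4) by (simp add: sum.distrib)
qed

definition word_entropy :: "'c set \<Rightarrow> ('c list \<Rightarrow> real) \<Rightarrow> nat \<Rightarrow> real" where
  "word_entropy S p n = - (\<Sum>w\<in>words S n. p w * ln (p w))"

lemma word_entropy_nonneg:
  assumes "stationary_weights S p" "finite S"
  shows "0 \<le> word_entropy S p n"
proof -
  have "(\<Sum>w\<in>words S n. p w * ln (p w)) \<le> 0"
  proof (intro sum_nonpos mult_nonneg_nonpos)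
    fix w assume w: "w \<in> words S n"
    then show "0 \<le> p w" using assms stationary_weights_nonneg by auto
    then show "ln (p w) \<le> 0"
      using stationary_weights_le_1[OF assms words_set[OF w]] by (cases "p w = 0") auto
  qed
  then show ?thesis by (simp add: word_entropy_def)
qed

text \<open>Subadditivity is Gibbs' inequality for the law of the pair (u, v) against the product of
  its marginals. Stationarity makes the second marginal the same function \<open>p\<close>
  again.\<close>

lemma word_entropy_add_le:
  assumes p: "stationary_weights S p" and S: "finite S"
  shows "word_entropy S p (m + n) \<le> word_entropy S p m + word_entropy S p n"
proof -
  let ?A = "words S m \<times> words S n"
  have nn: "0 \<le> p u" "0 \<le> p v" "0 \<le> p (u @ v)" "p (u @ v) \<le> p u" "p (u @ v) \<le> p v"
    if "u \<in> words S m" "v \<in> words S n" for u v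
    using that words_set[OF that(1)] words_set[OF that(2)] stationary_weights_mono[OF p S]
    by (auto intro!: stationary_weightsD(2)[OF p])
  have "(\<Sum>(u,v)\<in>?A. p (u @ v) * ln (p u * p v)) \<le> (\<Sum>(u,v)\<in>?A. p (u @ v) * ln (p (u @ v)))"
    unfolding case_prod_unfold
  proof (rule gibbs_inequality)
    have "(\<Sum>x\<in>?A. p (fst x) * p (snd x)) = 1"
      using stationary_weights_sum[OF p]
      by (simp add: sum.cartesian_product' sum_distrib_left[symmetric] sum_distrib_right[symmetric])
    moreover have "(\<Sum>x\<in>?A. p (fst x @ snd x)) = 1"
      using stationary_weights_sum[OF p, of "m + n"] sum_words_append[of p S m n]
      by (simp add: sum.cartesian_product')
    ultimately show "(\<Sum>x\<in>?A. p (fst x) * p (snd x)) \<le> (\<Sum>x\<in>?A. p (fst x @ snd x))" by simp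
  qed (auto simp: nn, (metis nn(3) nn(4) nn(5) order_antisym)+)
  also have "\<dots> = (\<Sum>w\<in>words S (m + n). p w * ln (p w))"
    by (simp add: sum_words_append sum.cartesian_product)
  also have "(\<Sum>(u,v)\<in>?A. p (u @ v) * ln (p u * p v))
    = (\<Sum>(u,v)\<in>?A. p (u @ v) * ln (p u) + p (u @ v) * ln (p v))"
  proof (intro sum.cong refl, clarify)
    fix u v assume uv: "u \<in> words S m" "v \<in> words S n"
    show "p (u @ v) * ln (p u * p v) = p (u @ v) * ln (p u) + p (u @ v) * ln (p v)"
    proof (cases "p (u @ v) = 0")
      case False
      then have "0 < p u" "0 < p v" using nn[OF uv] by linarith+
      then show ?thesis by (simp add: ln_mult algebra_simps)
    qed simp
  qed
  also have "\<dots> = (\<Sum>u\<in>words S m. \<Sum>v\<in>words S n. p (u @ v) * ln (p u))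
      + (\<Sum>v\<in>words S n. \<Sum>u\<in>words S m. p (u @ v) * ln (p v))"
    by (subst (2) sum.swap) (simp add: sum.cartesian_product[symmetric] sum.distrib)
  also have "(\<Sum>u\<in>words S m. \<Sum>v\<in>words S n. p (u @ v) * ln (p u)) = (\<Sum>u\<in>words S m. p u * ln (p u))"
    by (intro sum.cong refl)
       (simp add: sum_distrib_right[symmetric] stationary_weights_append_right[OF p words_set])
  also have "(\<Sum>v\<in>words S n. \<Sum>u\<in>words S m. p (u @ v) * ln (p v)) = (\<Sum>v\<in>words S n. p v * ln (p v))"
    by (intro sum.cong refl)
       (simp add: sum_distrib_right[symmetric] stationary_weights_append_left[OF p words_set])
  finally show ?thesis by (simp add: word_entropy_def)
qed

text \<open>Fekete's lemma. For a block length \<open>m\<close> with a nearly optimal quotient,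
  write n as a multiple of \<open>m\<close> plus a remainder below \<open>m\<close>; the remainder
  costs at most the constant \<open>B\<close>, which is negligible against n.\<close>

lemma fekete:
  fixes a :: "nat \<Rightarrow> real"
  assumes sub: "\<And>m n. a (m + n) \<le> a m + a n" and nonneg: "\<And>n. 0 \<le> a n"
  shows "(\<lambda>n. a n / n) \<longlonglongrightarrow> (INF n\<in>{1..}. a n / n)"
proof -
  let ?L = "INF n\<in>{1..}. a n / real n"
  have bdd: "bdd_below ((\<lambda>n. a n / real n) ` {1..})"
    using nonneg by (intro bdd_belowI[of _ 0]) auto
  have lower: "?L \<le> a n / n" if "n \<ge> 1" for n
    using bdd that by (intro cINF_lower) auto
  have mult: "a (q * m + r) \<le> q * a m + a r" for q m r
  proof (induction q)
    case (Suc q)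
    have "a (Suc q * m + r) \<le> a m + a (q * m + r)" using sub[of m "q * m + r"] by (simp add: add.assoc)
    then show ?case using Suc by (simp add: algebra_simps)
  qed simp
  show ?thesis
  proof (rule LIMSEQ_I)
    fix e :: real assume "0 < e"
    have "?L < ?L + e / 2" using \<open>0 < e\<close> by simp
    then obtain m where m: "m \<ge> 1" "a m / m < ?L + e / 2"
      using cINF_less_iff[OF _ bdd, of "?L + e / 2"] by auto
    define B where "B = Max (a ` {..<m})"
    have B: "a r \<le> B" if "r < m" for r using that by (auto simp: B_def)
    have "0 \<le> B" using B[of 0] m nonneg[of 0] by linarith
    define N where "N = nat \<lceil>2 * B / e\<rceil> + 1"
    have "norm (a n / n - ?L) < e" if "n \<ge> N" for n
    proof -
      have n: "n \<ge> 1" "real n > 2 * B / e" using that by (auto simp: N_def) linarith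
      have "a n \<le> (n div m) * a m + a (n mod m)"
        using mult[of "n div m" m "n mod m"] by simp
      also have "\<dots> \<le> (n div m) * a m + B" using B[of "n mod m"] m by simp
      also have "(n div m) * a m \<le> n * (a m / m)"
      proof -
        have "real (n div m) \<le> n / m" by (simp add: of_nat_div_le_of_nat)
        then have "(n div m) * a m \<le> n / m * a m" using nonneg by (intro mult_right_mono)
        then show ?thesis by simp
      qed
      finally have "a n / n \<le> (n * (a m / m) + B) / n" by (intro divide_right_mono) auto
      also have "\<dots> = a m / m + B / n" using n by (simp add: add_divide_distrib)
      also have "B / n < e / 2" using n \<open>0 < e\<close> \<open>0 \<le> B\<close> by (simp add: field_simps)
      finally have "a n / n < ?L + e" using m by linarith
      then show ?thesis using lower[OF n(1)] by simp
    qed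
    then show "\<exists>no. \<forall>n\<ge>no. norm (a n / n - ?L) < e" by blast
  qed
qed

text \<open>Taken as an infimum, the rate is bounded by every single block entropy. This is the
  source of its upper semicontinuity when a maximizer is constructed.\<close>

definition entropy_rate :: "'c set \<Rightarrow> ('c list \<Rightarrow> real) \<Rightarrow> real" where
  "entropy_rate S p = (INF n\<in>{1..}. word_entropy S p n / real n)"

lemma entropy_rate_tendsto:
  assumes "stationary_weights S p" "finite S"
  shows "(\<lambda>n. word_entropy S p n / n) \<longlonglongrightarrow> entropy_rate S p"
  unfolding entropy_rate_def using word_entropy_add_le[OF assms] word_entropy_nonneg[OF assms]
  by (intro fekete)

lemma entropy_rate_le:
  assumes "stationary_weights S p" "finite S" "n \<ge> 1"
  shows "entropy_rate S p \<le> word_entropy S p n / n"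
  unfolding entropy_rate_def using assms word_entropy_nonneg[OF assms(1,2)]
  by (intro cINF_lower bdd_belowI[of _ 0]) auto

text \<open>The crude estimate -x ln x \<le> 1 for each letter. Its purpose is a uniform bound that
  makes suprema of rates finite.\<close>

lemma entropy_rate_le_card:
  assumes "stationary_weights S p" "finite S"
  shows "entropy_rate S p \<le> card (words S 1)"
proof -
  have "- (p w * ln (p w)) \<le> 1" if "w \<in> words S 1" for w
    using gibbs_pointwise[of "p w" 1] stationary_weights_nonneg[OF assms(1) that] by simp
  then have "(\<Sum>w\<in>words S 1. - (p w * ln (p w))) \<le> (\<Sum>w\<in>words S 1. 1)" by (rule sum_mono)
  then show ?thesis using entropy_rate_le[OF assms, of 1] by (simp add: word_entropy_def sum_negf)
qed

text \<open>Apply the Gibbs bound at \<open>x\<close> and at \<open>y\<close> against their common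
  mixture and average; the linear terms cancel. No derivative is taken, so zero arguments need no
  separate treatment.\<close>

lemma xlnx_convex:
  fixes x y t :: real
  assumes "0 \<le> x" "0 \<le> y" "0 \<le> t" "t \<le> 1"
  shows "(t * x + (1 - t) * y) * ln (t * x + (1 - t) * y) \<le> t * (x * ln x) + (1 - t) * (y * ln y)"
proof (cases "t = 0 \<or> t = 1")
  case False
  then have t: "0 < t" "t < 1" using assms by auto
  let ?z = "t * x + (1 - t) * y"
  have z: "0 \<le> ?z" "?z = 0 \<Longrightarrow> x = 0" "?z = 0 \<Longrightarrow> y = 0"
    using assms t by (auto simp: add_nonneg_eq_0_iff)
  have "t * (x * ln ?z + x) \<le> t * (x * ln x + ?z)"
    using assms z by (intro mult_left_mono gibbs_pointwise) auto
  moreover have "(1 - t) * (y * ln ?z + y) \<le> (1 - t) * (y * ln y + ?z)"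
    using assms z by (intro mult_left_mono gibbs_pointwise) auto
  ultimately show ?thesis by (simp add: algebra_simps)
qed auto

lemma entropy_rate_concave:
  assumes p: "stationary_weights S p" and q: "stationary_weights S q" and S: "finite S"
    and t: "0 \<le> t" "t \<le> 1"
  shows "t * entropy_rate S p + (1 - t) * entropy_rate S q
    \<le> entropy_rate S (\<lambda>w. t * p w + (1 - t) * q w)"
proof (rule LIMSEQ_le)
  let ?r = "\<lambda>w. t * p w + (1 - t) * q w"
  show "(\<lambda>n. t * (word_entropy S p n / n) + (1 - t) * (word_entropy S q n / n))
      \<longlonglongrightarrow> t * entropy_rate S p + (1 - t) * entropy_rate S q"
    by (intro tendsto_intros entropy_rate_tendsto p q S)
  show "(\<lambda>n. word_entropy S ?r n / n) \<longlonglongrightarrow> entropy_rate S ?r"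
    by (intro entropy_rate_tendsto stationary_weights_convex p q S t)
  have "t * word_entropy S p n + (1 - t) * word_entropy S q n \<le> word_entropy S ?r n" for n
  proof -
    have "(\<Sum>w\<in>words S n. ?r w * ln (?r w))
      \<le> (\<Sum>w\<in>words S n. t * (p w * ln (p w)) + (1 - t) * (q w * ln (q w)))"
      using stationary_weights_nonneg[OF p] stationary_weights_nonneg[OF q] t
      by (intro sum_mono xlnx_convex) auto
    then show ?thesis by (simp add: word_entropy_def sum.distrib sum_distrib_left[symmetric])
  qed
  then have "t * (word_entropy S p n / n) + (1 - t) * (word_entropy S q n / n)
      \<le> word_entropy S ?r n / n" for n
    using divide_right_mono[of "t * word_entropy S p n + (1 - t) * word_entropy S q n" _ "real n"]
    by (simp add: add_divide_distrib)
  then show "\<exists>N. \<forall>n\<ge>N. t * (word_entropy S p n / n) + (1 - t) * (word_entropy S q n / n)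
      \<le> word_entropy S ?r n / n" by blast
qed

section \<open>Measures on the full shift and their cylinder weights\<close>

lemma in_cylinder_iff: "x \<in> cylinder I \<longleftrightarrow> map x [0..<length I] = I"
  unfolding cylinder_def by (subst list_eq_iff_nth_eq) simp

lemma cylinder_Nil [simp]: "cylinder [] = UNIV"
  by (simp add: cylinder_def)

lemma cylinder_disjoint:
  assumes "length I = length J" "I \<noteq> J"
  shows "cylinder I \<inter> cylinder J = {}"
proof -
  obtain i where "i < length I" "I ! i \<noteq> J ! i" using assms nth_equalityI by metis
  then show ?thesis using assms(1) unfolding cylinder_def by force
qed

lemma cylinder_nonempty: "cylinder I \<noteq> {}"
proof -
  \<comment> \<open>Beyond the length of \<open>I\<close> the value \<open>I ! i\<close> is
    unspecified, but any value will do there.\<close>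
  have "(\<lambda>i. I ! i) \<in> cylinder I" by (simp add: cylinder_def)
  then show ?thesis by blast
qed

lemma cylinder_Int:
  assumes "length I \<le> length J"
  shows "cylinder I \<inter> cylinder J = (if take (length I) J = I then cylinder J else {})"
proof -
  have "x \<in> cylinder I \<longleftrightarrow> take (length I) J = I" if "x \<in> cylinder J" for x
  proof -
    have "take (length I) (map x [0..<length J]) = map x [0..<length I]"
      using assms by (simp add: take_map)
    moreover have "map x [0..<length J] = J" using that by (rule in_cylinder_iff[THEN iffD1])
    ultimately show ?thesis unfolding in_cylinder_iff[of x I] by argo
  qed
  then show ?thesis by auto
qed

lemma cylinder_eq_UN_extend:
  "cylinder I = (\<Union>V\<in>words UNIV k. cylinder (I @ V))"
proof (intro set_eqI iffI)
  fix x assume x: "x \<in> cylinder I"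
  let ?V = "map (\<lambda>i. x (length I + i)) [0..<k]"
  have "x \<in> cylinder (I @ ?V)" using x by (auto simp: cylinder_def nth_append)
  moreover have "?V \<in> words UNIV k" by (simp add: words_def)
  ultimately show "x \<in> (\<Union>V\<in>words UNIV k. cylinder (I @ V))" by blast
next
  fix x assume "x \<in> (\<Union>V\<in>words UNIV k. cylinder (I @ V))"
  then obtain V where "x \<in> cylinder (I @ V)" by blast
  then have "x i = (I @ V) ! i" if "i < length I" for i using that by (auto simp: cylinder_def)
  then show "x \<in> cylinder I" by (auto simp: cylinder_def nth_append)
qed

lemma shift_power: "(left_shift ^^ n) x i = x (n + i)"
  by (induction n arbitrary: i) (auto simp: left_shift_def)

lemma vimage_shift_cylinder: "left_shift -` cylinder I = (\<Union>c. cylinder (c # I))"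
  by (auto simp: cylinder_def left_shift_def less_Suc_eq_0_disj)

lemma open_cylinder: "open (cylinder I :: (nat \<Rightarrow> 'a::discrete_topology) set)"
proof -
  have "cylinder I = Pi\<^sub>E UNIV (\<lambda>i. if i < length I then {I ! i} else UNIV)"
    by (auto simp: cylinder_def PiE_iff split: if_splits)
  moreover have "{i. (if i < length I then {I ! i} else UNIV) \<noteq> UNIV} \<subseteq> {..<length I}"
    by auto
  moreover have "open (if i < length I then {I ! i} else UNIV)" for i
    by (rule Topological_Spaces.open_discrete)
  ultimately show ?thesis
    using open_PiE[of "\<lambda>i. if i < length I then {I ! i} else UNIV"] finite_subset by fastforce
qed

lemma open_contains_cylinder:
  fixes U :: "(nat \<Rightarrow> 'a::topological_space) set"
  assumes "open U" "x \<in> U"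
  shows "\<exists>n. cylinder (map x [0..<n]) \<subseteq> U"
proof -
  have "openin (product_topology (\<lambda>i. euclidean) UNIV) U" using assms(1) by (simp add: open_fun_def)
  then obtain X where X: "x \<in> Pi\<^sub>E UNIV X" "finite {i. X i \<noteq> UNIV}" "Pi\<^sub>E UNIV X \<subseteq> U"
    using product_topology_open_contains_basis[OF _ assms(2), of "\<lambda>i. euclidean" UNIV] by auto
  then obtain n where n: "\<And>i. X i \<noteq> UNIV \<Longrightarrow> i < n"
    using finite_nat_set_iff_bounded[of "{i. X i \<noteq> UNIV}"] by auto
  have "y i \<in> X i" if "y \<in> cylinder (map x [0..<n])" for y i
    using that X(1) n[of i] by (cases "X i = UNIV") (auto simp: cylinder_def PiE_iff)
  then have "cylinder (map x [0..<n]) \<subseteq> U" using X(3) by (auto simp: PiE_iff)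
  then show ?thesis by blast
qed

text \<open>Every open set is the union of the cylinders inside it, and this union is countable
  because words over a finite alphabet are.\<close>

lemma sets_borel_cylinder:
  "sets (borel :: (nat \<Rightarrow> 'a::{finite, discrete_topology}) measure) = sigma_sets UNIV (range cylinder)"
proof
  show "sigma_sets UNIV (range cylinder) \<subseteq> sets (borel :: (nat \<Rightarrow> 'a) measure)"
    by (intro sets.sigma_sets_subset[of _ borel, simplified]) (auto intro: borel_open open_cylinder)
  have "U \<in> sigma_sets UNIV (range cylinder)" if "open U" for U :: "(nat \<Rightarrow> 'a) set"
  proof -
    have "U = (\<Union>I\<in>{I. cylinder I \<subseteq> U}. cylinder I)"
    proof (intro set_eqI iffI)
      fix x assume "x \<in> U"
      then obtain n where "cylinder (map x [0..<n]) \<subseteq> U" using open_contains_cylinder[OF \<open>open U\<close>] by blast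
      moreover have "x \<in> cylinder (map x [0..<n])" by (simp add: cylinder_def)
      ultimately show "x \<in> (\<Union>I\<in>{I. cylinder I \<subseteq> U}. cylinder I)" by blast
    qed blast
    moreover have "(\<Union>I\<in>{I. cylinder I \<subseteq> U}. cylinder I) \<in> sigma_sets UNIV (range cylinder)"
      by (intro sigma_sets_UNION) auto
    ultimately show ?thesis by simp
  qed
  then show "sets (borel :: (nat \<Rightarrow> 'a) measure) \<subseteq> sigma_sets UNIV (range cylinder)"
    unfolding borel_def by (subst sets_measure_of) (auto intro!: sigma_sets_mono)
qed

lemma cylinder_in_sets [measurable]:
  "sets M = sets borel \<Longrightarrow> cylinder (I :: 'a::discrete_topology list) \<in> sets M"
  using open_cylinder[of I] by (simp add: borel_open)

text \<open>Two cylinders are nested or disjoint, so adding the empty set is enough for stability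
  under intersection.\<close>

lemma Int_stable_cylinder: "Int_stable (insert {} (range cylinder))"
proof (rule Int_stableI)
  fix A B :: "(nat \<Rightarrow> 'a) set"
  assume "A \<in> insert {} (range cylinder)" "B \<in> insert {} (range cylinder)"
  then consider "A = {} \<or> B = {}" | I J where "A = cylinder I" "B = cylinder J" by auto
  then show "A \<inter> B \<in> insert {} (range cylinder)"
  proof cases
    case 2
    then show ?thesis
      using cylinder_Int[of I J] cylinder_Int[of J I] by (cases "length I \<le> length J") (auto split: if_splits)
  qed auto
qed

section \<open>Invariant measures and their cylinder weights\<close>

definition weights :: "(nat \<Rightarrow> 'a) measure \<Rightarrow> 'a list \<Rightarrow> real" where
  "weights M I = measure M (cylinder I)"

lemma prob_measure_eqI_weights:
  fixes M N :: "(nat \<Rightarrow> 'a::{finite, discrete_topology}) measure"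
  assumes "sets M = sets borel" "sets N = sets borel" "prob_space M" "prob_space N"
    and eq: "\<And>I. weights M I = weights N I"
  shows "M = N"
proof (rule measure_eqI_generator_eq[OF Int_stable_cylinder, where \<Omega> = UNIV and A = "\<lambda>_. UNIV"])
  interpret M: prob_space M by fact
  interpret N: prob_space N by fact
  have gen: "sets (borel :: (nat \<Rightarrow> 'a) measure) = sigma_sets UNIV (insert {} (range cylinder))"
    unfolding sets_borel_cylinder
    by (rule sigma_sets_eqI) (auto intro: sigma_sets.Empty)
  show "sets M = sigma_sets UNIV (insert {} (range cylinder))"
    "sets N = sigma_sets UNIV (insert {} (range cylinder))" using assms gen by auto
  show "emeasure M X = emeasure N X" if "X \<in> insert {} (range cylinder)" for X
    using that eq by (auto simp: M.emeasure_eq_measure N.emeasure_eq_measure weights_def)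
  show "range (\<lambda>_. UNIV) \<subseteq> insert {} (range cylinder)"
    by (auto intro!: range_eqI[of _ _ "[]"])
  show "emeasure M UNIV \<noteq> \<infinity>" by simp
qed auto

lemma measure_UN_cylinder:
  fixes M :: "(nat \<Rightarrow> 'a::discrete_topology) measure"
  assumes "sets M = sets borel" "finite_measure M" "finite W" "\<And>I. I \<in> W \<Longrightarrow> length I = n"
  shows "measure M (\<Union>I\<in>W. cylinder I) = (\<Sum>I\<in>W. weights M I)"
proof -
  have "disjoint_family_on cylinder W"
    unfolding disjoint_family_on_def using cylinder_disjoint assms(4) by metis
  moreover have "cylinder ` W \<subseteq> sets M" using cylinder_in_sets[OF assms(1)] by blast
  ultimately show ?thesis
    unfolding weights_def by (intro finite_measure.finite_measure_finite_Union assms(2,3))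
qed

lemma continuous_left_shift:
  "continuous_on UNIV (left_shift :: (nat \<Rightarrow> 'a::topological_space) \<Rightarrow> _)"
  unfolding left_shift_def by (intro continuous_on_coordinatewise_then_product continuous_on_product_coordinates)

lemma measurable_left_shift:
  "(left_shift :: (nat \<Rightarrow> 'a::topological_space) \<Rightarrow> _) \<in> borel_measurable borel"
  by (intro borel_measurable_continuous_onI continuous_left_shift)

lemma weights_snoc:
  fixes M :: "(nat \<Rightarrow> 'a::{finite, discrete_topology}) measure"
  assumes "sets M = sets borel" "finite_measure M"
  shows "(\<Sum>c\<in>UNIV. weights M (w @ [c])) = weights M w"
proof -
  have "cylinder w = (\<Union>I\<in>(\<lambda>c. w @ [c]) ` UNIV. cylinder I)"
    unfolding cylinder_eq_UN_extend[of w 1] words_1 by simp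
  then have "weights M w = measure M (\<Union>I\<in>(\<lambda>c. w @ [c]) ` UNIV. cylinder I)"
    unfolding weights_def by (rule arg_cong)
  also have "\<dots> = (\<Sum>I\<in>(\<lambda>c. w @ [c]) ` UNIV. weights M I)"
    by (intro measure_UN_cylinder[OF assms, of _ "Suc (length w)"]) auto
  finally have "weights M w = (\<Sum>I\<in>(\<lambda>c. w @ [c]) ` UNIV. weights M I)" .
  then show ?thesis by (simp add: sum.reindex inj_on_def)
qed

lemma weights_Cons:
  fixes M :: "(nat \<Rightarrow> 'a::{finite, discrete_topology}) measure"
  assumes "sets M = sets borel" "finite_measure M"
  shows "(\<Sum>c\<in>UNIV. weights M (c # w)) = weights (distr M borel left_shift) w"
proof -
  have "left_shift -` cylinder w \<inter> space M = (\<Union>I\<in>(\<lambda>c. c # w) ` UNIV. cylinder I)"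
    using assms(1)[THEN sets_eq_imp_space_eq] by (auto simp: vimage_shift_cylinder)
  moreover have "left_shift \<in> measurable M borel"
    using measurable_left_shift by (simp cong: measurable_cong_sets add: assms(1))
  ultimately have "weights (distr M borel left_shift) w
      = measure M (\<Union>I\<in>(\<lambda>c. c # w) ` UNIV. cylinder I)"
    by (simp add: weights_def measure_distr cylinder_in_sets)
  also have "\<dots> = (\<Sum>I\<in>(\<lambda>c. c # w) ` UNIV. weights M I)"
    by (intro measure_UN_cylinder[OF assms, of _ "Suc (length w)"]) auto
  finally have "weights (distr M borel left_shift) w = (\<Sum>I\<in>(\<lambda>c. c # w) ` UNIV. weights M I)" .
  then show ?thesis by (simp add: sum.reindex inj_on_def)
qed

lemma invariant_measuresD:
  assumes "M \<in> invariant_measures T"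
  shows "sets M = sets borel" "prob_space M" "finite_measure M" "distr M borel T = M"
    "space M = UNIV"
  using assms sets_eq_imp_space_eq[of M borel]
  by (auto simp: invariant_measures_def intro: prob_space.finite_measure)

lemma weights_stationary:
  fixes M :: "(nat \<Rightarrow> 'a::{finite, discrete_topology}) measure"
  assumes "M \<in> invariant_measures left_shift"
  shows "stationary_weights UNIV (weights M)"
proof -
  note M = invariant_measuresD[OF assms]
  have "weights M [] = 1" using prob_space.prob_space[OF M(2)] M(5) by (simp add: weights_def)
  then show ?thesis
    using weights_snoc[OF M(1,3)] weights_Cons[OF M(1,3)] M(4)
    by (auto simp: stationary_weights_def) (simp add: weights_def)
qed

lemma invariant_if_weights_stationary:
  fixes M :: "(nat \<Rightarrow> 'a::{finite, discrete_topology}) measure"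
  assumes M: "sets M = sets borel" "prob_space M" and w: "stationary_weights UNIV (weights M)"
  shows "M \<in> invariant_measures left_shift"
proof -
  have fin: "finite_measure M" using M(2) by (rule prob_space.finite_measure)
  have meas: "left_shift \<in> measurable M borel"
    using measurable_left_shift by (simp cong: measurable_cong_sets add: M(1))
  have "distr M borel left_shift = M"
    using M meas weights_Cons[OF M(1) fin] stationary_weightsD(4)[OF w]
    by (intro prob_measure_eqI_weights prob_space.prob_space_distr) auto
  then show ?thesis using M measurable_left_shift by (auto simp: invariant_measures_def)
qed

text \<open>Kolmogorov's extension theorem: consistency on the right makes the laws of the prefixes
  a projective family, and consistency on the left makes the limit measure shift invariant.\<close>

lemma exists_measure_of_weights:
  fixes p :: "'a::{finite, discrete_topology} list \<Rightarrow> real"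
  assumes p: "stationary_weights UNIV p"
  obtains M where "M \<in> invariant_measures left_shift" "weights M = p"
proof -
  have nonneg: "0 \<le> p w" for w using stationary_weightsD(2)[OF p] by simp
  define q where "q n = embed_pmf (\<lambda>w. if length w = n then p w else 0)" for n
  have pmf_q: "pmf (q n) w = (if length w = n then p w else 0)" for n w
    unfolding q_def
  proof (rule pmf_embed_pmf)
    have "(\<integral>\<^sup>+ w. ennreal (if length w = n then p w else 0) \<partial>count_space UNIV)
        = (\<Sum>w\<in>words UNIV n. ennreal (if length w = n then p w else 0))"
      by (rule nn_integral_count_space'[OF finite_words[OF finite_class.finite_UNIV]]) (auto simp: words_def)
    also have "\<dots> = (\<Sum>w\<in>words UNIV n. ennreal (p w))" by (rule sum.cong) (auto simp: words_def)
    also have "\<dots> = 1" using stationary_weights_sum[OF p] nonneg by simp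
    finally show "(\<integral>\<^sup>+ w. ennreal (if length w = n then p w else 0) \<partial>count_space UNIV) = 1" .
  qed (use nonneg in auto)
  have set_q: "set_pmf (q n) \<subseteq> words UNIV n" for n
    using pmf_q by (auto simp: set_pmf_iff words_def split: if_splits)
  have meas_q: "measure (q n) A = (\<Sum>w\<in>words UNIV n \<inter> A. p w)" for n A
  proof -
    have "measure (q n) A = measure (q n) (words UNIV n \<inter> A)"
      using set_q[of n] by (intro measure_pmf.finite_measure_eq_AE) (auto simp: AE_measure_pmf_iff)
    also have "\<dots> = (\<Sum>w\<in>words UNIV n \<inter> A. pmf (q n) w)" by (simp add: measure_measure_pmf_finite)
    also have "\<dots> = (\<Sum>w\<in>words UNIV n \<inter> A. p w)" by (rule sum.cong) (auto simp: pmf_q words_def)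
    finally show ?thesis .
  qed
  have map_q: "map_pmf (take n) (q m) = q n" if "n \<le> m" for n m
  proof (rule pmf_eqI)
    fix w :: "'a list"
    have "pmf (map_pmf (take n) (q m)) w = (\<Sum>v\<in>words UNIV m \<inter> take n -` {w}. p v)"
      by (simp add: pmf_map meas_q)
    also have "\<dots> = pmf (q n) w"
    proof (cases "length w = n")
      case True
      have "words UNIV m \<inter> take n -` {w} = (\<lambda>v. w @ v) ` words UNIV (m - n)"
      proof (intro set_eqI iffI)
        fix v assume "v \<in> words UNIV m \<inter> take n -` {w}"
        then have "take n v = w" "length v = m" by (auto simp: words_def)
        then have "v = w @ drop n v" "drop n v \<in> words UNIV (m - n)"
          using append_take_drop_id[of n v] by (auto simp: words_def)
        then show "v \<in> (\<lambda>v. w @ v) ` words UNIV (m - n)" by blast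
      qed (use True that in \<open>auto simp: words_def\<close>)
      then show ?thesis
        using True stationary_weights_append_right[OF p, of w] by (simp add: pmf_q sum.reindex inj_on_def)
    next
      case False
      then have "words UNIV m \<inter> take n -` {w} = {}" using that by (auto simp: words_def)
      then show ?thesis using False by (simp add: pmf_q)
    qed
    finally show "pmf (map_pmf (take n) (q m)) w = pmf (q n) w" .
  qed
  \<comment> \<open>The projective limit is formed over a Polish coordinate space, so letters are
    coded as reals by \<open>e\<close> and the limit is decoded by \<open>d\<close>.\<close>
  define e :: "'a \<Rightarrow> real" where "e c = real (to_nat c)" for c
  define d :: "real \<Rightarrow> 'a" where "d r = from_nat (nat \<lfloor>r\<rfloor>)" for r
  have de: "d (e c) = c" for c by (simp add: d_def e_def)
  have d_meas [measurable]: "d \<in> measurable borel (count_space UNIV)" unfolding d_def by measurable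
  \<comment> \<open>The least word length that reaches all coordinates in \<open>J\<close>. The
    finite-dimensional law \<open>P J\<close> is read off words of that length.\<close>
  define N where "N J = (if J = {} then 0 else Suc (Max J))" for J :: "nat set"
  have N: "j < N J" if "finite J" "j \<in> J" for j J using that by (auto simp: N_def less_Suc_eq_le)
  have N_mono: "N J \<le> N H" if "J \<subseteq> H" "finite H" for J H
    using that by (auto simp: N_def intro: Max_mono)
  have N_less: "N {..<n} = n" for n
  proof (cases n)
    case (Suc m)
    have "Max {..<Suc m} = m" by (rule Max_eqI) auto
    moreover have "{..<Suc m} \<noteq> {}" by blast
    ultimately show ?thesis using Suc by (simp add: N_def)
  qed (simp add: N_def)
  define P where "P J = distr (measure_pmf (q (N J))) (PiM J (\<lambda>_. borel)) (\<lambda>w. \<lambda>j\<in>J. e (w ! j))" for J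
  have meas: "(\<lambda>w. \<lambda>j\<in>J. e (w ! j)) \<in> measurable (measure_pmf (q n)) (PiM J (\<lambda>_. borel))" for J n
    by (intro measurable_restrict) simp
  \<comment> \<open>Any longer words give the same law on \<open>J\<close>. This independence of the
    length is what projectivity amounts to.\<close>
  have P_take: "P J = distr (measure_pmf (q m)) (PiM J (\<lambda>_. borel)) (\<lambda>w. \<lambda>j\<in>J. e (w ! j))"
    if "finite J" "N J \<le> m" for J m
  proof -
    have "P J = distr (distr (measure_pmf (q m)) (count_space UNIV) (take (N J)))
        (PiM J (\<lambda>_. borel)) (\<lambda>w. \<lambda>j\<in>J. e (w ! j))"
      unfolding P_def map_q[OF that(2), symmetric] map_pmf_rep_eq ..
    also have "\<dots> = distr (measure_pmf (q m)) (PiM J (\<lambda>_. borel))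
        ((\<lambda>w. \<lambda>j\<in>J. e (w ! j)) \<circ> take (N J))"
      by (intro distr_distr measurable_restrict) (auto simp: space_PiM)
    also have "(\<lambda>w. \<lambda>j\<in>J. e (w ! j)) \<circ> take (N J) = (\<lambda>w. \<lambda>j\<in>J. e (w ! j))"
      using N[OF that(1)] by (auto simp: fun_eq_iff restrict_def)
    finally show ?thesis .
  qed
  interpret PP: polish_projective UNIV P
  proof (rule polish_projective.intro, rule projective_family.intro)
    fix J H :: "nat set" assume JH: "J \<subseteq> H" "finite H"
    have "distr (P H) (PiM J (\<lambda>_. borel)) (\<lambda>f. restrict f J)
      = distr (measure_pmf (q (N H))) (PiM J (\<lambda>_. borel)) ((\<lambda>f. restrict f J) \<circ> (\<lambda>w. \<lambda>j\<in>H. e (w ! j)))"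
      unfolding P_def using JH(1) by (intro distr_distr meas measurable_restrict_subset)
    also have "(\<lambda>f. restrict f J) \<circ> (\<lambda>w. \<lambda>j\<in>H. e (w ! j)) = (\<lambda>w. \<lambda>j\<in>J. e (w ! j))"
      using JH(1) by (auto simp: fun_eq_iff restrict_def)
    also have "distr (measure_pmf (q (N H))) (PiM J (\<lambda>_. borel)) (\<lambda>w. \<lambda>j\<in>J. e (w ! j)) = P J"
      using JH N_mono[OF JH] by (intro P_take[symmetric]) (auto intro: finite_subset)
    finally show "P J = distr (P H) (PiM J (\<lambda>_. borel)) (\<lambda>f. restrict f J)" ..
  next
    show "prob_space (P J)" for J
      unfolding P_def by (intro measure_pmf.prob_space_distr meas)
  qed
  have sets_lim' [measurable_cong]: "sets PP.lim = sets (PiM UNIV (\<lambda>_. borel))" by (rule PP.sets_lim)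
  have space_lim': "space PP.lim = UNIV" using sets_eq_imp_space_eq[OF sets_lim'] by (simp add: space_PiM)
  let ?D = "\<lambda>x i. d (x i)"
  have vim: "?D -` cylinder w = {x. \<forall>i<length w. d (x i) = w ! i}" for w
    by (auto simp: cylinder_def)
  have D: "?D \<in> measurable PP.lim borel"
  proof (rule measurable_sigma_sets[OF sets_borel_cylinder])
    show "?D -` y \<inter> space PP.lim \<in> sets PP.lim" if range: "y \<in> range cylinder" for y :: "(nat \<Rightarrow> 'a) set"
    proof -
      obtain w where y: "y = cylinder w" using range by (rule rangeE)
      have comp: "(\<lambda>x. d (x i)) \<in> measurable PP.lim (count_space UNIV)" for i
        unfolding measurable_cong_sets[OF sets_lim' refl]
        by (intro measurable_compose[OF _ d_meas] measurable_component_singleton) auto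
      have "{x \<in> space PP.lim. \<forall>i\<in>{..<length w}. d (x i) = w ! i} \<in> sets PP.lim"
      proof (rule sets.sets_Collect_finite_All)
        show "{x \<in> space PP.lim. d (x i) = w ! i} \<in> sets PP.lim" for i
          using measurable_sets[OF comp[of i], of "{w ! i}"] by (simp add: vimage_def Int_def conj_commute)
      qed simp
      then show ?thesis unfolding y vim by (simp add: space_lim' Ball_def)
    qed
  qed auto
  define M where "M = distr PP.lim borel ?D"
  have M: "sets M = sets borel" "prob_space M"
    unfolding M_def using D by (auto intro: PP.P.prob_space_distr)
  have "weights M w = p w" for w
  proof -
    let ?n = "length w"
    let ?X = "{x \<in> space (PiM {..<?n} (\<lambda>_. borel)). \<forall>i<?n. d (x i) = w ! i}"
    have comp: "(\<lambda>x. d (x i)) \<in> measurable (PiM {..<?n} (\<lambda>_. borel)) (count_space UNIV)"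
      if "i < ?n" for i
      using that by (intro measurable_compose[OF _ d_meas] measurable_component_singleton) auto
    have "{x \<in> space (PiM {..<?n} (\<lambda>_. borel)). \<forall>i\<in>{..<?n}. d (x i) = w ! i}
        \<in> sets (PiM {..<?n} (\<lambda>_. borel))"
    proof (rule sets.sets_Collect_finite_All)
      fix i assume "i \<in> {..<?n}"
      then show "{x \<in> space (PiM {..<?n} (\<lambda>_. borel)). d (x i) = w ! i} \<in> sets (PiM {..<?n} (\<lambda>_. borel))"
        using measurable_sets[OF comp[of i], of "{w ! i}"] by (simp add: vimage_def Int_def conj_commute)
    qed simp
    then have X: "?X \<in> sets (PiM {..<?n} (\<lambda>_. borel))" by (simp add: Ball_def)
    have emb: "prod_emb UNIV (\<lambda>_. borel) {..<?n} ?X = ?D -` cylinder w"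
      unfolding vim by (auto simp: prod_emb_def space_PiM PiE_def)
    have "emeasure M (cylinder w) = emeasure PP.lim (?D -` cylinder w)"
      unfolding M_def using D by (subst emeasure_distr) (auto simp: space_lim'[simplified] cylinder_in_sets space_PiM)
    also have "\<dots> = emeasure (P {..<?n}) ?X"
      unfolding emb[symmetric] using X by (intro PP.emeasure_lim_emb) auto
    also have "\<dots> = emeasure (q ?n) {v. \<forall>i<?n. v ! i = w ! i}"
      unfolding P_def N_less using X
      by (subst emeasure_distr[OF meas]) (auto simp: space_PiM de intro!: arg_cong2[where f = emeasure])
    also have "\<dots> = ennreal (\<Sum>v\<in>words UNIV ?n \<inter> {v. \<forall>i<?n. v ! i = w ! i}. p v)"
      by (simp add: measure_pmf.emeasure_eq_measure meas_q)
    also have "words UNIV ?n \<inter> {v. \<forall>i<?n. v ! i = w ! i} = {w}"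
      by (auto simp: words_def intro: nth_equalityI)
    finally show ?thesis using nonneg by (simp add: weights_def measure_def)
  qed
  then have "weights M = p" by auto
  then show ?thesis using that[of M] invariant_if_weights_stationary[OF M] p by simp
qed

section \<open>Images of measures under letterwise maps\<close>

lemma finite_map_fibre [simp, intro]: "finite {I :: 'a::finite list. map f I = J}"
  by (rule finite_subset[OF _ finite_words[OF finite_class.finite_UNIV, of "length J"]]) (auto simp: words_def)

definition push_weights :: "('a \<Rightarrow> 'd) \<Rightarrow> ('a list \<Rightarrow> real) \<Rightarrow> 'd list \<Rightarrow> real" where
  "push_weights f p J = (\<Sum>I | map f I = J. p I)"

lemma weights_distr_letterwise:
  fixes M :: "(nat \<Rightarrow> 'a::{finite, discrete_topology}) measure"
    and \<pi> :: "(nat \<Rightarrow> 'a) \<Rightarrow> (nat \<Rightarrow> 'd::{finite, discrete_topology})"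
  assumes "sets M = sets borel" "finite_measure M" "continuous_on UNIV \<pi>" "\<And>x i. \<pi> x i = f (x i)"
  shows "weights (distr M borel \<pi>) = push_weights f (weights M)"
proof
  fix J
  have meas: "\<pi> \<in> measurable M borel"
    using borel_measurable_continuous_onI[OF assms(3)] by (simp cong: measurable_cong_sets add: assms(1))
  have "\<pi> -` cylinder J \<inter> space M = (\<Union>I\<in>{I. map f I = J}. cylinder I)"
  proof (intro set_eqI iffI)
    fix x assume "x \<in> \<pi> -` cylinder J \<inter> space M"
    then have "map f (map x [0..<length J]) = J" "x \<in> cylinder (map x [0..<length J])"
      using assms(4) by (auto simp: cylinder_def intro!: nth_equalityI)
    then show "x \<in> (\<Union>I\<in>{I. map f I = J}. cylinder I)" by blast
  next
    fix x assume "x \<in> (\<Union>I\<in>{I. map f I = J}. cylinder I)"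
    then show "x \<in> \<pi> -` cylinder J \<inter> space M"
      using assms(4) sets_eq_imp_space_eq[OF assms(1)] by (auto simp: cylinder_def)
  qed
  then have "weights (distr M borel \<pi>) J = measure M (\<Union>I\<in>{I. map f I = J}. cylinder I)"
    using meas by (simp add: weights_def measure_distr cylinder_in_sets)
  also have "\<dots> = push_weights f (weights M) J"
    unfolding push_weights_def by (intro measure_UN_cylinder[OF assms(1,2), of _ "length J"]) auto
  finally show "weights (distr M borel \<pi>) J = push_weights f (weights M) J" .
qed

section \<open>The Kolmogorov--Sinai theorem for the full shift\<close>

text \<open>With partition cells as letters, these sets take the place of the cylinders.\<close>

definition itinerary_set :: "(nat \<Rightarrow> 'a) set list \<Rightarrow> (nat \<Rightarrow> 'a) set" where
  "itinerary_set w = {x. \<forall>i<length w. (left_shift ^^ i) x \<in> w ! i}"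

lemma itinerary_set_Nil [simp]: "itinerary_set [] = UNIV"
  by (simp add: itinerary_set_def)

lemma itinerary_set_Cons: "itinerary_set (A # w) = A \<inter> left_shift -` itinerary_set w"
  by (auto simp: itinerary_set_def less_Suc_eq_0_disj funpow_swap1)

lemma itinerary_set_snoc:
  "itinerary_set (w @ [A]) = itinerary_set w \<inter> (left_shift ^^ length w) -` A"
  by (auto simp: itinerary_set_def nth_append less_Suc_eq)

text \<open>Given a guess \<open>B i\<close> at every position, letters are drawn independently from
  subprobabilities \<open>r\<close>; the resulting words have total mass at most one. This bounds
  the mass of the comparison weights in the coding argument.\<close>

lemma sum_words_prod_le_1:
  fixes r :: "'c \<Rightarrow> 'c \<Rightarrow> real"
  assumes "finite P" "\<And>A B. 0 \<le> r A B" "\<And>i. (\<Sum>A\<in>P. r A (B i)) \<le> 1"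
  shows "(\<Sum>w\<in>words P n. \<Prod>i<n. r (w ! i) (B i)) \<le> 1"
proof (induction n)
  case (Suc n)
  have "(\<Sum>w\<in>words P (Suc n). \<Prod>i<Suc n. r (w ! i) (B i))
    = (\<Sum>w\<in>words P n. (\<Prod>i<n. r (w ! i) (B i)) * (\<Sum>A\<in>P. r A (B n)))"
    unfolding sum_words_snoc sum_distrib_left
    by (intro sum.cong refl) (auto simp: words_def nth_append)
  also have "\<dots> \<le> (\<Sum>w\<in>words P n. (\<Prod>i<n. r (w ! i) (B i)) * 1)"
    using assms by (intro sum_mono mult_left_mono prod_nonneg) auto
  finally show ?case using Suc by simp
qed simp

text \<open>The events decided by the first \<open>N\<close> letters, an algebra that approximates
  all measurable sets. Words in \<open>W\<close> of another length have no effect.\<close>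

definition prefix_set :: "nat \<Rightarrow> 'a list set \<Rightarrow> (nat \<Rightarrow> 'a) set" where
  "prefix_set N W = {x. map x [0..<N] \<in> W}"

lemma prefix_set_eq_UN: "prefix_set N W = (\<Union>w\<in>W \<inter> words UNIV N. cylinder w)"
  unfolding prefix_set_def in_cylinder_iff[abs_def] words_def
  by (auto simp: in_cylinder_iff)

lemma prefix_set_take: "N \<le> N' \<Longrightarrow> prefix_set N W = prefix_set N' {v. take N v \<in> W}"
  by (simp add: prefix_set_def take_map)

context
  fixes M :: "(nat \<Rightarrow> 'a::{finite, discrete_topology}) measure"
  assumes M: "M \<in> invariant_measures left_shift"
begin

interpretation prob_space M by (rule invariant_measuresD(2)[OF M])

lemma measurable_shift_power: "left_shift ^^ i \<in> measurable M M"
proof (induction i)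
  case (Suc i)
  have "left_shift \<in> measurable M M"
    using measurable_left_shift by (simp cong: measurable_cong_sets add: invariant_measuresD(1)[OF M])
  then show ?case using Suc by (auto intro: measurable_comp)
qed (simp add: id_def)

lemma measure_shift_power:
  assumes "A \<in> sets M"
  shows "prob ((left_shift ^^ i) -` A) = prob A"
proof (induction i)
  case (Suc i)
  let ?B = "(left_shift ^^ i) -` A"
  have B: "?B \<in> sets M"
    using measurable_sets[OF measurable_shift_power assms] invariant_measuresD(5)[OF M] by simp
  have "prob ?B = measure (distr M borel left_shift) ?B" using invariant_measuresD(4)[OF M] by simp
  also have "\<dots> = prob (left_shift -` ?B)"
    using measurable_shift_power[of 1] B invariant_measuresD(1,5)[OF M]
    by (subst measure_distr) (auto cong: measurable_cong_sets)
  also have "left_shift -` ?B = (left_shift ^^ Suc i) -` A"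
    by (simp add: funpow_Suc_right vimage_comp del: funpow.simps)
  finally show ?case using Suc by (simp del: funpow.simps)
qed simp

lemma vimage_shift_sets: "A \<in> sets M \<Longrightarrow> (left_shift ^^ i) -` A \<in> sets M"
  using measurable_sets[OF measurable_shift_power, of A i] invariant_measuresD(5)[OF M] by simp

lemma itinerary_set_sets: "set w \<subseteq> sets M \<Longrightarrow> itinerary_set w \<in> sets M"
proof (induction w rule: rev_induct)
  case Nil
  show ?case using sets.top[of M] invariant_measuresD(5)[OF M] by simp
qed (auto simp: itinerary_set_snoc intro: vimage_shift_sets)

lemma prefix_set_sets: "prefix_set N W \<in> sets M"
  unfolding prefix_set_eq_UN
  by (intro sets.finite_UN) (auto intro: cylinder_in_sets[OF invariant_measuresD(1)[OF M]])

text \<open>Induction over the generated sigma-algebra. In a countable union, continuity from below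
  first leaves finitely many sets, which are then approximated one by one after bringing their
  prefixes to a common length.\<close>

lemma approximate_by_prefix_set:
  assumes "B \<in> sets M" "e > 0"
  shows "\<exists>N W. prob (sym_diff B (prefix_set N W)) < e"
proof -
  have "B \<in> sigma_sets UNIV (range cylinder)"
    using assms(1) invariant_measuresD(1)[OF M] sets_borel_cylinder by auto
  then show ?thesis using assms(2)
  proof (induction arbitrary: e rule: sigma_sets.induct)
    case (Basic B)
    then obtain w where "B = cylinder w" by auto
    then have "B = prefix_set (length w) {w}" by (auto simp: prefix_set_def in_cylinder_iff)
    then show ?case using Basic.prems by (intro exI[of _ "length w"] exI[of _ "{w}"]) simp
  next
    case Empty
    then show ?case by (intro exI[of _ 0] exI[of _ "{}"]) (simp add: prefix_set_def)
  next
    case (Compl B)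
    then obtain N W where NW: "prob (sym_diff B (prefix_set N W)) < e" by blast
    have "sym_diff (UNIV - B) (prefix_set N (- W)) = sym_diff B (prefix_set N W)"
      by (auto simp: prefix_set_def)
    then show ?case using NW by metis
  next
    case (Union A)
    have A: "A i \<in> sets M" for i
      using Union.hyps[of i] invariant_measuresD(1)[OF M] sets_borel_cylinder by auto
    have fin: "\<exists>N W. prob (sym_diff (\<Union>i<m. A i) (prefix_set N W)) < d" if "d > 0" for m :: nat and d
      using that
    proof (induction m arbitrary: d)
      case 0
      then show ?case by (intro exI[of _ 0] exI[of _ "{}"]) (simp add: prefix_set_def)
    next
      case (Suc m)
      obtain N W where NW: "prob (sym_diff (\<Union>i<m. A i) (prefix_set N W)) < d / 2"
        using Suc.IH[of "d / 2"] Suc.prems by auto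
      obtain N' W' where NW': "prob (sym_diff (A m) (prefix_set N' W')) < d / 2"
        using Union.IH[of "d / 2" m] Suc.prems by auto
      let ?K = "max N N'" and ?V = "{v. take N v \<in> W \<or> take N' v \<in> W'}"
      have V: "prefix_set ?K ?V = prefix_set N W \<union> prefix_set N' W'"
        using prefix_set_take[of N ?K W] prefix_set_take[of N' ?K W'] by (auto simp: prefix_set_def)
      have "prob (sym_diff (\<Union>i<Suc m. A i) (prefix_set ?K ?V))
        \<le> prob (sym_diff (\<Union>i<m. A i) (prefix_set N W) \<union> sym_diff (A m) (prefix_set N' W'))"
        unfolding V using A prefix_set_sets
        by (intro finite_measure_mono) (auto simp: lessThan_Suc intro!: sets.Un sets.Diff sets.finite_UN)
      also have "\<dots> \<le> prob (sym_diff (\<Union>i<m. A i) (prefix_set N W)) + prob (sym_diff (A m) (prefix_set N' W'))"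
        using A prefix_set_sets by (intro measure_Un_le) (auto intro!: sets.Un sets.Diff sets.finite_UN)
      finally show ?case using NW NW' by (intro exI[of _ ?K] exI[of _ ?V]) linarith
    qed
    let ?U = "\<Union>i. A i"
    have U: "?U \<in> sets M" using A by auto
    have "(\<lambda>m. prob (\<Union>i<m. A i)) \<longlonglongrightarrow> prob (\<Union>m. \<Union>i<m. A i)"
      using A by (intro finite_Lim_measure_incseq) (auto simp: incseq_def intro: order.strict_trans2)
    moreover have "(\<Union>m. \<Union>i<m. A i) = ?U" by auto
    ultimately have "(\<lambda>m. prob (\<Union>i<m. A i)) \<longlonglongrightarrow> prob ?U" by simp
    then obtain m where m: "dist (prob (\<Union>i<m. A i)) (prob ?U) < e / 2"
      using metric_LIMSEQ_D[of _ _ "e / 2"] Union.prems by (meson half_gt_zero order_refl)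
    obtain N W where NW: "prob (sym_diff (\<Union>i<m. A i) (prefix_set N W)) < e / 2"
      using fin[of "e / 2" m] Union.prems by auto
    have "prob (?U - (\<Union>i<m. A i)) = prob ?U - prob (\<Union>i<m. A i)"
      using A U by (intro finite_measure_Diff) auto
    then have Um: "prob (?U - (\<Union>i<m. A i)) < e / 2" using m unfolding dist_real_def by linarith
    have "prob (sym_diff ?U (prefix_set N W))
      \<le> prob ((?U - (\<Union>i<m. A i)) \<union> sym_diff (\<Union>i<m. A i) (prefix_set N W))"
      using A U prefix_set_sets by (intro finite_measure_mono) (auto intro!: sets.Un sets.Diff sets.finite_UN)
    also have "\<dots> \<le> prob (?U - (\<Union>i<m. A i)) + prob (sym_diff (\<Union>i<m. A i) (prefix_set N W))"
      using A U prefix_set_sets by (intro measure_Un_le) (auto intro!: sets.Un sets.Diff sets.finite_UN)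
    finally show ?case using NW Um by (intro exI[of _ N] exI[of _ W]) linarith
  qed
qed

section \<open>Itineraries of a finite measurable partition\<close>

context
  fixes P :: "(nat \<Rightarrow> 'a) set set"
  assumes finP: "finite P" and Psets: "P \<subseteq> sets M" and part: "partition_on UNIV P"
begin

lemma sum_partition_vimage:
  assumes "B \<in> sets M"
  shows "(\<Sum>A\<in>P. prob (B \<inter> (left_shift ^^ i) -` A)) = prob B"
proof -
  have "prob (\<Union>A\<in>P. B \<inter> (left_shift ^^ i) -` A) = (\<Sum>A\<in>P. prob (B \<inter> (left_shift ^^ i) -` A))"
  proof (intro finite_measure_finite_Union finP)
    show "(\<lambda>A. B \<inter> (left_shift ^^ i) -` A) ` P \<subseteq> sets M"
      using assms Psets by (auto intro!: sets.Int vimage_shift_sets)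
    show "disjoint_family_on (\<lambda>A. B \<inter> (left_shift ^^ i) -` A) P"
      using part by (auto simp: disjoint_family_on_def partition_on_def disjoint_def)
  qed
  moreover have "(\<Union>A\<in>P. B \<inter> (left_shift ^^ i) -` A) = B"
    using part by (auto simp: partition_on_def)
  ultimately show ?thesis by simp
qed

lemma itinerary_stationary: "stationary_weights P (\<lambda>w. prob (itinerary_set w))"
  unfolding stationary_weights_def
proof (intro conjI ballI)
  show "prob (itinerary_set []) = 1" using prob_space invariant_measuresD(5)[OF M] by simp
  fix w assume "w \<in> lists P"
  then have w: "itinerary_set w \<in> sets M" using Psets by (intro itinerary_set_sets) auto
  show "(\<Sum>A\<in>P. prob (itinerary_set (w @ [A]))) = prob (itinerary_set w)"
    using sum_partition_vimage[OF w] by (simp add: itinerary_set_snoc)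
  have "(\<Sum>A\<in>P. prob (left_shift -` itinerary_set w \<inter> A)) = prob (left_shift -` itinerary_set w)"
    using sum_partition_vimage[OF vimage_shift_sets[OF w, of 1], of 0] by simp
  then show "(\<Sum>A\<in>P. prob (itinerary_set (A # w))) = prob (itinerary_set w)"
    using measure_shift_power[OF w, of 1] by (simp add: itinerary_set_Cons Int_commute)
qed simp

lemma dynamical_join_eq:
  assumes n: "n \<ge> 1"
  shows "dynamical_join M left_shift P n = itinerary_set ` words P n - {{}}"
proof -
  let ?Q = "\<lambda>i. (\<lambda>A. (left_shift ^^ i) -` A) ` P"
  have pre: "preimage_partition M (left_shift ^^ i) P = ?Q i" for i
    by (simp add: preimage_partition_def invariant_measuresD(5)[OF M])
  have eq: "dynamical_join M left_shift P n
    = (\<Union>f \<in> (\<Pi> Q\<in>?Q ` {..<n}. Q). {\<Inter> (f ` ?Q ` {..<n})}) - {{}}"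
    unfolding dynamical_join_def pre common_refinement ..
  show ?thesis unfolding eq
  proof (intro set_eqI iffI)
    fix X assume "X \<in> (\<Union>f \<in> (\<Pi> Q\<in>?Q ` {..<n}. Q). {\<Inter> (f ` ?Q ` {..<n})}) - {{}}"
    then obtain f where f: "f \<in> (\<Pi> Q\<in>?Q ` {..<n}. Q)" "X = \<Inter> (f ` ?Q ` {..<n})" "X \<noteq> {}" by blast
    have "\<exists>A\<in>P. f (?Q i) = (left_shift ^^ i) -` A" if "i < n" for i
    proof -
      have "f (?Q i) \<in> ?Q i" by (rule Pi_mem[OF f(1)]) (use that in blast)
      then show ?thesis by blast
    qed
    then obtain A where A: "\<And>i. i < n \<Longrightarrow> A i \<in> P \<and> f (?Q i) = (left_shift ^^ i) -` A i" by metis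
    have "X = itinerary_set (map A [0..<n])"
      unfolding f(2) itinerary_set_def using A by auto
    moreover have "map A [0..<n] \<in> words P n" using A by (auto simp: words_def)
    ultimately show "X \<in> itinerary_set ` words P n - {{}}" using f(3) by blast
  next
    fix X assume "X \<in> itinerary_set ` words P n - {{}}"
    then obtain w where w: "w \<in> words P n" "X = itinerary_set w" "X \<noteq> {}" by blast
    then obtain x where x: "x \<in> itinerary_set w" by blast
    have wP: "w ! i \<in> P" if "i < n" for i using w(1) that by (auto simp: words_def)
    \<comment> \<open>A common refinement selects one cell per partition, not per time. Selecting
      the cell that contains the fixed point \<open>x\<close> keeps this consistent when the
      preimage partitions of several times coincide.\<close>
    define f where "f Q = (THE B. B \<in> Q \<and> x \<in> B)" for Q
    have f: "f (?Q i) = (left_shift ^^ i) -` (w ! i)" if i: "i < n" for i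
      unfolding f_def
    proof (rule the_equality)
      show "(left_shift ^^ i) -` (w ! i) \<in> ?Q i \<and> x \<in> (left_shift ^^ i) -` (w ! i)"
        using wP[OF i] x i w(1) by (auto simp: itinerary_set_def words_def)
      fix B assume "B \<in> ?Q i \<and> x \<in> B"
      then obtain A where A: "A \<in> P" "B = (left_shift ^^ i) -` A" "(left_shift ^^ i) x \<in> A" by auto
      moreover have "(left_shift ^^ i) x \<in> w ! i" using x i w(1) by (auto simp: itinerary_set_def words_def)
      ultimately have "A = w ! i" using wP[OF i] part by (auto simp: partition_on_def disjoint_def)
      then show "B = (left_shift ^^ i) -` (w ! i)" using A by simp
    qed
    have "f \<in> (\<Pi> Q\<in>?Q ` {..<n}. Q)" using f wP by auto
    moreover have "X = \<Inter> (f ` ?Q ` {..<n})"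
      unfolding w(2) itinerary_set_def using f w(1) by (auto simp: words_def)
    ultimately show "X \<in> (\<Union>f \<in> (\<Pi> Q\<in>?Q ` {..<n}. Q). {\<Inter> (f ` ?Q ` {..<n})}) - {{}}"
      using w(3) by blast
  qed
qed

lemma itinerary_set_disjoint:
  assumes "w \<in> words P n" "v \<in> words P n" "w \<noteq> v"
  shows "itinerary_set w \<inter> itinerary_set v = {}"
proof -
  obtain i where i: "i < n" "w ! i \<noteq> v ! i"
    using assms nth_equalityI[of w v] by (auto simp: words_def)
  moreover have "w ! i \<in> P" "v ! i \<in> P" using assms(1,2) i(1) by (auto simp: words_def)
  ultimately have "w ! i \<inter> v ! i = {}"
    using part by (auto simp: partition_on_def disjoint_def)
  moreover have "(left_shift ^^ i) x \<in> w ! i \<inter> v ! i"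
    if "x \<in> itinerary_set w" "x \<in> itinerary_set v" for x
    using that i assms by (simp add: itinerary_set_def words_def)
  ultimately show ?thesis by blast
qed

lemma partition_entropy_dynamical_join:
  assumes "n \<ge> 1"
  shows "partition_entropy M (dynamical_join M left_shift P n)
    = word_entropy P (\<lambda>w. prob (itinerary_set w)) n"
proof -
  let ?F = "\<lambda>X. prob X * ln (prob X)"
  let ?W = "{w \<in> words P n. itinerary_set w \<noteq> {}}"
  have "dynamical_join M left_shift P n = itinerary_set ` ?W"
    unfolding dynamical_join_eq[OF assms] by auto
  moreover have "inj_on itinerary_set ?W"
    by (rule inj_onI) (use itinerary_set_disjoint in fastforce)
  ultimately have "sum ?F (dynamical_join M left_shift P n) = (\<Sum>w\<in>?W. ?F (itinerary_set w))"
    by (simp add: sum.reindex)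
  also have "\<dots> = (\<Sum>w\<in>words P n. ?F (itinerary_set w))"
    using finP by (intro sum.mono_neutral_left) auto
  finally show ?thesis by (simp add: partition_entropy_def word_entropy_def)
qed

lemma entropy_wrt_partition_eq:
  "entropy_wrt_partition M left_shift P = entropy_rate P (\<lambda>w. prob (itinerary_set w))"
proof -
  let ?p = "\<lambda>w. prob (itinerary_set w)"
  have "(\<lambda>n. partition_entropy M (dynamical_join M left_shift P n) / real n)
      \<longlonglongrightarrow> entropy_rate P ?p"
    using entropy_rate_tendsto[OF itinerary_stationary finP]
    by (rule Lim_transform_eventually)
       (intro eventually_sequentiallyI[of 1], simp add: partition_entropy_dynamical_join)
  then show ?thesis unfolding entropy_wrt_partition_def by (rule limI)
qed

section \<open>Coding itineraries by letters\<close>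

lemma sum_prob_Int_disjoint_cover:
  assumes "finite I" "B \<in> sets M" "A ` I \<subseteq> sets M" "disjoint_family_on A I" "(\<Union>i\<in>I. A i) = UNIV"
  shows "(\<Sum>i\<in>I. prob (B \<inter> A i)) = prob B"
proof -
  have "prob (\<Union>i\<in>I. B \<inter> A i) = (\<Sum>i\<in>I. prob (B \<inter> A i))"
    using assms by (intro finite_measure_finite_Union) (auto simp: disjoint_family_on_def)
  moreover have "(\<Union>i\<in>I. B \<inter> A i) = B" using assms(5) by auto
  ultimately show ?thesis by simp
qed

lemma UN_itinerary_set: "(\<Union>w\<in>words P n. itinerary_set w) = UNIV"
proof -
  define c where "c x i = (SOME A. A \<in> P \<and> (left_shift ^^ i) x \<in> A)" for x i
  have "\<exists>A. A \<in> P \<and> (left_shift ^^ i) x \<in> A" for x i using part by (auto simp: partition_on_def)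
  then have c: "c x i \<in> P \<and> (left_shift ^^ i) x \<in> c x i" for x i
    unfolding c_def by (rule someI_ex)
  have "x \<in> itinerary_set (map (c x) [0..<n])" "map (c x) [0..<n] \<in> words P n" for x
    using c by (auto simp: itinerary_set_def words_def)
  then show ?thesis by blast
qed

text \<open>A Fano-type estimate. Given the first \<open>n + N\<close> letters, \<open>G\<close>
  guesses the cell at each time below n from the next \<open>N\<close> letters, and a noisy channel
  corrects the guess. Gibbs' inequality for the joint law of itinerary and letters bounds the joint
  entropy by the letter entropy plus the expected cost of correction: -ln (1 - \<delta>) per time,
  and at most ln (card P / \<delta>) more at each wrong guess.\<close>

lemma word_entropy_coding_bound:
  assumes G: "\<And>v. G v \<in> P" and \<delta>: "0 < \<delta>" "\<delta> < 1"
  shows "word_entropy P (\<lambda>w. prob (itinerary_set w)) n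
    \<le> word_entropy UNIV (weights M) (n + N)
      + n * (- ln (1 - \<delta>) + prob {x. x \<notin> G (map x [0..<N])} * ln (card P / \<delta>))"
proof -
  define u where "u w = prob (itinerary_set w)" for w
  define j where "j w z = prob (itinerary_set w \<inter> cylinder z)" for w z
  let ?p = "weights M" and ?L = "n + N"
  let ?W = "words P n" and ?Z = "words (UNIV :: 'a set) (n + N)"
  let ?E = "{x. x \<notin> G (map x [0..<N])}"
  define k where "k = real (card P)"
  have "P \<noteq> {}" using part by (auto simp: partition_on_def)
  then have k: "k \<ge> 1" using finP by (simp add: k_def Suc_le_eq card_gt_0_iff)
  \<comment> \<open>The guess \<open>B\<close> gets mass 1 - \<delta>; each of the fewer than
    \<open>k\<close> other cells gets \<delta> / k, so the total stays at most one and no cell has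
    mass zero.\<close>
  define r where "r A B = (if A = B then 1 - \<delta> else \<delta> / k)" for A B :: "(nat \<Rightarrow> 'a) set"
  define g where "g i z = G (take N (drop i z))" for i and z :: "'a list"
  define q where "q w z = ?p z * (\<Prod>i<n. r (w ! i) (g i z))" for w z
  have r_pos: "0 < r A B" for A B using \<delta> k by (simp add: r_def)
  have r_sum: "(\<Sum>A\<in>P. r A B) \<le> 1" if "B \<in> P" for B
  proof -
    have "(\<Sum>A\<in>P. r A B) = r B B + (\<Sum>A\<in>P - {B}. r A B)" using that finP by (simp add: sum.remove)
    also have "(\<Sum>A\<in>P - {B}. r A B) = (\<Sum>A\<in>P - {B}. \<delta> / k)" by (rule sum.cong) (auto simp: r_def)
    also have "\<dots> \<le> (\<Sum>A\<in>P. \<delta> / k)" using finP \<delta> k by (intro sum_mono2) auto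
    also have "\<dots> = \<delta>" using k by (simp add: k_def)
    finally show ?thesis by (simp add: r_def)
  qed
  have sets_it: "itinerary_set w \<in> sets M" if "w \<in> ?W" for w
    using that Psets by (intro itinerary_set_sets) (auto simp: words_def)
  have sets_cy: "cylinder z \<in> sets M" for z :: "'a list"
    by (rule cylinder_in_sets[OF invariant_measuresD(1)[OF M]])
  have fin: "finite ?W" "finite ?Z" using finP by auto
  have cy_disj: "disjoint_family_on cylinder ?Z"
    unfolding disjoint_family_on_def using cylinder_disjoint words_length by metis
  have it_disj: "disjoint_family_on itinerary_set ?W"
    unfolding disjoint_family_on_def using itinerary_set_disjoint by blast
  have sum_z: "(\<Sum>z\<in>?Z. j w z) = u w" if "w \<in> ?W" for w
    unfolding j_def u_def using fin cy_disj sets_cy sets_it[OF that] cylinder_eq_UN_extend[of "[]" ?L]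
    by (intro sum_prob_Int_disjoint_cover) auto
  have sum_w: "(\<Sum>w\<in>?W. j w z) = ?p z" for z
    unfolding j_def weights_def Int_commute[of _ "cylinder z"]
    using fin it_disj sets_cy sets_it UN_itinerary_set
    by (intro sum_prob_Int_disjoint_cover) auto
  have j0: "0 \<le> j w z" for w z by (simp add: j_def)
  have j_le: "j w z \<le> u w" "j w z \<le> ?p z" if "w \<in> ?W" for w z
    unfolding j_def u_def weights_def using sets_cy sets_it[OF that]
    by (auto intro!: finite_measure_mono)
  have j_total: "(\<Sum>w\<in>?W. \<Sum>z\<in>?Z. j w z) = 1"
    using stationary_weights_sum[OF itinerary_stationary, of n] sum_z by (simp add: u_def)
  \<comment> \<open>The left side is at most the probability that the guess at time \<open>i\<close>
    misses the actual cell, and invariance moves this event to time 0. The \<open>N\<close> surplus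
    letters of \<open>z\<close> ensure that every window fits.\<close>
  have err: "(\<Sum>w\<in>?W. \<Sum>z\<in>?Z. j w z * of_bool (w ! i \<noteq> g i z)) \<le> prob ?E" if i: "i < n" for i
  proof -
    let ?K = "{x \<in> ?W \<times> ?Z. fst x ! i \<noteq> g i (snd x)}"
    let ?A = "\<lambda>x. itinerary_set (fst x) \<inter> cylinder (snd x)"
    have E: "?E \<in> sets M"
    proof -
      have "?E = UNIV - (\<Union>A\<in>P. A \<inter> prefix_set N {v. G v = A})"
        using G by (auto simp: prefix_set_def)
      moreover have "UNIV \<in> sets M" using sets.top[of M] invariant_measuresD(5)[OF M] by simp
      ultimately show ?thesis
        using Psets finP prefix_set_sets by (auto intro!: sets.Diff sets.finite_UN sets.Int)
    qed
    have "(\<Sum>w\<in>?W. \<Sum>z\<in>?Z. j w z * of_bool (w ! i \<noteq> g i z)) = (\<Sum>x\<in>?W \<times> ?Z. if fst x ! i \<noteq> g i (snd x) then prob (?A x) else 0)"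
      unfolding sum.cartesian_product by (intro sum.cong refl) (auto simp: j_def)
    also have "\<dots> = (\<Sum>x\<in>?K. prob (?A x))"
      using fin by (subst sum.If_cases) (auto intro!: sum.cong)
    also have "\<dots> = prob (\<Union>x\<in>?K. ?A x)"
    proof (rule finite_measure_finite_Union[symmetric])
      show "disjoint_family_on ?A ?K"
        unfolding disjoint_family_on_def
      proof (intro ballI impI)
        fix x y assume xy: "x \<in> ?K" "y \<in> ?K" "x \<noteq> y"
        then have "fst x \<noteq> fst y \<or> snd x \<noteq> snd y" by (auto simp: prod_eq_iff)
        moreover have "itinerary_set (fst x) \<inter> itinerary_set (fst y) = {}" if "fst x \<noteq> fst y"
          by (rule disjoint_family_onD[OF it_disj _ _ that]) (use xy in auto)
        moreover have "cylinder (snd x) \<inter> cylinder (snd y) = {}" if "snd x \<noteq> snd y"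
          by (rule disjoint_family_onD[OF cy_disj _ _ that]) (use xy in auto)
        ultimately show "?A x \<inter> ?A y = {}" by blast
      qed
      show "?A ` ?K \<subseteq> sets M" using sets_it sets_cy by auto
      show "finite ?K" using fin by auto
    qed
    also have "\<dots> \<le> prob ((left_shift ^^ i) -` ?E)"
    proof (rule finite_measure_mono[OF _ vimage_shift_sets[OF E]], rule subsetI, rule vimageI2, rule CollectI, rule notI)
      fix x
      assume "x \<in> (\<Union>x\<in>?K. ?A x)" and xG: "(left_shift ^^ i) x \<in> G (map ((left_shift ^^ i) x) [0..<N])"
      then obtain w z where w: "w \<in> ?W" and z: "z \<in> ?Z" and ne: "w ! i \<noteq> g i z"
        and xw: "x \<in> itinerary_set w" and xz: "x \<in> cylinder z" by auto
      have "map ((left_shift ^^ i) x) [0..<N] = take N (drop i z)"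
        using xz z i by (intro nth_equalityI) (auto simp: words_def cylinder_def shift_power)
      then have "(left_shift ^^ i) x \<in> g i z" using xG by (simp add: g_def)
      moreover have "(left_shift ^^ i) x \<in> w ! i" using xw w i by (auto simp: itinerary_set_def words_def)
      moreover have "g i z \<in> P" "w ! i \<in> P" using G w i by (auto simp: g_def words_def)
      ultimately show False using ne part by (auto simp: partition_on_def disjoint_def)
    qed
    also have "\<dots> = prob ?E" by (rule measure_shift_power[OF E])
    finally show ?thesis .
  qed
  have "(\<Sum>x\<in>?W \<times> ?Z. j (fst x) (snd x) * ln (q (fst x) (snd x)))
    \<le> (\<Sum>x\<in>?W \<times> ?Z. j (fst x) (snd x) * ln (j (fst x) (snd x)))"
  proof (rule gibbs_inequality)
    have p0: "0 \<le> ?p z" for z by (simp add: weights_def)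
    have "(\<Sum>x\<in>?W \<times> ?Z. q (fst x) (snd x)) = (\<Sum>z\<in>?Z. \<Sum>w\<in>?W. q w z)"
      by (subst sum.swap) (simp add: sum.cartesian_product case_prod_unfold)
    also have "\<dots> = (\<Sum>z\<in>?Z. ?p z * (\<Sum>w\<in>?W. \<Prod>i<n. r (w ! i) (g i z)))"
      by (simp add: q_def sum_distrib_left)
    also have "\<dots> \<le> (\<Sum>z\<in>?Z. ?p z * 1)"
      using finP less_imp_le[OF r_pos] r_sum G p0
      by (intro sum_mono mult_left_mono sum_words_prod_le_1) (auto simp: g_def)
    also have "\<dots> = 1" using stationary_weights_sum[OF weights_stationary[OF M]] by simp
    also have "\<dots> = (\<Sum>x\<in>?W \<times> ?Z. j (fst x) (snd x))"
      using j_total by (simp add: sum.cartesian_product case_prod_unfold)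
    finally show "(\<Sum>x\<in>?W \<times> ?Z. q (fst x) (snd x)) \<le> (\<Sum>x\<in>?W \<times> ?Z. j (fst x) (snd x))" .
    fix x assume x: "x \<in> ?W \<times> ?Z"
    show "0 \<le> q (fst x) (snd x)"
      unfolding q_def using p0 less_imp_le[OF r_pos] by (intro mult_nonneg_nonneg prod_nonneg) auto
    show "j (fst x) (snd x) = 0" if "q (fst x) (snd x) = 0"
    proof -
      have "?p (snd x) = 0" using that r_pos by (auto simp: q_def prod_zero_iff less_le)
      then show ?thesis using j_le(2)[of "fst x" "snd x"] j0[of "fst x" "snd x"] x by auto
    qed
  qed (auto simp: j0)
  \<comment> \<open>Passing from the pair to the itinerary alone can only lower the entropy, because
    \<open>j w z \<le> u w\<close>.\<close>
  also have "\<dots> \<le> (\<Sum>x\<in>?W \<times> ?Z. j (fst x) (snd x) * ln (u (fst x)))"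
  proof (intro sum_mono)
    fix x assume x: "x \<in> ?W \<times> ?Z"
    show "j (fst x) (snd x) * ln (j (fst x) (snd x)) \<le> j (fst x) (snd x) * ln (u (fst x))"
    proof (cases "j (fst x) (snd x) = 0")
      case False
      then have "0 < j (fst x) (snd x)" using j0[of "fst x" "snd x"] by simp
      then show ?thesis using j_le(1)[of "fst x" "snd x"] x by (intro mult_left_mono) auto
    qed simp
  qed
  also have "\<dots> = (\<Sum>w\<in>?W. \<Sum>z\<in>?Z. j w z * ln (u w))"
    by (simp add: sum.cartesian_product case_prod_unfold)
  also have "\<dots> = (\<Sum>w\<in>?W. u w * ln (u w))"
    by (intro sum.cong refl) (simp add: sum_distrib_right[symmetric] sum_z)
  finally have upper: "(\<Sum>w\<in>?W. \<Sum>z\<in>?Z. j w z * ln (q w z)) \<le> (\<Sum>w\<in>?W. u w * ln (u w))"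
    by (simp add: sum.cartesian_product case_prod_unfold)
  \<comment> \<open>At a wrong guess the nonpositive term ln (1 - \<delta>) is included as well, so
    that it can be charged uniformly at every time.\<close>
  have ln_r: "ln (1 - \<delta>) - of_bool (A \<noteq> B) * ln (k / \<delta>) \<le> ln (r A B)" for A B
  proof (cases "A = B")
    case False
    have "ln (1 - \<delta>) \<le> 0" using \<delta> by simp
    moreover have "ln (\<delta> / k) = - ln (k / \<delta>)" using \<delta> k by (simp add: ln_div)
    ultimately show ?thesis using False by (simp add: r_def)
  qed (simp add: r_def)
  have ln_k: "0 \<le> ln (k / \<delta>)" using \<delta> k by (intro ln_ge_zero) (simp add: field_simps)
  have low: "j w z * ln (?p z) + (\<Sum>i<n. j w z * ln (1 - \<delta>) - j w z * of_bool (w ! i \<noteq> g i z) * ln (k / \<delta>))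
      \<le> j w z * ln (q w z)" if w: "w \<in> ?W" for w z
  proof (cases "j w z = 0")
    case False
    then have jpos: "0 < j w z" using j0[of w z] by simp
    then have p: "0 < ?p z" using j_le(2)[OF w, of z] by linarith
    have "0 < (\<Prod>i<n. r (w ! i) (g i z))" using r_pos by (simp add: prod_pos)
    then have "ln (q w z) = ln (?p z) + ln (\<Prod>i<n. r (w ! i) (g i z))"
      unfolding q_def using p by (simp add: ln_mult_pos)
    also have "ln (\<Prod>i<n. r (w ! i) (g i z)) = (\<Sum>i<n. ln (r (w ! i) (g i z)))"
      by (rule ln_prod) (simp, metis r_pos less_irrefl)
    finally have "ln (q w z) = ln (?p z) + (\<Sum>i<n. ln (r (w ! i) (g i z)))" .
    moreover have "(\<Sum>i<n. j w z * ln (1 - \<delta>) - j w z * of_bool (w ! i \<noteq> g i z) * ln (k / \<delta>))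
      \<le> (\<Sum>i<n. j w z * ln (r (w ! i) (g i z)))"
    proof (rule sum_mono)
      fix i
      show "j w z * ln (1 - \<delta>) - j w z * of_bool (w ! i \<noteq> g i z) * ln (k / \<delta>) \<le> j w z * ln (r (w ! i) (g i z))"
        using mult_left_mono[OF ln_r[of "w ! i" "g i z"] j0[of w z]] by (simp add: right_diff_distrib mult.assoc)
    qed
    ultimately show ?thesis by (simp add: distrib_left sum_distrib_left)
  qed simp
  have "(\<Sum>w\<in>?W. \<Sum>z\<in>?Z. j w z * ln (?p z) + (\<Sum>i<n. j w z * ln (1 - \<delta>) - j w z * of_bool (w ! i \<noteq> g i z) * ln (k / \<delta>)))
      \<le> (\<Sum>w\<in>?W. \<Sum>z\<in>?Z. j w z * ln (q w z))"
    by (intro sum_mono low)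
  also have "(\<Sum>w\<in>?W. \<Sum>z\<in>?Z. j w z * ln (?p z) + (\<Sum>i<n. j w z * ln (1 - \<delta>) - j w z * of_bool (w ! i \<noteq> g i z) * ln (k / \<delta>)))
    = (\<Sum>w\<in>?W. \<Sum>z\<in>?Z. j w z * ln (?p z))
      + (\<Sum>i<n. \<Sum>w\<in>?W. \<Sum>z\<in>?Z. j w z * ln (1 - \<delta>) - j w z * of_bool (w ! i \<noteq> g i z) * ln (k / \<delta>))"
    by (simp add: sum.distrib sum.swap[of _ "{..<n}"])
  also have "(\<Sum>i<n. \<Sum>w\<in>?W. \<Sum>z\<in>?Z. j w z * ln (1 - \<delta>) - j w z * of_bool (w ! i \<noteq> g i z) * ln (k / \<delta>))
    = (\<Sum>i<n. ln (1 - \<delta>) - (\<Sum>w\<in>?W. \<Sum>z\<in>?Z. j w z * of_bool (w ! i \<noteq> g i z)) * ln (k / \<delta>))"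
    using j_total by (simp add: sum_subtractf sum_distrib_right[symmetric])
  also have "(\<Sum>w\<in>?W. \<Sum>z\<in>?Z. j w z * ln (?p z)) = (\<Sum>z\<in>?Z. ?p z * ln (?p z))"
    by (subst sum.swap) (simp add: sum_distrib_right[symmetric] sum_w)
  finally have "(\<Sum>z\<in>?Z. ?p z * ln (?p z))
      + (\<Sum>i<n. ln (1 - \<delta>) - (\<Sum>w\<in>?W. \<Sum>z\<in>?Z. j w z * of_bool (w ! i \<noteq> g i z)) * ln (k / \<delta>))
    \<le> (\<Sum>w\<in>?W. u w * ln (u w))" using upper by linarith
  moreover have "(\<Sum>i<n. ln (1 - \<delta>) - prob ?E * ln (k / \<delta>))
    \<le> (\<Sum>i<n. ln (1 - \<delta>) - (\<Sum>w\<in>?W. \<Sum>z\<in>?Z. j w z * of_bool (w ! i \<noteq> g i z)) * ln (k / \<delta>))"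
    using err ln_k by (intro sum_mono diff_mono order_refl mult_right_mono) auto
  ultimately show ?thesis
    unfolding word_entropy_def u_def[symmetric] k_def[symmetric] by (simp add: algebra_simps)
qed

text \<open>Approximate each cell by a prefix set and guess any cell whose approximation accepts the
  word. A point that is guessed wrongly lies in one of the \<open>card P\<close> symmetric
  differences: that of the guessed cell, or that of its own cell if no approximation
  accepts.\<close>

lemma exists_guess:
  assumes "e > 0"
  shows "\<exists>N G. (\<forall>v. G v \<in> P) \<and> prob {x. x \<notin> G (map x [0..<N])} < e"
proof -
  have "P \<noteq> {}" using part by (auto simp: partition_on_def)
  then obtain A0 where A0: "A0 \<in> P" by blast
  have k: "0 < real (card P)" using finP \<open>P \<noteq> {}\<close> by (simp add: card_gt_0_iff)
  have "\<exists>N W. prob (sym_diff A (prefix_set N W)) < e / card P" if "A \<in> P" for A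
    using that Psets assms k by (intro approximate_by_prefix_set) auto
  then obtain N W where NW: "\<And>A. A \<in> P \<Longrightarrow> prob (sym_diff A (prefix_set (N A) (W A))) < e / card P"
    by metis
  define K where "K = Max (N ` P)"
  have K: "N A \<le> K" if "A \<in> P" for A using that finP by (simp add: K_def)
  define G where "G v = (if \<exists>A\<in>P. take (N A) v \<in> W A then SOME A. A \<in> P \<and> take (N A) v \<in> W A else A0)" for v
  have G1: "G v \<in> P \<and> take (N (G v)) v \<in> W (G v)" if "\<exists>A\<in>P. take (N A) v \<in> W A" for v
    using that someI_ex[of "\<lambda>A. A \<in> P \<and> take (N A) v \<in> W A"] by (auto simp: G_def)
  have "G v \<in> P" for v using G1[of v] A0 by (cases "\<exists>A\<in>P. take (N A) v \<in> W A") (auto simp: G_def)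
  moreover have "prob {x. x \<notin> G (map x [0..<K])} < e"
  proof -
    have sub: "{x. x \<notin> G (map x [0..<K])} \<subseteq> (\<Union>A\<in>P. sym_diff A (prefix_set (N A) (W A)))"
    proof
      fix x assume x: "x \<in> {x. x \<notin> G (map x [0..<K])}"
      let ?v = "map x [0..<K]"
      have pre: "x \<in> prefix_set (N A) (W A) \<longleftrightarrow> take (N A) ?v \<in> W A" if "A \<in> P" for A
        using prefix_set_take[OF K[OF that], of "W A"] by (auto simp: prefix_set_def)
      obtain B where B: "B \<in> P" "x \<in> B" using part by (auto simp: partition_on_def)
      show "x \<in> (\<Union>A\<in>P. sym_diff A (prefix_set (N A) (W A)))"
      proof (cases "\<exists>A\<in>P. take (N A) ?v \<in> W A")
        case True
        then show ?thesis using G1[OF True] pre[of "G ?v"] x by blast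
      next
        case False
        then show ?thesis using B pre[of B] by blast
      qed
    qed
    have "prob {x. x \<notin> G (map x [0..<K])} \<le> prob (\<Union>A\<in>P. sym_diff A (prefix_set (N A) (W A)))"
      using Psets finP prefix_set_sets
      by (intro finite_measure_mono sub sets.finite_UN sets.Un sets.Diff) auto
    also have "\<dots> \<le> (\<Sum>A\<in>P. prob (sym_diff A (prefix_set (N A) (W A))))"
      using Psets finP prefix_set_sets
      by (intro finite_measure_subadditive_finite finP image_subsetI sets.Un sets.Diff) auto
    also have "\<dots> < (\<Sum>A\<in>P. e / card P)" using NW finP \<open>P \<noteq> {}\<close> by (intro sum_strict_mono)
    also have "\<dots> = e" using k by simp
    finally show ?thesis .
  qed
  ultimately show ?thesis by blast
qed

text \<open>The order of limits matters: first n, since \<open>N\<close> depends on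
  \<open>e\<close>; then \<open>e\<close>, since its factor ln (card P / \<delta>) blows up for
  small \<delta>; and \<delta> last.\<close>

lemma entropy_rate_itinerary_le:
  "entropy_rate P (\<lambda>w. prob (itinerary_set w)) \<le> entropy_rate UNIV (weights M)"
proof -
  let ?u = "\<lambda>w. prob (itinerary_set w)" and ?h = "entropy_rate UNIV (weights M)"
  note st = weights_stationary[OF M]
  have bound: "entropy_rate P ?u \<le> ?h + (- ln (1 - \<delta>) + e * ln (card P / \<delta>))"
    if "0 < \<delta>" "\<delta> < 1" "0 < e" for \<delta> e
  proof -
    obtain N G where G: "\<And>v. G v \<in> P" and E: "prob {x. x \<notin> G (map x [0..<N])} < e"
      using exists_guess[OF \<open>0 < e\<close>] by blast
    have "1 \<le> real (card P)" using part finP by (auto simp: partition_on_def Suc_le_eq card_gt_0_iff)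
    then have "0 \<le> ln (card P / \<delta>)" using that by (intro ln_ge_zero) (simp add: field_simps)
    then have c: "prob {x. x \<notin> G (map x [0..<N])} * ln (card P / \<delta>) \<le> e * ln (card P / \<delta>)"
      using E by (intro mult_right_mono) auto
    let ?c = "- ln (1 - \<delta>) + e * ln (card P / \<delta>)"
    have le: "word_entropy P ?u n \<le> word_entropy UNIV (weights M) n + word_entropy UNIV (weights M) N + n * ?c" for n
    proof -
      have "word_entropy P ?u n \<le> word_entropy UNIV (weights M) (n + N)
          + n * (- ln (1 - \<delta>) + prob {x. x \<notin> G (map x [0..<N])} * ln (card P / \<delta>))"
        using word_entropy_coding_bound[OF G that(1,2)] .
      also have "\<dots> \<le> word_entropy UNIV (weights M) (n + N) + n * ?c"
        using c by (intro add_left_mono mult_left_mono) auto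
      finally show ?thesis using word_entropy_add_le[OF st, of n N] by simp
    qed
    have "(\<lambda>n. word_entropy UNIV (weights M) n / n + word_entropy UNIV (weights M) N / n + ?c) \<longlonglongrightarrow> ?h + 0 + ?c"
      by (intro tendsto_add tendsto_const entropy_rate_tendsto[OF st] lim_const_over_n) simp
    moreover have "(\<lambda>n. word_entropy P ?u n / n) \<longlonglongrightarrow> entropy_rate P ?u"
      by (rule entropy_rate_tendsto[OF itinerary_stationary finP])
    moreover have "word_entropy P ?u n / n
      \<le> word_entropy UNIV (weights M) n / n + word_entropy UNIV (weights M) N / n + ?c" if "n \<ge> 1" for n
      using divide_right_mono[OF le[of n], of "real n"] that by (simp add: add_divide_distrib)
    ultimately show ?thesis by (intro LIMSEQ_le[of _ _ _ "?h + ?c"]) auto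
  qed
  have "entropy_rate P ?u \<le> ?h - ln (1 - \<delta>)" if "0 < \<delta>" "\<delta> < 1" for \<delta>
  proof (rule tendsto_lowerbound)
    show "((\<lambda>e. ?h + (- ln (1 - \<delta>) + e * ln (card P / \<delta>))) \<longlongrightarrow> ?h - ln (1 - \<delta>)) (at_right 0)"
      by (auto intro!: tendsto_eq_intros)
    show "\<forall>\<^sub>F e in at_right 0. entropy_rate P ?u \<le> ?h + (- ln (1 - \<delta>) + e * ln (card P / \<delta>))"
      using eventually_at_right_less[of 0] by eventually_elim (rule bound[OF that])
  qed simp
  note le = this
  show ?thesis
  proof (rule tendsto_lowerbound)
    show "((\<lambda>\<delta>. ?h - ln (1 - \<delta>)) \<longlongrightarrow> ?h) (at_right 0)"
      by (auto intro!: tendsto_eq_intros)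
    show "\<forall>\<^sub>F \<delta> in at_right 0. entropy_rate P ?u \<le> ?h - ln (1 - \<delta>)"
      using le eventually_at_right_real[of 0 "1::real"] by (auto elim!: eventually_mono)
  qed simp
qed

end

text \<open>The coding bound controls every partition, and the partition by the first letter attains
  the bound because its itinerary sets are exactly the cylinders.\<close>

lemma measure_entropy_left_shift: "measure_entropy M left_shift = ereal (entropy_rate UNIV (weights M))"
proof (rule antisym)
  note inv = invariant_measuresD[OF M]
  show "measure_entropy M left_shift \<le> ereal (entropy_rate UNIV (weights M))"
    unfolding measure_entropy_def
  proof (rule SUP_least)
    fix P assume "P \<in> {P. finite P \<and> P \<subseteq> sets M \<and> partition_on (space M) P}"
    then have P: "finite P" "P \<subseteq> sets M" "partition_on UNIV P" using inv(5) by auto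
    show "ereal (entropy_wrt_partition M left_shift P) \<le> ereal (entropy_rate UNIV (weights M))"
      using entropy_rate_itinerary_le[OF P] entropy_wrt_partition_eq[OF P] by simp
  qed
  let ?c = "\<lambda>a::'a. cylinder [a]"
  define P where "P = range ?c"
  have inj: "inj ?c"
  proof (rule injI)
    fix a b :: 'a assume "?c a = ?c b"
    then show "a = b" using cylinder_disjoint[of "[a]" "[b]"] cylinder_nonempty[of "[a]"] by auto
  qed
  have P: "finite P" "P \<subseteq> sets M" "partition_on UNIV P"
  proof -
    show "P \<subseteq> sets M" using cylinder_in_sets[OF inv(1)] by (auto simp: P_def)
    have "(\<Union>a. ?c a) = UNIV" by (auto simp: cylinder_def)
    moreover have "?c a \<inter> ?c b = {}" if "?c a \<noteq> ?c b" for a b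
      by (rule cylinder_disjoint) (use that in auto)
    ultimately show "partition_on UNIV P"
      using cylinder_nonempty unfolding P_def partition_on_def disjoint_def by blast
  qed (simp add: P_def)
  have it: "itinerary_set (map ?c v) = cylinder v" for v
    by (auto simp: itinerary_set_def cylinder_def shift_power)
  have W: "words P n = map ?c ` words UNIV n" for n
  proof (intro set_eqI iffI)
    fix w assume w: "w \<in> words P n"
    have "?c (inv ?c A) = A" if "A \<in> set w" for A
      using w that by (intro f_inv_into_f) (auto simp: words_def P_def)
    then have "map ?c (map (inv ?c) w) = w" by (simp add: map_idI)
    then show "w \<in> map ?c ` words UNIV n"
      using w by (intro image_eqI[of _ _ "map (inv ?c) w"]) (auto simp: words_def)
  qed (auto simp: words_def P_def)
  have "word_entropy P (\<lambda>w. prob (itinerary_set w)) n = word_entropy UNIV (weights M) n" for n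
    unfolding word_entropy_def W using inj
    by (subst sum.reindex) (auto simp: it weights_def intro: inj_on_subset[OF inj_mapI])
  then have "entropy_wrt_partition M left_shift P = entropy_rate UNIV (weights M)"
    by (simp add: entropy_wrt_partition_eq[OF P] entropy_rate_def)
  then show "ereal (entropy_rate UNIV (weights M)) \<le> measure_entropy M left_shift"
    unfolding measure_entropy_def using P inv(5)
    by (intro SUP_upper2[of P]) auto
qed

end

section \<open>Push-forwards and compactness of stationary weights\<close>

lemma bij_betw_fibre_append:
  "bij_betw (\<lambda>(I1, I2). I1 @ I2) ({I1. map f I1 = J1} \<times> {I2. map f I2 = J2}) {I. map f I = J1 @ J2}"
  by (rule bij_betwI[where g = "\<lambda>I. (take (length J1) I, drop (length J1) I)"])
     (auto simp: take_map[symmetric] drop_map[symmetric])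

lemma sum_fibre_append:
  fixes g :: "'a list \<Rightarrow> real"
  shows "(\<Sum>I | map f I = J1 @ J2. g I) = (\<Sum>I1 | map f I1 = J1. \<Sum>I2 | map f I2 = J2. g (I1 @ I2))"
  unfolding sum.cartesian_product
  by (subst sum.reindex_bij_betw[OF bij_betw_fibre_append, symmetric]) (simp add: case_prod_unfold)

lemma sum_words_fibre:
  fixes g :: "'a::finite list \<Rightarrow> real" and f :: "'a \<Rightarrow> 'd::finite"
  shows "(\<Sum>J\<in>words UNIV n. \<Sum>I | map f I = J. g I) = (\<Sum>I\<in>words UNIV n. g I)"
proof -
  have "{I. map f I = J} = {I \<in> words UNIV n. map f I = J}" if "J \<in> words UNIV n" for J
    using that by (auto simp: words_def)
  then have "(\<Sum>J\<in>words UNIV n. \<Sum>I | map f I = J. g I)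
      = (\<Sum>J\<in>words UNIV n. \<Sum>I | I \<in> words UNIV n \<and> map f I = J. g I)"
    by (intro sum.cong refl) auto
  also have "\<dots> = (\<Sum>I\<in>words UNIV n. g I)" by (rule sum.group[OF finite_words[OF finite] finite_words[OF finite]]) (auto simp: words_def)
  finally show ?thesis .
qed

lemma push_weights_stationary:
  fixes f :: "'a::finite \<Rightarrow> 'd::finite"
  assumes p: "stationary_weights UNIV p"
  shows "stationary_weights UNIV (push_weights f p)"
  unfolding stationary_weights_def
proof (intro conjI ballI)
  show "push_weights f p [] = 1" using stationary_weightsD(1)[OF p] by (simp add: push_weights_def)
  fix J :: "'d list"
  show "0 \<le> push_weights f p J"
    unfolding push_weights_def by (intro sum_nonneg) (auto intro: stationary_weightsD(2)[OF p])
  have "(\<Sum>d\<in>UNIV. push_weights f p (J @ [d]))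
      = (\<Sum>I1 | map f I1 = J. \<Sum>d\<in>UNIV. \<Sum>I2 | map f I2 = [d]. p (I1 @ I2))"
    unfolding push_weights_def sum_fibre_append by (rule sum.swap)
  also have "\<dots> = (\<Sum>I1 | map f I1 = J. \<Sum>c\<in>UNIV. p (I1 @ [c]))"

  proof (intro sum.cong refl)
    fix I1
    show "(\<Sum>d\<in>UNIV. \<Sum>I2 | map f I2 = [d]. p (I1 @ I2)) = (\<Sum>c\<in>UNIV. p (I1 @ [c]))"
      using sum_words_fibre[where f = f and n = 1 and g = "\<lambda>I2. p (I1 @ I2)"] by (simp add: sum_words_1)
  qed
  finally show "(\<Sum>d\<in>UNIV. push_weights f p (J @ [d])) = push_weights f p J"
    using stationary_weightsD(3)[OF p] by (simp add: push_weights_def)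
  have "(\<Sum>d\<in>UNIV. push_weights f p ([d] @ J))
      = (\<Sum>I2 | map f I2 = J. \<Sum>d\<in>UNIV. \<Sum>I1 | map f I1 = [d]. p (I1 @ I2))"
  proof -
    have "push_weights f p ([d] @ J) = (\<Sum>I2 | map f I2 = J. \<Sum>I1 | map f I1 = [d]. p (I1 @ I2))" for d
      unfolding push_weights_def sum_fibre_append by (rule sum.swap)
    then show ?thesis by (simp only:) (rule sum.swap)
  qed
  also have "\<dots> = (\<Sum>I2 | map f I2 = J. \<Sum>c\<in>UNIV. p ([c] @ I2))"
  proof (intro sum.cong refl)
    fix I2
    show "(\<Sum>d\<in>UNIV. \<Sum>I1 | map f I1 = [d]. p (I1 @ I2)) = (\<Sum>c\<in>UNIV. p ([c] @ I2))"
      using sum_words_fibre[where f = f and n = 1 and g = "\<lambda>I1. p (I1 @ I2)"] by (simp add: sum_words_1)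
  qed
  finally show "(\<Sum>d\<in>UNIV. push_weights f p (d # J)) = push_weights f p J"
    using stationary_weightsD(4)[OF p] by (simp add: push_weights_def)
qed

lemma push_weights_convex:
  "push_weights f (\<lambda>w. t * p w + (1 - t) * q w)
    = (\<lambda>J. t * push_weights f p J + (1 - t) * push_weights f q J)"
  by (simp add: push_weights_def sum.distrib sum_distrib_left fun_eq_iff)

text \<open>Tychonoff on the cube of functions from words to [0,1]. There are countably many words,
  so compactness is sequential, and each stationarity condition involves finitely many coordinates
  and survives the limit.\<close>

lemma stationary_weights_seq_compact:
  fixes p :: "nat \<Rightarrow> 'a::finite list \<Rightarrow> real"
  assumes p: "\<And>m. stationary_weights UNIV (p m)"
  obtains r q where "strict_mono r" "stationary_weights UNIV q" "\<And>w. (\<lambda>m. p (r m) w) \<longlonglongrightarrow> q w"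
proof -
  have "compactin (product_topology (\<lambda>_. euclidean) UNIV) (Pi\<^sub>E (UNIV :: 'a list set) (\<lambda>_. {0..1::real}))"
    by (simp add: compactin_PiE)
  then have "compact (Pi\<^sub>E (UNIV :: 'a list set) (\<lambda>_. {0..1::real}))"
    by (simp add: euclidean_product_topology)
  then have "seq_compact (Pi\<^sub>E (UNIV :: 'a list set) (\<lambda>_. {0..1::real}))"
    by (rule compact_imp_seq_compact)
  moreover have "p m \<in> Pi\<^sub>E UNIV (\<lambda>_. {0..1})" for m
    using stationary_weightsD(2)[OF p] stationary_weights_le_1[OF p finite] by auto
  ultimately obtain q r where r: "strict_mono r" and q: "(p \<circ> r) \<longlonglongrightarrow> q"
    unfolding seq_compact_def by blast
  have lim: "(\<lambda>m. p (r m) w) \<longlonglongrightarrow> q w" for w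
    using continuous_on_tendsto_compose[OF continuous_on_product_coordinates[of w] q] by (simp add: o_def)
  have "stationary_weights UNIV q"
    unfolding stationary_weights_def
  proof (intro conjI ballI)
    show "q [] = 1" using lim[of "[]"] stationary_weightsD(1)[OF p] by (simp add: LIMSEQ_const_iff)
    fix w :: "'a list"
    show "0 \<le> q w" using LIMSEQ_le_const[OF lim[of w]] stationary_weightsD(2)[OF p] by auto
    have "(\<lambda>m. \<Sum>c\<in>UNIV. p (r m) (w @ [c])) \<longlonglongrightarrow> (\<Sum>c\<in>UNIV. q (w @ [c]))" by (intro tendsto_sum lim)
    then show "(\<Sum>c\<in>UNIV. q (w @ [c])) = q w"
      using lim[of w] stationary_weightsD(3)[OF p] LIMSEQ_unique by force
    have "(\<lambda>m. \<Sum>c\<in>UNIV. p (r m) (c # w)) \<longlonglongrightarrow> (\<Sum>c\<in>UNIV. q (c # w))" by (intro tendsto_sum lim)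
    then show "(\<Sum>c\<in>UNIV. q (c # w)) = q w"
      using lim[of w] stationary_weightsD(4)[OF p] LIMSEQ_unique by force
  qed
  with r lim show ?thesis using that by blast
qed

section \<open>Quasi-additive functions on words\<close>

text \<open>Almost additivity in logarithmic form, on words. The empty word is included, which
  bounds the value there by \<open>K\<close>.\<close>

definition quasi_additive :: "('c list \<Rightarrow> real) \<Rightarrow> bool" where
  "quasi_additive \<psi> \<longleftrightarrow> (\<exists>K. \<forall>I J. \<bar>\<psi> (I @ J) - \<psi> I - \<psi> J\<bar> \<le> K)"

lemma quasi_additiveI: "(\<And>I J. \<bar>\<psi> (I @ J) - \<psi> I - \<psi> J\<bar> \<le> K) \<Longrightarrow> quasi_additive \<psi>"
  unfolding quasi_additive_def by blast

lemma quasi_additive_lincomb: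
  assumes "quasi_additive \<psi>" "quasi_additive \<rho>"
  shows "quasi_additive (\<lambda>I. x * \<psi> I + y * \<rho> I)"
proof -
  obtain K L where K: "\<And>I J. \<bar>\<psi> (I @ J) - \<psi> I - \<psi> J\<bar> \<le> K" and L: "\<And>I J. \<bar>\<rho> (I @ J) - \<rho> I - \<rho> J\<bar> \<le> L"
    using assms unfolding quasi_additive_def by blast
  show ?thesis
  proof (rule quasi_additiveI)
    fix I J
    have "\<bar>x * (\<psi> (I @ J) - \<psi> I - \<psi> J) + y * (\<rho> (I @ J) - \<rho> I - \<rho> J)\<bar>
      \<le> \<bar>x\<bar> * \<bar>\<psi> (I @ J) - \<psi> I - \<psi> J\<bar> + \<bar>y\<bar> * \<bar>\<rho> (I @ J) - \<rho> I - \<rho> J\<bar>"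
      by (metis abs_mult abs_triangle_ineq)
    also have "\<dots> \<le> \<bar>x\<bar> * K + \<bar>y\<bar> * L" using K L by (intro add_mono mult_left_mono) auto
    finally show "\<bar>x * \<psi> (I @ J) + y * \<rho> (I @ J) - (x * \<psi> I + y * \<rho> I) - (x * \<psi> J + y * \<rho> J)\<bar>
      \<le> \<bar>x\<bar> * K + \<bar>y\<bar> * L" by (simp add: algebra_simps)
  qed
qed

lemma quasi_additive_scale: "quasi_additive \<psi> \<Longrightarrow> quasi_additive (\<lambda>I. x * \<psi> I)"
  using quasi_additive_lincomb[of \<psi> \<psi> x 0] by simp

lemma quasi_additive_map: "quasi_additive \<psi> \<Longrightarrow> quasi_additive (\<lambda>I. \<psi> (map f I))"
  unfolding quasi_additive_def by (metis map_append)

text \<open>The logarithm of the push-forward of the weights \<open>exp \<psi>\<close>.\<close>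

definition fibre_log_sum :: "('a \<Rightarrow> 'd) \<Rightarrow> ('a list \<Rightarrow> real) \<Rightarrow> 'd list \<Rightarrow> real" where
  "fibre_log_sum f \<psi> J = ln (\<Sum>I | map f I = J. exp (\<psi> I))"

lemma fibre_sum_exp_pos:
  fixes f :: "'a::finite \<Rightarrow> 'd"
  assumes "surj f"
  shows "0 < (\<Sum>I | map f I = J. exp (\<psi> I :: real))"
proof (rule sum_pos)
  have "map f (map (inv f) J) = J" using surj_f_inv_f[OF assms] by (simp add: map_idI)
  then show "{I. map f I = J} \<noteq> {}" by blast
qed auto

lemma exp_fibre_log_sum:
  fixes f :: "'a::finite \<Rightarrow> 'd"
  shows "surj f \<Longrightarrow> exp (fibre_log_sum f \<psi> J) = (\<Sum>I | map f I = J. exp (\<psi> I))"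
  unfolding fibre_log_sum_def using fibre_sum_exp_pos by simp

text \<open>The fibre over a concatenation is the product of the fibres, so fibre sums multiply up
  to the factor exp K; the constant \<open>K\<close> is inherited unchanged.\<close>

lemma quasi_additive_fibre_log_sum:
  fixes f :: "'a::finite \<Rightarrow> 'd"
  assumes f: "surj f" and \<psi>: "quasi_additive \<psi>"
  shows "quasi_additive (fibre_log_sum f \<psi>)"
proof -
  obtain K where K: "\<And>I J. \<bar>\<psi> (I @ J) - \<psi> I - \<psi> J\<bar> \<le> K" using \<psi> unfolding quasi_additive_def by blast
  let ?Z = "\<lambda>J. \<Sum>I | map f I = J. exp (\<psi> I)"
  show ?thesis
  proof (rule quasi_additiveI)
    fix J1 J2
    have bnd: "\<psi> (I @ J) \<le> K + (\<psi> I + \<psi> J)" "- K + (\<psi> I + \<psi> J) \<le> \<psi> (I @ J)" for I J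
      using K[of I J] by linarith+
    have pos: "0 < ?Z J" for J using fibre_sum_exp_pos[OF f] .
    have Z: "?Z J1 * ?Z J2 = (\<Sum>I1 | map f I1 = J1. \<Sum>I2 | map f I2 = J2. exp (\<psi> I1 + \<psi> I2))"
      by (simp add: sum_product exp_add)
    have "?Z (J1 @ J2) \<le> (\<Sum>I1 | map f I1 = J1. \<Sum>I2 | map f I2 = J2. exp K * exp (\<psi> I1 + \<psi> I2))"
      unfolding sum_fibre_append exp_add[symmetric] using bnd(1)
      by (intro sum_mono exp_le_cancel_iff[THEN iffD2])
    also have "\<dots> = exp K * (?Z J1 * ?Z J2)" unfolding Z by (simp add: sum_distrib_left)
    finally have "ln (?Z (J1 @ J2)) \<le> ln (exp K * (?Z J1 * ?Z J2))"
      using pos by (intro ln_mono) auto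
    moreover have "exp (- K) * (?Z J1 * ?Z J2) \<le> ?Z (J1 @ J2)"
    proof -
      have "exp (- K) * (?Z J1 * ?Z J2)
        = (\<Sum>I1 | map f I1 = J1. \<Sum>I2 | map f I2 = J2. exp (- K) * exp (\<psi> I1 + \<psi> I2))"
        unfolding Z by (simp add: sum_distrib_left)
      also have "\<dots> \<le> ?Z (J1 @ J2)"
        unfolding sum_fibre_append exp_add[symmetric] using bnd(2)
        by (intro sum_mono exp_le_cancel_iff[THEN iffD2])
      finally show ?thesis .
    qed
    then have "ln (exp (- K) * (?Z J1 * ?Z J2)) \<le> ln (?Z (J1 @ J2))"
      using pos by (intro ln_mono) auto
    moreover have "ln (exp L * (?Z J1 * ?Z J2)) = L + ln (?Z J1) + ln (?Z J2)" for L
      using pos[of J1] pos[of J2] by (simp add: ln_mult_pos)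
    ultimately show "\<bar>fibre_log_sum f \<psi> (J1 @ J2) - fibre_log_sum f \<psi> J1 - fibre_log_sum f \<psi> J2\<bar> \<le> K"
      unfolding fibre_log_sum_def by simp
  qed
qed

text \<open>Explicit solution of the weighted variational problem at the level of words: distribute
  mass on \<open>\<D>\<^sup>n\<close> proportionally to \<open>Z\<^bsup>a/(a+b)\<^esup>\<close>, where \<open>Z\<close> is the fibre sum of \<open>exp (s/a)\<close>,
  and within each fibre proportionally to \<open>exp (s/a)\<close>.\<close>

lemma exists_weighted_gibbs_weights:
  fixes f :: "'a::finite \<Rightarrow> 'd::finite" and s :: "'a list \<Rightarrow> real"
  assumes f: "surj f" and s: "quasi_additive s" and a: "a > 0" and b: "b \<ge> 0"
  obtains \<psi> R where "quasi_additive \<psi>" "\<And>n. (\<Sum>I\<in>words UNIV n. exp (\<psi> I)) = 1"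
    "\<And>I. a * \<psi> I + b * fibre_log_sum f \<psi> (map f I) = s I - R (length I)"
proof -
  define Z where "Z = fibre_log_sum f (\<lambda>I. s I / a)"
  \<comment> \<open>The logarithmic normalizer is itself a fibre sum, for the map to a one-letter
    alphabet whose words are just lengths. Its quasi-additivity thus comes from the same lemma as
    that of \<open>Z\<close>.\<close>
  define Q where "Q = fibre_log_sum (\<lambda>_::'d. ()) (\<lambda>J. a / (a + b) * Z J)"
  \<comment> \<open>Normalizing within a fibre subtracts \<open>Z\<close>, and the mass given to the
    fibre restores a / (a + b) of it. This leaves the coefficient - b / (a + b), for which the
    \<open>Z\<close> terms cancel in the weighted sum of \<open>\<psi>\<close> and its fibre
    sum.\<close>
  define \<psi> where "\<psi> I = s I / a - b / (a + b) * Z (map f I) - Q (map (\<lambda>_. ()) I)" for I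
  have surj_unit: "surj (\<lambda>_::'d. ())" by auto
  have qZ: "quasi_additive Z"
    unfolding Z_def using quasi_additive_scale[OF s, of "1 / a"] by (intro quasi_additive_fibre_log_sum f) simp
  have qQ: "quasi_additive Q"
    unfolding Q_def by (intro quasi_additive_fibre_log_sum surj_unit quasi_additive_scale qZ)
  have "quasi_additive (\<lambda>I. 1 * (1 / a * s I + (- (b / (a + b))) * Z (map f I)) + (- 1) * Q (map (\<lambda>_. ()) I))"
    by (intro quasi_additive_lincomb quasi_additive_map qZ qQ s)
  then have q\<psi>: "quasi_additive \<psi>" by (simp add: \<psi>_def[abs_def] algebra_simps)
  have exp_fibre: "(\<Sum>I | map f I = J. exp (\<psi> I)) = exp (a / (a + b) * Z J - Q (map (\<lambda>_. ()) J))" for J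
  proof -
    have "(\<Sum>I | map f I = J. exp (\<psi> I))
      = (\<Sum>I | map f I = J. exp (s I / a) * exp (- (b / (a + b)) * Z J - Q (map (\<lambda>_. ()) J)))"
    proof (intro sum.cong refl)
      fix I assume "I \<in> {I. map f I = J}"
      then have "map f I = J" "map (\<lambda>_. ()) I = map (\<lambda>_. ()) J" by auto
      then show "exp (\<psi> I) = exp (s I / a) * exp (- (b / (a + b)) * Z J - Q (map (\<lambda>_. ()) J))"
        by (simp add: \<psi>_def exp_add[symmetric])
    qed
    also have "\<dots> = exp (Z J) * exp (- (b / (a + b)) * Z J - Q (map (\<lambda>_. ()) J))"
      by (simp add: sum_distrib_right[symmetric] exp_fibre_log_sum[OF f] Z_def)
    also have "\<dots> = exp (a / (a + b) * Z J - Q (map (\<lambda>_. ()) J))"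
    proof -
      have "Z J + - (b / (a + b)) * Z J = a / (a + b) * Z J" using a b by (simp add: field_simps)
      then show ?thesis by (simp add: exp_add[symmetric])
    qed
    finally show ?thesis .
  qed
  have "(\<Sum>I\<in>words UNIV n. exp (\<psi> I)) = 1" for n
  proof -
    have "(\<Sum>I\<in>words UNIV n. exp (\<psi> I))
      = (\<Sum>J\<in>words UNIV n. exp (a / (a + b) * Z J - Q (map (\<lambda>_. ()) J)))"
      using sum_words_fibre[where f = f and g = "\<lambda>I. exp (\<psi> I)" and n = n] by (simp add: exp_fibre)
    also have "\<dots> = (\<Sum>J\<in>words UNIV n. exp (a / (a + b) * Z J) * exp (- Q (replicate n ())))"
      by (intro sum.cong refl) (auto simp: words_def map_replicate_const exp_add[symmetric])
    also have "\<dots> = (\<Sum>J | map (\<lambda>_. ()) J = replicate n (). exp (a / (a + b) * Z J)) * exp (- Q (replicate n ()))"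
    proof -
      have "words UNIV n = {J :: 'd list. map (\<lambda>_. ()) J = replicate n ()}"
        by (auto simp: words_def map_replicate_const dest: arg_cong[where f = length])
      then show ?thesis by (simp add: sum_distrib_right)
    qed
    also have "\<dots> = 1" by (simp add: exp_fibre_log_sum[OF surj_unit, symmetric] Q_def exp_minus)
    finally show ?thesis .
  qed
  moreover have "a * \<psi> I + b * fibre_log_sum f \<psi> (map f I) = s I - (a + b) * Q (replicate (length I) ())" for I
  proof -
    have fl: "fibre_log_sum f \<psi> (map f I) = a / (a + b) * Z (map f I) - Q (replicate (length I) ())"
      unfolding fibre_log_sum_def exp_fibre by (simp add: map_replicate_const)
    have "a * (s I / a) = s I" using a by simp
    then show ?thesis unfolding fl \<psi>_def by (simp add: map_replicate_const right_diff_distrib distrib_right)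
  qed
  ultimately show ?thesis using that[of \<psi> "\<lambda>n. (a + b) * Q (replicate n ())"] q\<psi> by simp
qed

section \<open>Stationary weights comparable to Gibbs weights\<close>

text \<open>The stationary weights are a limit of periodic-orbit averages: the orbit average of the
  periodic point \<open>U\<^sup>\<infinity>\<close>, weighted by \<open>exp (\<psi> U)\<close>, is exactly stationary for every period.\<close>

lemma exists_comparable_stationary_weights:
  fixes \<psi> :: "'a::finite list \<Rightarrow> real"
  assumes q: "quasi_additive \<psi>" and total: "\<And>n. (\<Sum>I\<in>words UNIV n. exp (\<psi> I)) = 1"
  obtains \<mu> C where "stationary_weights UNIV \<mu>" "C > 0"
    "\<And>I. exp (\<psi> I) \<le> C * \<mu> I" "\<And>I. \<mu> I \<le> C * exp (\<psi> I)"
proof -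
  obtain K where K: "\<And>I J. \<bar>\<psi> (I @ J) - \<psi> I - \<psi> J\<bar> \<le> K" using q unfolding quasi_additive_def by blast
  \<comment> \<open>Whether \<open>U\<close>, continued with period \<open>m\<close>, shows the word
    \<open>I\<close> at position \<open>i\<close>.\<close>
  define ind where "ind m U i I \<longleftrightarrow> (\<forall>j<length I. U ! ((i + j) mod m) = I ! j)"
    for m i :: nat and U I :: "'a list"
  define S where "S m i I = (\<Sum>U\<in>words UNIV m. exp (\<psi> U) * of_bool (ind m U i I))" for m i I
  define p where "p m I = (\<Sum>i<m. S m i I) / m" for m I
  have S0: "0 \<le> S m i I" for m i I unfolding S_def by (intro sum_nonneg) auto
  have S1: "S m i I \<le> 1" for m i I
  proof -
    have "S m i I \<le> (\<Sum>U\<in>words UNIV m. exp (\<psi> U) * 1)" unfolding S_def by (intro sum_mono mult_left_mono) auto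
    then show ?thesis using total by simp
  qed
  have snoc: "(\<Sum>c\<in>UNIV. S m i (I @ [c])) = S m i I" for m i I
  proof -
    have "ind m U i (I @ [c]) \<longleftrightarrow> ind m U i I \<and> c = U ! ((i + length I) mod m)" for U c
      by (auto simp: ind_def nth_append less_Suc_eq)
    then have "(\<Sum>c\<in>UNIV. of_bool (ind m U i (I @ [c]))) = (of_bool (ind m U i I) :: real)" for U
      by (simp add: of_bool_conj sum_distrib_left[symmetric])
    then show ?thesis unfolding S_def by (subst sum.swap) (simp add: sum_distrib_left[symmetric])
  qed
  have Cons: "(\<Sum>c\<in>UNIV. S m i (c # I)) = S m (Suc i) I" for m i I
  proof -
    have "ind m U i (c # I) \<longleftrightarrow> c = U ! (i mod m) \<and> ind m U (Suc i) I" for U c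
      by (auto simp: ind_def less_Suc_eq_0_disj)
    then have "(\<Sum>c\<in>UNIV. of_bool (ind m U i (c # I))) = (of_bool (ind m U (Suc i) I) :: real)" for U
      by (simp add: of_bool_conj sum_distrib_right[symmetric])
    then show ?thesis unfolding S_def by (subst sum.swap) (simp add: sum_distrib_left[symmetric])
  qed
  have stat: "stationary_weights UNIV (p m)" if m: "m \<ge> 1" for m
    unfolding stationary_weights_def
  proof (intro conjI ballI)
    have "S m i [] = 1" for i unfolding S_def using total by (simp add: ind_def)
    then show "p m [] = 1" using m by (simp add: p_def)
    fix w :: "'a list"
    show "0 \<le> p m w" unfolding p_def using S0 by (intro divide_nonneg_nonneg sum_nonneg) auto
    show "(\<Sum>c\<in>UNIV. p m (w @ [c])) = p m w"
      unfolding p_def sum_divide_distrib[symmetric] by (subst sum.swap) (simp add: snoc)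
    \<comment> \<open>Positions are cyclic, so shifting all of them by one leaves their sum
      unchanged.\<close>
    have "S m m w = S m 0 w" by (simp add: S_def ind_def)
    then have "(\<Sum>i<m. S m (Suc i) w) = (\<Sum>i<m. S m i w)"
      using sum.lessThan_Suc_shift[of "\<lambda>i. S m i w" m] by simp
    then show "(\<Sum>c\<in>UNIV. p m (c # w)) = p m w"
      unfolding p_def sum_divide_distrib[symmetric] by (subst sum.swap) (simp add: Cons)
  qed
  have S_eq: "S m i I = (\<Sum>A\<in>words UNIV i. \<Sum>B\<in>words UNIV l. exp (\<psi> (A @ I @ B)))"
    if m: "m = i + (length I + l)" "length I + l > 0" for m i l I
  proof -
    have "S m i I = (\<Sum>A\<in>words UNIV i. \<Sum>V\<in>words UNIV (length I). \<Sum>B\<in>words UNIV l.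
        exp (\<psi> (A @ V @ B)) * of_bool (ind m (A @ V @ B) i I))"
      unfolding S_def m(1) sum_words_append ..
    also have "\<dots> = (\<Sum>A\<in>words UNIV i. \<Sum>V\<in>words UNIV (length I). if V = I then \<Sum>B\<in>words UNIV l. exp (\<psi> (A @ V @ B)) else 0)"
    proof (intro sum.cong refl)
      fix A V :: "'a list" assume A: "A \<in> words UNIV i" and V: "V \<in> words UNIV (length I)"
      have "ind m (A @ V @ B) i I \<longleftrightarrow> V = I" if B: "B \<in> words UNIV l" for B
      proof -
        have "(A @ V @ B) ! ((i + j) mod m) = V ! j" if "j < length I" for j
          using that A V m by (auto simp: words_def nth_append)
        then have "ind m (A @ V @ B) i I \<longleftrightarrow> (\<forall>j<length I. V ! j = I ! j)" by (simp add: ind_def)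
        then show ?thesis using V by (auto simp: words_def intro: nth_equalityI)
      qed
      then show "(\<Sum>B\<in>words UNIV l. exp (\<psi> (A @ V @ B)) * of_bool (ind m (A @ V @ B) i I))
          = (if V = I then \<Sum>B\<in>words UNIV l. exp (\<psi> (A @ V @ B)) else 0)" by simp
    qed
    also have "\<dots> = (\<Sum>A\<in>words UNIV i. \<Sum>B\<in>words UNIV l. exp (\<psi> (A @ I @ B)))"
    proof -
      have "I \<in> words UNIV (length I)" by (simp add: words_def)
      then show ?thesis by (simp add: sum.delta)
    qed
    finally show ?thesis .
  qed
  \<comment> \<open>Under this bound on \<open>i\<close> the occurrence of \<open>I\<close> does not
    wrap around, so the period splits into a prefix, \<open>I\<close> and a suffix; the two
    splittings cost exp (2 * K), and prefix and suffix sum to one. At most \<open>length I\<close>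
    positions of a period escape, a share that vanishes as \<open>m\<close> grows.\<close>
  have S_bounds: "exp (- (2 * K)) * exp (\<psi> I) \<le> S m i I" "S m i I \<le> exp (2 * K) * exp (\<psi> I)"
    if "i < m - length I" for m i I
  proof -
    define l where "l = m - length I - i"
    have m: "m = i + (length I + l)" "length I + l > 0" using that by (auto simp: l_def)
    have ab: "\<psi> (A @ I @ B) \<le> 2 * K + (\<psi> A + \<psi> I + \<psi> B)" "- (2 * K) + (\<psi> A + \<psi> I + \<psi> B) \<le> \<psi> (A @ I @ B)" for A B
      using K[of A "I @ B"] K[of I B] by linarith+
    have prod: "exp \<kappa> * exp (\<psi> I) = (\<Sum>A\<in>words UNIV i. \<Sum>B\<in>words UNIV l. exp (\<kappa> + (\<psi> A + \<psi> I + \<psi> B)))" for \<kappa>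
    proof -
      have "(\<Sum>A\<in>words UNIV i. \<Sum>B\<in>words UNIV l. exp (\<kappa> + (\<psi> A + \<psi> I + \<psi> B)))
        = (\<Sum>A\<in>words UNIV i. exp (\<psi> A) * (\<Sum>B\<in>words UNIV l. exp (\<psi> B) * (exp \<kappa> * exp (\<psi> I))))"
        by (simp add: exp_add sum_distrib_left mult_ac)
      also have "\<dots> = (\<Sum>A\<in>words UNIV i. exp (\<psi> A)) * ((\<Sum>B\<in>words UNIV l. exp (\<psi> B)) * (exp \<kappa> * exp (\<psi> I)))"
        by (simp only: sum_distrib_right)
      finally show ?thesis using total by simp
    qed
    show "S m i I \<le> exp (2 * K) * exp (\<psi> I)"
      unfolding S_eq[OF m] prod using ab(1) by (intro sum_mono exp_le_cancel_iff[THEN iffD2])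
    show "exp (- (2 * K)) * exp (\<psi> I) \<le> S m i I"
      unfolding S_eq[OF m] prod using ab(2) by (intro sum_mono exp_le_cancel_iff[THEN iffD2])
  qed
  obtain r \<mu> where r: "strict_mono r" and \<mu>: "stationary_weights UNIV \<mu>"
    and lim: "\<And>I. (\<lambda>m. p (Suc (r m)) I) \<longlonglongrightarrow> \<mu> I"
    using stationary_weights_seq_compact[of "\<lambda>m. p (Suc m)"] stat by auto
  have inv: "(\<lambda>m. real k / real (Suc (r m))) \<longlonglongrightarrow> 0" for k
    using LIMSEQ_subseq_LIMSEQ[OF LIMSEQ_Suc[OF lim_const_over_n[of "real k"]] r] by (simp add: o_def)
  let ?C = "exp (2 * K)"
  have lower: "(1 - real (length I) / real m) * (exp (- (2 * K)) * exp (\<psi> I)) \<le> p m I" if "m \<ge> 1" for m I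
  proof (cases "length I \<le> m")
    case True
    have "(real m - real (length I)) * (exp (- (2 * K)) * exp (\<psi> I)) = (\<Sum>i<m - length I. exp (- (2 * K)) * exp (\<psi> I))"
      using True by (simp add: of_nat_diff)
    also have "\<dots> \<le> (\<Sum>i<m - length I. S m i I)" using S_bounds(1) by (intro sum_mono) auto
    also have "\<dots> \<le> (\<Sum>i<m. S m i I)" using S0 by (intro sum_mono2) auto
    finally have "(real m - real (length I)) * (exp (- (2 * K)) * exp (\<psi> I)) / m \<le> p m I"
      unfolding p_def by (rule divide_right_mono) simp
    then show ?thesis using that by (simp add: diff_divide_distrib left_diff_distrib)
  next
    case False
    then have "1 - real (length I) / real m \<le> 0" using that by (simp add: field_simps)
    moreover have "0 \<le> p m I" using stationary_weightsD(2)[OF stat[OF that]] by simp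
    ultimately show ?thesis by (intro order_trans[OF mult_nonpos_nonneg]) auto
  qed
  have upper: "p m I \<le> ?C * exp (\<psi> I) + real (length I) / real m" if "m \<ge> 1" for m I
  proof -
    have "(\<Sum>i<m. S m i I) \<le> (\<Sum>i<m. ?C * exp (\<psi> I) + of_bool (m - length I \<le> i))"
    proof (rule sum_mono)
      fix i
      have "0 \<le> ?C * exp (\<psi> I)" by simp
      then show "S m i I \<le> ?C * exp (\<psi> I) + of_bool (m - length I \<le> i)"
        using S_bounds(2)[of i m I] S1[of m i I] by (cases "i < m - length I") (simp, simp add: add_increasing)
    qed
    also have "\<dots> = real m * (?C * exp (\<psi> I)) + real (card {i. i < m \<and> m - length I \<le> i})"
      by (simp add: sum.distrib of_bool_def sum.If_cases lessThan_def Int_def)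
    also have "real (card {i. i < m \<and> m - length I \<le> i}) \<le> real (length I)"
    proof -
      have "{i. i < m \<and> m - length I \<le> i} = {m - length I..<m}" by auto
      then show ?thesis by simp
    qed
    finally have "p m I \<le> (real m * (?C * exp (\<psi> I)) + real (length I)) / m"
      unfolding p_def by (intro divide_right_mono) auto
    then show ?thesis using that by (simp add: add_divide_distrib)
  qed
  have "exp (\<psi> I) \<le> ?C * \<mu> I" for I
  proof -
    have "(\<lambda>m. (1 - real (length I) / real (Suc (r m))) * (exp (- (2 * K)) * exp (\<psi> I)))
        \<longlonglongrightarrow> (1 - 0) * (exp (- (2 * K)) * exp (\<psi> I))"
      by (intro tendsto_intros inv)
    then have "(1 - 0) * (exp (- (2 * K)) * exp (\<psi> I)) \<le> \<mu> I"
      by (rule LIMSEQ_le[OF _ lim]) (intro exI allI impI lower, simp)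
    then show ?thesis by (simp add: exp_minus field_simps)
  qed
  moreover have "\<mu> I \<le> ?C * exp (\<psi> I)" for I
  proof -
    have "(\<lambda>m. ?C * exp (\<psi> I) + real (length I) / real (Suc (r m))) \<longlonglongrightarrow> ?C * exp (\<psi> I) + 0"
      by (intro tendsto_intros inv)
    then have "\<mu> I \<le> ?C * exp (\<psi> I) + 0"
      by (rule LIMSEQ_le[OF lim]) (intro exI allI impI upper, simp)
    then show ?thesis by simp
  qed
  ultimately show ?thesis using that[of \<mu> ?C] \<mu> by simp
qed

section \<open>Relative entropy and uniqueness\<close>

text \<open>Relative entropy on words of length \<open>n\<close> with respect to the weights
  \<open>exp \<psi>\<close>. The reference is given by its logarithm and may fail to be
  stationary.\<close>

definition divergence :: "('a::finite list \<Rightarrow> real) \<Rightarrow> ('a list \<Rightarrow> real) \<Rightarrow> nat \<Rightarrow> real" where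
  "divergence \<nu> \<psi> n = (\<Sum>I\<in>words UNIV n. \<nu> I * (ln (\<nu> I) - \<psi> I))"

lemma divergence_nonneg:
  assumes "stationary_weights UNIV \<nu>" "(\<Sum>I\<in>words UNIV n. exp (\<psi> I)) \<le> 1"
  shows "0 \<le> divergence \<nu> \<psi> n"
proof -
  have "(\<Sum>I\<in>words UNIV n. \<nu> I * ln (exp (\<psi> I))) \<le> (\<Sum>I\<in>words UNIV n. \<nu> I * ln (\<nu> I))"
    using assms stationary_weights_sum[OF assms(1)] stationary_weights_nonneg[OF assms(1)]
    by (intro gibbs_inequality) auto
  then show ?thesis by (simp add: divergence_def right_diff_distrib sum_subtractf)
qed

text \<open>The logarithmic density is at most ln C, uniformly in the length, so comparable weights
  have relative entropy rate zero.\<close>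

lemma divergence_le:
  assumes \<nu>: "stationary_weights UNIV \<nu>" and C: "C > 0" "\<And>I. \<nu> I \<le> C * exp (\<psi> I)"
  shows "divergence \<nu> \<psi> n \<le> ln C"
proof -
  have "divergence \<nu> \<psi> n \<le> (\<Sum>I\<in>words UNIV n. \<nu> I * ln C)"
    unfolding divergence_def
  proof (rule sum_mono)
    fix I :: "'a list" assume "I \<in> words UNIV n"
    then have "0 \<le> \<nu> I" using stationary_weights_nonneg[OF \<nu>] by simp
    show "\<nu> I * (ln (\<nu> I) - \<psi> I) \<le> \<nu> I * ln C"
    proof (cases "\<nu> I = 0")
      case False
      then have "ln (\<nu> I) \<le> ln (C * exp (\<psi> I))" using C \<open>0 \<le> \<nu> I\<close> by (intro ln_mono) auto
      also have "\<dots> = ln C + \<psi> I" using C by (simp add: ln_mult_pos)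
      finally show ?thesis using \<open>0 \<le> \<nu> I\<close> by (intro mult_left_mono) auto
    qed simp
  qed
  also have "\<dots> = ln C" using stationary_weights_sum[OF \<nu>] by (simp add: sum_distrib_right[symmetric])
  finally show ?thesis .
qed

text \<open>The relative entropy density dominates the squared Hellinger distance, which
  gives a weak form of Pinsker's inequality.\<close>

lemma abs_diff_le_relative_entropy:
  fixes p q t :: real
  assumes "0 \<le> p" "0 \<le> q" "q = 0 \<Longrightarrow> p = 0" "0 < t"
  shows "\<bar>p - q\<bar> \<le> (p * ln p - p * ln q - p + q) / (2 * t) + t * (p + q)"
proof -
  define x y where "x = sqrt p" and "y = sqrt q"
  have xy: "0 \<le> x" "0 \<le> y" "p = x\<^sup>2" "q = y\<^sup>2" using assms by (auto simp: x_def y_def)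
  have H: "(x - y)\<^sup>2 \<le> p * ln p - p * ln q - p + q"
  proof (cases "p = 0")
    case True
    then show ?thesis using xy by simp
  next
    case False
    then have pos: "0 < x" "0 < y" using assms xy by (auto simp: less_le)
    have "ln (y / x) \<le> y / x - 1" using pos by (intro ln_le_minus_one) simp
    then have "2 * x\<^sup>2 * ln (y / x) \<le> 2 * x\<^sup>2 * (y / x - 1)" by (intro mult_left_mono) auto
    also have "\<dots> = 2 * x * y - 2 * x\<^sup>2" using pos by (simp add: field_simps power2_eq_square)
    finally have "2 * x\<^sup>2 * (ln y - ln x) \<le> 2 * x * y - 2 * x\<^sup>2" using pos by (simp add: ln_div)
    moreover have "ln p = 2 * ln x" "ln q = 2 * ln y" using pos xy by (simp_all add: ln_realpow)
    ultimately show ?thesis using xy by (simp add: power2_eq_square algebra_simps)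
  qed
  have "\<bar>p - q\<bar> = \<bar>x - y\<bar> * (x + y)" using xy by (simp add: power2_eq_square square_diff_square_factored abs_mult mult.commute)
  \<comment> \<open>The arithmetic-geometric mean inequality with weight \<open>t\<close>. Keeping
    \<open>t\<close> free lets the estimate be summed over words before \<open>t\<close> is matched
    to the relative entropy.\<close>
  also have "\<dots> \<le> (x - y)\<^sup>2 / (2 * t) + t * (x + y)\<^sup>2 / 2"
  proof -
    have "0 \<le> (\<bar>x - y\<bar> - t * (x + y))\<^sup>2 / (2 * t)" using assms by simp
    also have "\<dots> = (x - y)\<^sup>2 / (2 * t) + t * (x + y)\<^sup>2 / 2 - \<bar>x - y\<bar> * (x + y)"
      using assms by (simp add: power2_diff power_mult_distrib add_divide_distrib diff_divide_distrib)
        (simp add: power2_eq_square field_simps)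
    finally show ?thesis by simp
  qed
  also have "\<dots> \<le> (p * ln p - p * ln q - p + q) / (2 * t) + t * (p + q)"
  proof (rule add_mono)
    have "0 \<le> (x - y)\<^sup>2" by simp
    then have "(x + y)\<^sup>2 / 2 \<le> p + q" using xy by (simp add: power2_eq_square algebra_simps)
    then show "t * (x + y)\<^sup>2 / 2 \<le> t * (p + q)"
      using mult_left_mono[of "(x + y)\<^sup>2 / 2" "p + q" t] assms by simp
  qed (use H assms in \<open>auto intro!: divide_right_mono\<close>)
  finally show ?thesis .
qed

text \<open>Otherwise every increment over \<open>N\<close> steps exceeds \<open>t\<close>, and
  \<open>D\<close> grows at rate at least t / N along the multiples of \<open>N\<close>.\<close>

lemma exists_small_increment:
  fixes D :: "nat \<Rightarrow> real"
  assumes D: "(\<lambda>n. D n / n) \<longlonglongrightarrow> 0" and N: "N \<ge> 1" and t: "t > 0"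
  shows "\<exists>m. D (m + N) - D m \<le> t"
proof (rule ccontr)
  assume "\<not> ?thesis"
  then have step: "D m + t \<le> D (m + N)" for m by (smt (verit))
  have "D 0 + real k * t \<le> D (k * N)" for k
  proof (induction k)
    case (Suc k)
    then show ?case using step[of "k * N"] by (simp add: algebra_simps)
  qed simp
  then have "(D 0 + real k * t) / real (k * N) \<le> D (k * N) / real (k * N)" for k
    by (intro divide_right_mono) auto
  moreover have "(D 0 + real k * t) / real (k * N) = D 0 / N / k + t / N" if "k \<ge> 1" for k
    using that N by (simp add: field_simps)
  ultimately have le: "D 0 / N / k + t / N \<le> D (k * N) / real (k * N)" if "k \<ge> 1" for k
    using that by metis
  have "strict_mono (\<lambda>k. k * N)" using N by (intro strict_monoI) auto
  from LIMSEQ_subseq_LIMSEQ[OF D this] have l1: "(\<lambda>k. D (k * N) / real (k * N)) \<longlonglongrightarrow> 0" by (simp add: o_def)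
  have l2: "(\<lambda>k. D 0 / N / k + t / N) \<longlonglongrightarrow> 0 + t / N"
    by (intro tendsto_add tendsto_const lim_const_over_n)
  have "0 + t / N \<le> 0" by (rule LIMSEQ_le[OF l2 l1]) (use le in blast)
  then show False using t N by (simp add: field_simps)
qed

text \<open>Small increments of the relative entropy say that, under \<open>\<nu>\<close>, a long word followed by a
  word of length \<open>N\<close> is nearly distributed as the first word under \<open>\<nu>\<close> followed by the \<open>\<mu>\<close>-conditional
  law. The lower quasi-Bernoulli bound makes this conditional kernel satisfy a Doeblin condition, hence
  a strict contraction in total variation.\<close>

lemma stationary_weights_unique_if_divergence_sublinear:
  fixes \<mu> \<nu> :: "'a::finite list \<Rightarrow> real"
  assumes \<mu>: "stationary_weights UNIV \<mu>" and pos: "\<And>I. 0 < \<mu> I"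
    and C: "C > 0" "\<And>I J. \<mu> I * \<mu> J \<le> C * \<mu> (I @ J)"
    and \<nu>: "stationary_weights UNIV \<nu>"
    and D: "(\<lambda>n. divergence \<nu> (\<lambda>I. ln (\<mu> I)) n / n) \<longlonglongrightarrow> 0"
  shows "\<nu> = \<mu>"
proof -
  define TV where "TV n = (\<Sum>I\<in>words UNIV n. \<bar>\<nu> I - \<mu> I\<bar>)" for n
  define D' where "D' n = divergence \<nu> (\<lambda>I. ln (\<mu> I)) n" for n
  have \<nu>0: "0 \<le> \<nu> I" for I using stationary_weightsD(2)[OF \<nu>] by simp
  have \<nu>_le: "\<nu> (I @ J) \<le> \<nu> I" for I J using stationary_weights_mono(1)[OF \<nu> finite] by simp
  have ext: "(\<Sum>J\<in>words UNIV N. \<nu> (I @ J)) = \<nu> I" "(\<Sum>J\<in>words UNIV N. \<mu> (I @ J)) = \<mu> I"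
    "(\<Sum>J\<in>words UNIV N. \<nu> (J @ I)) = \<nu> I" "(\<Sum>J\<in>words UNIV N. \<mu> (J @ I)) = \<mu> I" for I N
    using stationary_weights_append_right[OF \<nu>] stationary_weights_append_right[OF \<mu>]
      stationary_weights_append_left[OF \<nu>] stationary_weights_append_left[OF \<mu>] by auto
  have sum1: "(\<Sum>I\<in>words UNIV n. \<nu> I) = 1" "(\<Sum>I\<in>words UNIV n. \<mu> I) = 1" for n
    using stationary_weights_sum[OF \<nu>] stationary_weights_sum[OF \<mu>] by auto
  have contract: "TV N \<le> (1 - 1 / C) * TV m + 3 * t" if t: "t > 0" and small: "D' (m + N) - D' m \<le> t\<^sup>2" for N m t
  proof -
    define \<rho> where "\<rho> I J = \<nu> I * \<mu> (I @ J) / \<mu> I" for I J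
    let ?A = "words (UNIV :: 'a set) m" and ?B = "words (UNIV :: 'a set) N"
    have \<rho>0: "0 \<le> \<rho> I J" for I J using \<nu>0 less_imp_le[OF pos] by (simp add: \<rho>_def)
    have \<rho>_sum: "(\<Sum>J\<in>?B. \<rho> I J) = \<nu> I" for I
      using ext(2)[of I N] less_imp_neq[OF pos[of I]]
      by (simp add: \<rho>_def sum_distrib_left[symmetric] sum_divide_distrib[symmetric])
    have abs: "(\<Sum>I\<in>?A. \<Sum>J\<in>?B. \<bar>\<nu> (I @ J) - \<rho> I J\<bar>) \<le> 3 * t"
    proof -
      \<comment> \<open>The chain rule: summed over pairs of words, the relative entropy of
        \<open>\<nu>\<close> to the hybrid law \<open>\<rho>\<close> is exactly the increment of
        \<open>D'\<close>.\<close>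
      have key: "\<nu> (I @ J) * ln (\<nu> (I @ J)) - \<nu> (I @ J) * ln (\<rho> I J)
          = \<nu> (I @ J) * (ln (\<nu> (I @ J)) - ln (\<mu> (I @ J))) - \<nu> (I @ J) * (ln (\<nu> I) - ln (\<mu> I))" for I J
      proof (cases "\<nu> (I @ J) = 0")
        case False
        then have "0 < \<nu> I" using \<nu>_le[of I J] \<nu>0[of "I @ J"] by linarith
        then have ln_\<rho>: "ln (\<rho> I J) = ln (\<nu> I) + ln (\<mu> (I @ J)) - ln (\<mu> I)"
          unfolding \<rho>_def using pos[of I] pos[of "I @ J"] by (simp add: ln_div ln_mult_pos)
        show ?thesis unfolding ln_\<rho> by (simp add: algebra_simps)
      qed simp
      have "(\<Sum>I\<in>?A. \<Sum>J\<in>?B. \<bar>\<nu> (I @ J) - \<rho> I J\<bar>)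
        \<le> (\<Sum>I\<in>?A. \<Sum>J\<in>?B. (\<nu> (I @ J) * ln (\<nu> (I @ J)) - \<nu> (I @ J) * ln (\<rho> I J) - \<nu> (I @ J) + \<rho> I J) / (2 * t)
            + t * (\<nu> (I @ J) + \<rho> I J))"
      proof (intro sum_mono abs_diff_le_relative_entropy \<nu>0 \<rho>0 t)
        fix I J assume "\<rho> I J = 0"
        then have "\<nu> I = 0" using less_imp_neq[OF pos[of I]] less_imp_neq[OF pos[of "I @ J"]] by (auto simp: \<rho>_def)
        then show "\<nu> (I @ J) = 0" using \<nu>_le[of I J] \<nu>0[of "I @ J"] by simp
      qed
      also have "\<dots> = (\<Sum>I\<in>?A. \<Sum>J\<in>?B. (\<nu> (I @ J) * (ln (\<nu> (I @ J)) - ln (\<mu> (I @ J)))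
          - \<nu> (I @ J) * (ln (\<nu> I) - ln (\<mu> I)) - \<nu> (I @ J) + \<rho> I J) / (2 * t) + t * (\<nu> (I @ J) + \<rho> I J))"
        by (simp only: key)
      also have "\<dots> = ((\<Sum>I\<in>?A. \<Sum>J\<in>?B. \<nu> (I @ J) * (ln (\<nu> (I @ J)) - ln (\<mu> (I @ J))))
          - (\<Sum>I\<in>?A. (\<Sum>J\<in>?B. \<nu> (I @ J)) * (ln (\<nu> I) - ln (\<mu> I)))
          - (\<Sum>I\<in>?A. \<Sum>J\<in>?B. \<nu> (I @ J)) + (\<Sum>I\<in>?A. \<Sum>J\<in>?B. \<rho> I J)) / (2 * t)
          + t * ((\<Sum>I\<in>?A. \<Sum>J\<in>?B. \<nu> (I @ J)) + (\<Sum>I\<in>?A. \<Sum>J\<in>?B. \<rho> I J))"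
        by (simp add: sum.distrib sum_subtractf sum_distrib_left sum_distrib_right sum_divide_distrib
            add_divide_distrib diff_divide_distrib distrib_left)
      also have "\<dots> = (D' (m + N) - D' m) / (2 * t) + 2 * t"
        by (simp add: ext \<rho>_sum sum1 D'_def divergence_def sum_words_append)
      also have "\<dots> \<le> t\<^sup>2 / (2 * t) + 2 * t" using small t by (intro add_right_mono divide_right_mono) auto
      also have "\<dots> \<le> 3 * t" using t by (simp add: power2_eq_square)
      finally show ?thesis .
    qed
    \<comment> \<open>The Doeblin condition: the conditional law given \<open>I\<close> dominates
      the law of \<open>J\<close> scaled by 1 / C, independently of \<open>I\<close>. Removing that
      part leaves a kernel of mass 1 - 1 / C.\<close>
    have kernel: "0 \<le> \<mu> (I @ J) / \<mu> I - \<mu> J / C" for I J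
      using C(2)[of I J] C(1) pos[of I] by (simp add: field_simps)
    have "TV N \<le> (\<Sum>J\<in>?B. (\<Sum>I\<in>?A. \<bar>\<nu> (I @ J) - \<rho> I J\<bar>) + (\<Sum>I\<in>?A. \<bar>\<nu> I - \<mu> I\<bar> * (\<mu> (I @ J) / \<mu> I - \<mu> J / C)))"
      unfolding TV_def
    proof (rule sum_mono)
      fix J :: "'a list"
      \<comment> \<open>The common part may be subtracted for free because \<open>\<nu>\<close> and
        \<open>\<mu>\<close> have the same total mass on words of length \<open>m\<close>.\<close>
      have "\<nu> J - \<mu> J = (\<Sum>I\<in>?A. \<nu> (I @ J)) - (\<Sum>I\<in>?A. \<mu> (I @ J)) - ((\<Sum>I\<in>?A. \<nu> I) - (\<Sum>I\<in>?A. \<mu> I)) * (\<mu> J / C)"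
        using ext(3,4)[of J m] sum1[of m] by simp
      also have "\<dots> = (\<Sum>I\<in>?A. (\<nu> (I @ J) - \<mu> (I @ J)) - (\<nu> I - \<mu> I) * (\<mu> J / C))"
        by (simp only: sum_subtractf[symmetric] sum_distrib_right)
      also have "\<dots> = (\<Sum>I\<in>?A. (\<nu> (I @ J) - \<rho> I J) + (\<nu> I - \<mu> I) * (\<mu> (I @ J) / \<mu> I - \<mu> J / C))"
      proof (rule sum.cong[OF refl])
        fix I
        have "\<rho> I J - \<mu> (I @ J) = (\<nu> I - \<mu> I) * (\<mu> (I @ J) / \<mu> I)"
          using less_imp_neq[OF pos[of I]] by (simp add: \<rho>_def left_diff_distrib diff_divide_distrib)
        then show "(\<nu> (I @ J) - \<mu> (I @ J)) - (\<nu> I - \<mu> I) * (\<mu> J / C)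
            = (\<nu> (I @ J) - \<rho> I J) + (\<nu> I - \<mu> I) * (\<mu> (I @ J) / \<mu> I - \<mu> J / C)"
          unfolding right_diff_distrib by linarith
      qed
      finally have "\<bar>\<nu> J - \<mu> J\<bar> \<le> (\<Sum>I\<in>?A. \<bar>(\<nu> (I @ J) - \<rho> I J) + (\<nu> I - \<mu> I) * (\<mu> (I @ J) / \<mu> I - \<mu> J / C)\<bar>)"
        by simp
      also have "\<dots> \<le> (\<Sum>I\<in>?A. \<bar>\<nu> (I @ J) - \<rho> I J\<bar> + \<bar>\<nu> I - \<mu> I\<bar> * (\<mu> (I @ J) / \<mu> I - \<mu> J / C))"
      proof (rule sum_mono)
        fix I
        show "\<bar>(\<nu> (I @ J) - \<rho> I J) + (\<nu> I - \<mu> I) * (\<mu> (I @ J) / \<mu> I - \<mu> J / C)\<bar>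
          \<le> \<bar>\<nu> (I @ J) - \<rho> I J\<bar> + \<bar>\<nu> I - \<mu> I\<bar> * (\<mu> (I @ J) / \<mu> I - \<mu> J / C)"
          using abs_triangle_ineq[of "\<nu> (I @ J) - \<rho> I J" "(\<nu> I - \<mu> I) * (\<mu> (I @ J) / \<mu> I - \<mu> J / C)"]
            kernel[of I J] by (simp add: abs_mult)
      qed
      finally show "\<bar>\<nu> J - \<mu> J\<bar> \<le> (\<Sum>I\<in>?A. \<bar>\<nu> (I @ J) - \<rho> I J\<bar>) + (\<Sum>I\<in>?A. \<bar>\<nu> I - \<mu> I\<bar> * (\<mu> (I @ J) / \<mu> I - \<mu> J / C))"
        by (simp add: sum.distrib)
    qed
    also have "\<dots> = (\<Sum>I\<in>?A. \<Sum>J\<in>?B. \<bar>\<nu> (I @ J) - \<rho> I J\<bar>)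
        + (\<Sum>I\<in>?A. \<Sum>J\<in>?B. \<bar>\<nu> I - \<mu> I\<bar> * (\<mu> (I @ J) / \<mu> I - \<mu> J / C))"
      unfolding sum.distrib by (intro arg_cong2[where f = "(+)"] sum.swap)
    also have "(\<Sum>I\<in>?A. \<Sum>J\<in>?B. \<bar>\<nu> I - \<mu> I\<bar> * (\<mu> (I @ J) / \<mu> I - \<mu> J / C)) = (1 - 1 / C) * TV m"
    proof -
      have "(\<Sum>J\<in>?B. \<mu> (I @ J) / \<mu> I - \<mu> J / C) = 1 - 1 / C" for I
        using ext(2)[of I N] sum1(2)[of N] less_imp_neq[OF pos[of I]]
        by (simp add: sum_subtractf sum_divide_distrib[symmetric])
      then show ?thesis unfolding TV_def by (simp add: sum_distrib_left[symmetric] sum_distrib_right[symmetric] mult.commute)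
    qed
    finally show ?thesis using abs by linarith
  qed
  have TV_le: "TV n \<le> 2" for n
  proof -
    have "TV n \<le> (\<Sum>I\<in>words UNIV n. \<nu> I + \<mu> I)"
      unfolding TV_def by (intro sum_mono) (use \<nu>0 less_imp_le[OF pos] in \<open>smt (verit)\<close>)
    then show ?thesis using sum1 by (simp add: sum.distrib)
  qed
  define T where "T = (SUP n. TV n)"
  have bdd: "bdd_above (range TV)" using TV_le by (intro bdd_aboveI[of _ 2]) auto
  have TV_T: "TV n \<le> T" for n unfolding T_def using bdd by (intro cSUP_upper) auto
  have C1: "1 \<le> C"
    using C(2)[of "[]" "[]"] stationary_weightsD(1)[OF \<mu>] by simp
  have D'_lim: "(\<lambda>n. D' n / n) \<longlonglongrightarrow> 0" using D by (simp add: D'_def)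
  \<comment> \<open>The length \<open>m\<close> supplied by the small increment is not under
    control, so the contraction is compared with the supremum \<open>T\<close>, which it then forces
    to be nonpositive.\<close>
  have step: "TV N \<le> (1 - 1 / C) * T" for N
  proof (cases "N = 0")
    case True
    then have "TV N = 0" using stationary_weightsD(1)[OF \<mu>] stationary_weightsD(1)[OF \<nu>] by (simp add: TV_def)
    moreover have "0 \<le> T" using TV_T[of N] calculation by simp
    moreover have "0 \<le> 1 - 1 / C" using C1 by simp
    ultimately show ?thesis by simp
  next
    case False
    have "TV N \<le> (1 - 1 / C) * T + e" if e: "e > 0" for e
    proof -
      obtain m where "D' (m + N) - D' m \<le> (e / 3)\<^sup>2"
        using exists_small_increment[OF D'_lim, of N "(e / 3)\<^sup>2"] False e by auto
      then have "TV N \<le> (1 - 1 / C) * TV m + 3 * (e / 3)" using e by (intro contract) auto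
      also have "(1 - 1 / C) * TV m \<le> (1 - 1 / C) * T" using TV_T C1 by (intro mult_left_mono) auto
      finally show ?thesis by simp
    qed
    then show ?thesis by (rule field_le_epsilon)
  qed
  have "T \<le> (1 - 1 / C) * T" unfolding T_def[symmetric] by (subst T_def) (intro cSUP_least step, simp)
  then have "T / C \<le> 0" by (simp add: algebra_simps)
  then have "T \<le> 0" using C(1) by (simp add: field_simps)
  show ?thesis
  proof
    fix I
    have "\<bar>\<nu> I - \<mu> I\<bar> \<le> TV (length I)"
      unfolding TV_def by (rule member_le_sum) (auto simp: words_def finite_lists_length_eq[of UNIV, simplified])
    then show "\<nu> I = \<mu> I" using TV_T[of "length I"] \<open>T \<le> 0\<close> by linarith
  qed
qed

section \<open>Weighted equilibrium states at the level of weights\<close>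

definition weighted_rate :: "real \<Rightarrow> real \<Rightarrow> ('a \<Rightarrow> 'd) \<Rightarrow> ('a::finite list \<Rightarrow> real) \<Rightarrow> real" where
  "weighted_rate a b f \<nu> = a * entropy_rate UNIV \<nu> + b * entropy_rate UNIV (push_weights f \<nu>)"

text \<open>Substituting the equation for \<open>s\<close> splits the energy into two parts, and
  each of the two entropies pairs with its own reference weights. The identity is exact at every
  length, so \<open>R n\<close> acts as a finite-level pressure.\<close>

lemma weighted_energy_identity:
  fixes f :: "'a::finite \<Rightarrow> 'd::finite"
  assumes \<nu>: "stationary_weights UNIV \<nu>"
    and eq: "\<And>I. a * \<psi> I + b * fibre_log_sum f \<psi> (map f I) = s I - R (length I)"
  shows "(\<Sum>I\<in>words UNIV n. \<nu> I * s I) + a * word_entropy UNIV \<nu> n + b * word_entropy UNIV (push_weights f \<nu>) n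
    = R n - a * divergence \<nu> \<psi> n - b * divergence (push_weights f \<nu>) (fibre_log_sum f \<psi>) n"
proof -
  have "(\<Sum>I\<in>words UNIV n. \<nu> I * s I)
      = (\<Sum>I\<in>words UNIV n. a * (\<nu> I * \<psi> I) + b * (\<nu> I * fibre_log_sum f \<psi> (map f I)) + \<nu> I * R n)"
  proof (intro sum.cong refl)
    fix I :: "'a list" assume "I \<in> words UNIV n"
    then have "s I = a * \<psi> I + b * fibre_log_sum f \<psi> (map f I) + R n" using eq[of I] by (simp add: words_def)
    then show "\<nu> I * s I = a * (\<nu> I * \<psi> I) + b * (\<nu> I * fibre_log_sum f \<psi> (map f I)) + \<nu> I * R n"
      by (simp add: algebra_simps)
  qed
  also have "\<dots> = a * (\<Sum>I\<in>words UNIV n. \<nu> I * \<psi> I) + b * (\<Sum>I\<in>words UNIV n. \<nu> I * fibre_log_sum f \<psi> (map f I)) + R n"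
    using stationary_weights_sum[OF \<nu>] by (simp add: sum.distrib sum_distrib_left[symmetric] sum_distrib_right[symmetric])
  also have "(\<Sum>I\<in>words UNIV n. \<nu> I * fibre_log_sum f \<psi> (map f I))
      = (\<Sum>J\<in>words UNIV n. push_weights f \<nu> J * fibre_log_sum f \<psi> J)"
    unfolding push_weights_def sum_distrib_right
    by (subst sum_words_fibre[where f = f, symmetric]) (auto intro!: sum.cong)
  finally show ?thesis
    by (simp add: word_entropy_def divergence_def right_diff_distrib sum_subtractf)
qed

lemma exists_unique_weighted_equilibrium:
  fixes f :: "'a::finite \<Rightarrow> 'd::finite" and s :: "'a list \<Rightarrow> real"
  assumes f: "surj f" and s: "quasi_additive s" and a: "a > 0" and b: "b \<ge> 0"
    and L: "\<And>\<nu>. stationary_weights UNIV \<nu> \<Longrightarrow> (\<lambda>n. (\<Sum>I\<in>words UNIV n. \<nu> I * s I) / n) \<longlonglongrightarrow> L \<nu>"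
  obtains \<mu> C where "stationary_weights UNIV \<mu>" "C > 0" "\<And>I. 0 < \<mu> I"
    "\<And>I J. \<mu> (I @ J) \<le> C * (\<mu> I * \<mu> J)" "\<And>I J. \<mu> I * \<mu> J \<le> C * \<mu> (I @ J)"
    "\<And>\<nu>. stationary_weights UNIV \<nu> \<Longrightarrow> L \<nu> + weighted_rate a b f \<nu> \<le> L \<mu> + weighted_rate a b f \<mu>"
    "\<And>\<nu>. stationary_weights UNIV \<nu> \<Longrightarrow> L \<nu> + weighted_rate a b f \<nu> = L \<mu> + weighted_rate a b f \<mu> \<Longrightarrow> \<nu> = \<mu>"
proof -
  obtain \<psi> R where q: "quasi_additive \<psi>" and total: "\<And>n. (\<Sum>I\<in>words UNIV n. exp (\<psi> I)) = 1"
    and eq: "\<And>I. a * \<psi> I + b * fibre_log_sum f \<psi> (map f I) = s I - R (length I)"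
    using exists_weighted_gibbs_weights[OF f s a b] by blast
  obtain \<mu> C where \<mu>: "stationary_weights UNIV \<mu>" and C: "C > 0"
    and lower: "\<And>I. exp (\<psi> I) \<le> C * \<mu> I" and upper: "\<And>I. \<mu> I \<le> C * exp (\<psi> I)"
    using exists_comparable_stationary_weights[OF q total] by blast
  obtain K where K: "\<And>I J. \<bar>\<psi> (I @ J) - \<psi> I - \<psi> J\<bar> \<le> K" using q unfolding quasi_additive_def by blast
  let ?\<rho> = "fibre_log_sum f \<psi>" and ?p = "push_weights f"
  have \<mu>_pos: "0 < \<mu> I" for I
  proof -
    have "0 < C * \<mu> I" using lower[of I] exp_gt_zero[of "\<psi> I"] by linarith
    then show ?thesis using C by (simp add: zero_less_mult_iff)
  qed
  \<comment> \<open>Three comparisons between \<open>\<mu>\<close> and \<open>exp \<psi>\<close>,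
    each costing \<open>C\<close>, and one use of the quasi-additivity of
    \<open>\<psi>\<close>.\<close>
  let ?C = "C ^ 3 * exp K"
  have qb1: "\<mu> (I @ J) \<le> ?C * (\<mu> I * \<mu> J)" for I J
  proof -
    have "\<mu> (I @ J) \<le> C * exp (\<psi> (I @ J))" by (rule upper)
    also have "\<dots> \<le> C * exp (K + (\<psi> I + \<psi> J))" using C K[of I J] by (intro mult_left_mono exp_le_cancel_iff[THEN iffD2]) linarith+
    also have "\<dots> = C * exp K * (exp (\<psi> I) * exp (\<psi> J))" by (simp add: exp_add)
    also have "\<dots> \<le> C * exp K * ((C * \<mu> I) * (C * \<mu> J))" using C lower less_imp_le[OF \<mu>_pos] by (intro mult_left_mono mult_mono) auto
    finally show ?thesis by (simp add: power3_eq_cube mult_ac)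
  qed
  have qb2: "\<mu> I * \<mu> J \<le> ?C * \<mu> (I @ J)" for I J
  proof -
    have "\<mu> I * \<mu> J \<le> (C * exp (\<psi> I)) * (C * exp (\<psi> J))" using C upper less_imp_le[OF \<mu>_pos] by (intro mult_mono) auto
    also have "\<dots> = C * C * exp (\<psi> I + \<psi> J)" by (simp add: exp_add)
    also have "\<dots> \<le> C * C * exp (K + \<psi> (I @ J))" using C K[of I J] by (intro mult_left_mono exp_le_cancel_iff[THEN iffD2]) auto
    also have "\<dots> = C * C * exp K * exp (\<psi> (I @ J))" by (simp add: exp_add)
    also have "\<dots> \<le> C * C * exp K * (C * \<mu> (I @ J))" using C lower by (intro mult_left_mono) auto
    finally show ?thesis by (simp add: power3_eq_cube mult_ac)
  qed
  have total_push: "(\<Sum>J\<in>words UNIV n. exp (?\<rho> J)) = 1" for n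
    using total sum_words_fibre[where f = f and g = "\<lambda>I. exp (\<psi> I)"] by (simp add: exp_fibre_log_sum[OF f])
  have D1: "0 \<le> divergence \<nu> \<psi> n" and D2: "0 \<le> divergence (?p \<nu>) ?\<rho> n" if "stationary_weights UNIV \<nu>" for \<nu> n
    by (rule divergence_nonneg[OF that], simp add: total)
       (rule divergence_nonneg[OF push_weights_stationary[OF that]], simp add: total_push)
  define E where "E \<nu> n = (\<Sum>I\<in>words UNIV n. \<nu> I * s I) + a * word_entropy UNIV \<nu> n + b * word_entropy UNIV (?p \<nu>) n" for \<nu> n
  define T where "T \<nu> = L \<nu> + weighted_rate a b f \<nu>" for \<nu>
  have E: "(\<lambda>n. E \<nu> n / n) \<longlonglongrightarrow> T \<nu>" if \<nu>: "stationary_weights UNIV \<nu>" for \<nu>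
  proof -
    have "(\<lambda>n. (\<Sum>I\<in>words UNIV n. \<nu> I * s I) / n + (a * (word_entropy UNIV \<nu> n / n) + b * (word_entropy UNIV (?p \<nu>) n / n))) \<longlonglongrightarrow> T \<nu>"
      unfolding T_def weighted_rate_def
      by (intro tendsto_add tendsto_mult tendsto_const L[OF \<nu>]
          entropy_rate_tendsto[OF \<nu> finite] entropy_rate_tendsto[OF push_weights_stationary[OF \<nu>] finite])
    then show ?thesis unfolding E_def by (simp only: add_divide_distrib add.assoc times_divide_eq_right)
  qed
  have E_eq: "E \<nu> n = R n - (a * divergence \<nu> \<psi> n + b * divergence (?p \<nu>) ?\<rho> n)" if "stationary_weights UNIV \<nu>" for \<nu> n
    unfolding E_def weighted_energy_identity[OF that eq] by simp
  \<comment> \<open>For \<open>\<mu>\<close> both divergences stay bounded, so the finite-level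
    pressure grows at the rate that \<open>\<mu>\<close> attains.\<close>
  have R: "(\<lambda>n. R n / n) \<longlonglongrightarrow> T \<mu>"
  proof -
    let ?D = "\<lambda>n. a * divergence \<mu> \<psi> n + b * divergence (?p \<mu>) ?\<rho> n"
    have push_le: "?p \<mu> J \<le> C * exp (?\<rho> J)" for J
      unfolding exp_fibre_log_sum[OF f] push_weights_def sum_distrib_left by (intro sum_mono upper)
    have D_le: "?D n \<le> (a + b) * ln C" for n
      unfolding distrib_right using a b
      by (intro add_mono mult_left_mono divergence_le[OF \<mu> C upper]
          divergence_le[OF push_weights_stationary[OF \<mu>] C push_le]) auto
    have D_ge: "0 \<le> ?D n" for n using D1[OF \<mu>, of n] D2[OF \<mu>, of n] a b by simp
    have D_lim: "(\<lambda>n. ?D n / n) \<longlonglongrightarrow> 0"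
    proof (rule real_tendsto_sandwich[OF _ _ tendsto_const lim_const_over_n[of "(a + b) * ln C"]])
      show "\<forall>\<^sub>F n in sequentially. 0 \<le> ?D n / n"
        by (intro always_eventually allI divide_nonneg_nonneg D_ge) simp
      show "\<forall>\<^sub>F n in sequentially. ?D n / n \<le> (a + b) * ln C / n"
        by (intro always_eventually allI divide_right_mono D_le) simp
    qed
    have "E \<mu> n / n + ?D n / n = R n / n" for n
      unfolding E_eq[OF \<mu>] add_divide_distrib[symmetric] by simp
    then show ?thesis using tendsto_add[OF E[OF \<mu>] D_lim] by (simp only: add_0_right)
  qed
  have gap: "(\<lambda>n. (a * divergence \<nu> \<psi> n + b * divergence (?p \<nu>) ?\<rho> n) / n) \<longlonglongrightarrow> T \<mu> - T \<nu>"
    if \<nu>: "stationary_weights UNIV \<nu>" for \<nu>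
  proof -
    have "R n / n - E \<nu> n / n = (a * divergence \<nu> \<psi> n + b * divergence (?p \<nu>) ?\<rho> n) / n" for n
      unfolding E_eq[OF \<nu>] diff_divide_distrib[symmetric] by simp
    from tendsto_diff[OF R E[OF \<nu>], unfolded this] show ?thesis .
  qed
  have le: "T \<nu> \<le> T \<mu>" if \<nu>: "stationary_weights UNIV \<nu>" for \<nu>
  proof -
    have "0 \<le> T \<mu> - T \<nu>"
      using D1[OF \<nu>] D2[OF \<nu>] a b
      by (intro LIMSEQ_le_const[OF gap[OF \<nu>]] exI allI impI divide_nonneg_nonneg add_nonneg_nonneg mult_nonneg_nonneg)
        auto
    then show ?thesis by simp
  qed
  have unique: "\<nu> = \<mu>" if \<nu>: "stationary_weights UNIV \<nu>" and T: "T \<nu> = T \<mu>" for \<nu>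
  proof (rule stationary_weights_unique_if_divergence_sublinear[OF \<mu> \<mu>_pos _ qb2 \<nu>])
    let ?G = "\<lambda>n. (a * divergence \<nu> \<psi> n + b * divergence (?p \<nu>) ?\<rho> n) / n"
    let ?D = "divergence \<nu> (\<lambda>I. ln (\<mu> I))"
    have \<nu>0: "0 \<le> \<nu> I" for I using stationary_weightsD(2)[OF \<nu>] by simp
    \<comment> \<open>Replacing the reference \<open>exp \<psi>\<close> by the stationary
      \<open>\<mu>\<close> costs at most ln C.\<close>
    have D_le: "?D n \<le> divergence \<nu> \<psi> n + ln C" for n
    proof -
      have "?D n \<le> (\<Sum>I\<in>words UNIV n. \<nu> I * (ln (\<nu> I) - \<psi> I) + \<nu> I * ln C)"
        unfolding divergence_def
      proof (rule sum_mono)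
        fix I
        have "\<psi> I = ln (exp (\<psi> I))" by simp
        also have "\<dots> \<le> ln (C * \<mu> I)" using lower[of I] by (intro ln_mono) auto
        also have "\<dots> = ln C + ln (\<mu> I)" using C \<mu>_pos[of I] by (simp add: ln_mult_pos)
        finally have "ln (\<nu> I) - ln (\<mu> I) \<le> ln (\<nu> I) - \<psi> I + ln C" by simp
        from mult_left_mono[OF this \<nu>0[of I]]
        show "\<nu> I * (ln (\<nu> I) - ln (\<mu> I)) \<le> \<nu> I * (ln (\<nu> I) - \<psi> I) + \<nu> I * ln C"
          by (simp add: distrib_left)
      qed
      then show ?thesis
        using stationary_weights_sum[OF \<nu>] by (simp add: divergence_def sum.distrib sum_distrib_right[symmetric])
    qed
    have hi: "?D n / n \<le> ?G n / a + ln C / n" for n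
    proof -
      have "divergence \<nu> \<psi> n \<le> (a * divergence \<nu> \<psi> n + b * divergence (?p \<nu>) ?\<rho> n) / a"
        using D2[OF \<nu>, of n] a b by (simp add: add_divide_distrib)
      then have le': "?D n / n \<le> ((a * divergence \<nu> \<psi> n + b * divergence (?p \<nu>) ?\<rho> n) / a + ln C) / n"
        using D_le[of n] by (intro divide_right_mono) auto
      have "(X / a + c) / m = X / m / a + c / m" for X c m :: real
        by (simp add: add_divide_distrib mult.commute)
      from le'[unfolded this] show ?thesis .
    qed
    have lo: "0 \<le> ?D n / n" for n
    proof -
      have "(\<Sum>I\<in>words UNIV n. exp (ln (\<mu> I))) \<le> 1"
        using stationary_weights_sum[OF \<mu>, of n] \<mu>_pos by simp
      then show ?thesis using divergence_nonneg[OF \<nu>] by simp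
    qed
    have "(\<lambda>n. ?G n / a + ln C / n) \<longlonglongrightarrow> 0 / a + 0"
      using gap[OF \<nu>] T a by (intro tendsto_add tendsto_divide tendsto_const lim_const_over_n) auto
    then have lim: "(\<lambda>n. ?G n / a + ln C / n) \<longlonglongrightarrow> 0" by simp
    show "(\<lambda>n. ?D n / n) \<longlonglongrightarrow> 0"
      by (rule real_tendsto_sandwich[OF always_eventually always_eventually tendsto_const lim])
         (use lo hi in blast)+
  qed (use C in simp)
  show ?thesis
  proof (rule that[OF \<mu> _ \<mu>_pos qb1 qb2])
    show "0 < ?C" using C by simp
    show "L \<nu> + weighted_rate a b f \<nu> \<le> L \<mu> + weighted_rate a b f \<mu>"
      if "stationary_weights UNIV \<nu>" for \<nu>
      using le[OF that] unfolding T_def .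
    show "\<nu> = \<mu>"
      if "stationary_weights UNIV \<nu>" "L \<nu> + weighted_rate a b f \<nu> = L \<mu> + weighted_rate a b f \<mu>" for \<nu>
      by (rule unique[OF that(1)]) (unfold T_def, rule that(2))
  qed
qed

section \<open>Lagrange multipliers\<close>

text \<open>Points on either side of the constraint give one-sided bounds on \<open>c\<close>. A
  segment joining two opposite points crosses the constraint, where \<open>F\<close> is at most
  \<open>H\<close>, so concavity makes the bounds compatible and the supremum of the lower ones
  works. The reflection hypothesis puts points on both sides unless all of \<open>C\<close> lies on
  the constraint, where \<open>c = 0\<close> suffices.\<close>

lemma lagrange_multiplier:
  fixes C :: "('c \<Rightarrow> real) set" and F :: "('c \<Rightarrow> real) \<Rightarrow> real"
  assumes convex: "\<And>x y t. x \<in> C \<Longrightarrow> y \<in> C \<Longrightarrow> 0 \<le> t \<Longrightarrow> t \<le> 1 \<Longrightarrow> (\<lambda>j. t * x j + (1 - t) * y j) \<in> C"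
    and concave: "\<And>x y t. x \<in> C \<Longrightarrow> y \<in> C \<Longrightarrow> 0 \<le> t \<Longrightarrow> t \<le> 1 \<Longrightarrow>
      t * F x + (1 - t) * F y \<le> F (\<lambda>j. t * x j + (1 - t) * y j)"
    and slater: "\<And>x. x \<in> C \<Longrightarrow> \<exists>y\<in>C. \<exists>\<epsilon>>0. y i - e i = - \<epsilon> * (x i - e i)"
    and bound: "\<And>x. x \<in> C \<Longrightarrow> x i = e i \<Longrightarrow> F x \<le> H"
  shows "\<exists>c. \<forall>x\<in>C. F x + c * (x i - e i) \<le> H"
proof (cases "\<exists>x\<in>C. x i > e i")
  case False
  have "F x \<le> H" if x: "x \<in> C" for x
  proof (rule bound[OF x])
    obtain y \<epsilon> where y: "y \<in> C" "\<epsilon> > 0" "y i - e i = - \<epsilon> * (x i - e i)" using slater[OF x] by blast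
    have "x i \<le> e i" "y i \<le> e i" using False x y(1) by (auto simp: not_less)
    moreover have "0 \<le> - \<epsilon> * (x i - e i)" using y(2) \<open>x i \<le> e i\<close> by (simp add: mult_nonneg_nonpos)
    ultimately have "\<epsilon> * (x i - e i) = 0" using y(3) by linarith
    then show "x i = e i" using y(2) by simp
  qed
  then show ?thesis by (intro exI[of _ 0]) simp
next
  case True
  then obtain x0 where x0: "x0 \<in> C" "x0 i > e i" by blast
  define A where "A = {(F y - H) / (e i - y i) | y. y \<in> C \<and> y i < e i}"
  have key: "(F y - H) / (e i - y i) \<le> (H - F x) / (x i - e i)"
    if x: "x \<in> C" "x i > e i" and y: "y \<in> C" "y i < e i" for x y
  proof -
    define c d where "c = e i - y i" and "d = x i - e i"
    have cd: "c > 0" "d > 0" using x y by (auto simp: c_def d_def)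
    \<comment> \<open>The parameter at which the segment from \<open>y\<close> to \<open>x\<close>
      meets the constraint.\<close>
    define t where "t = c / (c + d)"
    have t: "0 \<le> t" "t \<le> 1" "1 - t = d / (c + d)" using cd by (auto simp: t_def field_simps)
    let ?z = "\<lambda>j. t * x j + (1 - t) * y j"
    have "?z i - e i = t * d - (1 - t) * c" unfolding c_def d_def by (simp add: algebra_simps)
    also have "\<dots> = 0" unfolding t(3) unfolding t_def by simp
    finally have "F ?z \<le> H" using convex[OF x(1) y(1) t(1,2)] by (intro bound) auto
    then have "t * F x + (1 - t) * F y \<le> H" using concave[OF x(1) y(1) t(1,2)] by linarith
    then have "(c * F x + d * F y) / (c + d) \<le> H" unfolding t(3) unfolding t_def by (simp add: add_divide_distrib)
    then have "c * F x + d * F y \<le> H * (c + d)" using cd by (simp add: pos_divide_le_eq)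
    then have "(F y - H) * d \<le> (H - F x) * c" by (simp add: algebra_simps)
    then have "(F y - H) / c \<le> (H - F x) / d" using cd by (simp add: field_simps)
    then show ?thesis by (simp add: c_def d_def)
  qed
  have "\<exists>y\<in>C. y i < e i"
  proof -
    obtain y \<epsilon> where y: "y \<in> C" "\<epsilon> > 0" "y i - e i = - \<epsilon> * (x0 i - e i)" using slater[OF x0(1)] by blast
    moreover have "0 < \<epsilon> * (x0 i - e i)" using y(2) x0(2) by simp
    ultimately show ?thesis by (intro bexI[of _ y]) auto
  qed
  then have ne: "A \<noteq> {}" unfolding A_def by blast
  have bdd: "bdd_above A" unfolding A_def using key[OF x0] by (intro bdd_aboveI[of _ "(H - F x0) / (x0 i - e i)"]) auto
  have "F x + Sup A * (x i - e i) \<le> H" if x: "x \<in> C" for x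
  proof -
    consider "x i = e i" | "x i > e i" | "x i < e i" by linarith
    then show ?thesis
    proof cases
      case 2
      have "Sup A \<le> (H - F x) / (x i - e i)"
        using ne key[OF x 2] by (intro cSup_least) (auto simp: A_def)
      then show ?thesis using 2 by (simp add: pos_le_divide_eq)
    next
      case 3
      have "(F x - H) / (e i - x i) \<le> Sup A" using x 3 bdd by (intro cSup_upper) (auto simp: A_def)
      then have "F x - H \<le> Sup A * (e i - x i)" using 3 by (simp add: pos_divide_le_eq)
      then show ?thesis by (simp add: algebra_simps)
    qed (use bound x in auto)
  qed
  then show ?thesis by blast
qed

text \<open>Constraints are removed one at a time. The multiplier of \<open>i\<close> is found on
  the slice where the other constraints hold, which the reflection preserves; its linear term is
  then absorbed into \<open>F\<close>, so the induction must allow any concave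
  \<open>F\<close>.\<close>

lemma lagrange_multipliers:
  fixes C :: "('c \<Rightarrow> real) set" and F :: "('c \<Rightarrow> real) \<Rightarrow> real"
  assumes "finite X"
    and convex: "\<And>x y t. x \<in> C \<Longrightarrow> y \<in> C \<Longrightarrow> 0 \<le> t \<Longrightarrow> t \<le> 1 \<Longrightarrow> (\<lambda>j. t * x j + (1 - t) * y j) \<in> C"
    and "\<And>x y t. x \<in> C \<Longrightarrow> y \<in> C \<Longrightarrow> 0 \<le> t \<Longrightarrow> t \<le> 1 \<Longrightarrow>
      t * F x + (1 - t) * F y \<le> F (\<lambda>j. t * x j + (1 - t) * y j)"
    and "\<And>x. x \<in> C \<Longrightarrow> \<exists>y\<in>C. \<exists>\<epsilon>>0. \<forall>i\<in>X. y i - e i = - \<epsilon> * (x i - e i)"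
    and "\<And>x. x \<in> C \<Longrightarrow> \<forall>i\<in>X. x i = e i \<Longrightarrow> F x \<le> H"
  shows "\<exists>g. \<forall>x\<in>C. F x + (\<Sum>i\<in>X. g i * (x i - e i)) \<le> H"
  using assms(1,3-5)
proof (induction X arbitrary: F rule: finite_induct)
  case (insert i X)
  note concave = insert.prems(1) and slater = insert.prems(2) and bound = insert.prems(3)
  let ?C = "{x \<in> C. \<forall>j\<in>X. x j = e j}"
  have "\<exists>c. \<forall>x\<in>?C. F x + c * (x i - e i) \<le> H"
  proof (rule lagrange_multiplier)
    fix x assume x: "x \<in> ?C"
    then obtain y \<epsilon> where y: "y \<in> C" "\<epsilon> > 0" "\<forall>j\<in>insert i X. y j - e j = - \<epsilon> * (x j - e j)"
      using slater by blast
    then have "y j = e j" if "j \<in> X" for j using x that by auto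
    then show "\<exists>y\<in>?C. \<exists>\<epsilon>>0. y i - e i = - \<epsilon> * (x i - e i)" using y by blast
  next
    fix x y and t :: real assume *: "x \<in> ?C" "y \<in> ?C" "0 \<le> t" "t \<le> 1"
    then show "(\<lambda>j. t * x j + (1 - t) * y j) \<in> ?C" using convex by (auto simp: algebra_simps)
    show "t * F x + (1 - t) * F y \<le> F (\<lambda>j. t * x j + (1 - t) * y j)" using * concave by blast
  qed (use bound in auto)
  then obtain c where c: "\<forall>x\<in>?C. F x + c * (x i - e i) \<le> H" by blast
  have "\<exists>g. \<forall>x\<in>C. F x + c * (x i - e i) + (\<Sum>i\<in>X. g i * (x i - e i)) \<le> H"
  proof (rule insert.IH)
    fix x y and t :: real assume *: "x \<in> C" "y \<in> C" "0 \<le> t" "t \<le> 1"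
    show "t * (F x + c * (x i - e i)) + (1 - t) * (F y + c * (y i - e i))
      \<le> F (\<lambda>j. t * x j + (1 - t) * y j) + c * (t * x i + (1 - t) * y i - e i)"
      using concave[OF *] by (simp add: algebra_simps)
  next
    fix x assume "x \<in> C"
    then show "\<exists>y\<in>C. \<exists>\<epsilon>>0. \<forall>i\<in>X. y i - e i = - \<epsilon> * (x i - e i)" using slater by blast
  qed (use c in blast)
  then obtain g where g: "\<And>x. x \<in> C \<Longrightarrow> F x + c * (x i - e i) + (\<Sum>i\<in>X. g i * (x i - e i)) \<le> H" by blast
  have "(\<Sum>j\<in>insert i X. (g(i := c)) j * (x j - e j)) = c * (x i - e i) + (\<Sum>j\<in>X. g j * (x j - e j))" for x
    using insert.hyps by (auto intro!: sum.cong)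
  then show ?case using g by (intro exI[of _ "g(i := c)"]) (simp add: add.assoc)
qed simp

section \<open>Markov extensions\<close>

text \<open>The Markov chain with memory n - 1 that agrees with \<open>q\<close> up to length
  \<open>n\<close>. It runs to the left, prepending a letter given the first n - 1 letters, because
  lists recurse that way.\<close>

primrec markov_extension :: "nat \<Rightarrow> ('a list \<Rightarrow> real) \<Rightarrow> 'a list \<Rightarrow> real" where
  "markov_extension n q [] = q []"
| "markov_extension n q (c # w) = (if length w < n then q (c # w)
     else q (c # take (n - 1) w) / q (take (n - 1) w) * markov_extension n q w)"

lemma markov_extension_eq: "length w \<le> n \<Longrightarrow> markov_extension n q w = q w"
  by (cases w) auto

lemma markov_extension_stationary:
  fixes q :: "'a::finite list \<Rightarrow> real"
  assumes n: "n \<ge> 1" and q: "q [] = 1" "\<And>w. (\<Sum>c\<in>UNIV. q (w @ [c])) = q w" "\<And>w. (\<Sum>c\<in>UNIV. q (c # w)) = q w"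
    and pos: "\<And>w. length w \<le> n \<Longrightarrow> 0 < q w"
  shows "stationary_weights UNIV (markov_extension n q)"
  unfolding stationary_weights_def
proof (intro conjI ballI)
  let ?p = "markov_extension n q"
  show "?p [] = 1" using q by simp
  fix w :: "'a list"
  show "0 \<le> ?p w"
  proof (induction w)
    case (Cons c w)
    then show ?case using pos[of "c # w"] pos[of "c # take (n - 1) w"] pos[of "take (n - 1) w"] n
      by (auto intro!: less_imp_le[of 0 "q _"] mult_nonneg_nonneg divide_nonneg_nonneg)
  qed (use q in simp)
  show "(\<Sum>c\<in>UNIV. ?p (w @ [c])) = ?p w"
  proof (induction w)
    case Nil
    then show ?case using q(2)[of "[]"] n by simp
  next
    case (Cons a w)
    show ?case
    proof (cases "Suc (length w) < n")
      case True
      then show ?thesis using q(2)[of "a # w"] by simp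
    next
      case False
      \<comment> \<open>Since \<open>w\<close> has at least n - 1 letters, an appended letter does
        not enter the memory, and the transition factor comes out of the sum.\<close>
      then have "take (n - 1) (w @ [c]) = take (n - 1) w" for c by simp
      then have "(\<Sum>c\<in>UNIV. ?p ((a # w) @ [c])) = q (a # take (n - 1) w) / q (take (n - 1) w) * ?p w"
        using False Cons.IH by (simp add: sum_distrib_left[symmetric] sum_divide_distrib[symmetric])
      also have "\<dots> = ?p (a # w)"
      proof (cases "length w < n")
        case True
        then have "take (n - 1) w = w" by simp
        then show ?thesis using True pos[of w] by (simp add: markov_extension_eq)
      qed simp
      finally show ?thesis .
    qed
  qed
  show "(\<Sum>c\<in>UNIV. ?p (c # w)) = ?p w"
  proof (cases "length w < n")
    case True
    then show ?thesis using q(3)[of w] by (simp add: markov_extension_eq)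
  next
    case False
    have "length (take (n - 1) w) \<le> n" by simp
    then have "q (take (n - 1) w) \<noteq> 0" using pos by fastforce
    then show ?thesis using False q(3)[of "take (n - 1) w"]
      by (simp add: sum_distrib_right[symmetric] sum_divide_distrib[symmetric])
  qed
qed

text \<open>Reflect \<open>\<nu>\<close> through \<open>\<eta>\<close>: the weights (1 + \<epsilon>)
  \<eta> - \<epsilon> \<nu> stay positive when \<epsilon> is the minimum of \<open>\<eta>\<close>,
  because \<open>\<nu>\<close> is at most one. The minimum runs over all lengths up to
  \<open>n\<close> since the Markov extension divides by the weights of shorter words.\<close>

lemma stationary_marginals_relative_interior:
  fixes \<eta> \<nu> :: "'a::finite list \<Rightarrow> real"
  assumes n: "n \<ge> 1" and \<eta>: "stationary_weights UNIV \<eta>" and pos: "\<And>w. 0 < \<eta> w"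
    and \<nu>: "stationary_weights UNIV \<nu>"
  shows "\<exists>p. stationary_weights UNIV p \<and> (\<exists>\<epsilon>>0. \<forall>w\<in>words UNIV n. p w - \<eta> w = - \<epsilon> * (\<nu> w - \<eta> w))"
proof -
  let ?W = "{w :: 'a list. length w \<le> n}"
  have fin: "finite ?W" using finite_lists_length_le[of "UNIV :: 'a set" n] by simp
  have ne: "?W \<noteq> {}" by (auto intro: exI[of _ "[]"])
  define \<epsilon> where "\<epsilon> = Min (\<eta> ` ?W)"
  have \<epsilon>: "\<epsilon> > 0" unfolding \<epsilon>_def using fin ne pos by (subst Min_gr_iff) auto
  define q where "q w = (1 + \<epsilon>) * \<eta> w - \<epsilon> * \<nu> w" for w
  have "0 < q w" if "length w \<le> n" for w
  proof -
    have "\<epsilon> \<le> \<eta> w" unfolding \<epsilon>_def using fin that by (intro Min_le) auto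
    moreover have "\<epsilon> * \<nu> w \<le> \<epsilon> * 1" using stationary_weights_le_1[OF \<nu> finite, of w] \<epsilon> by (intro mult_left_mono) auto
    moreover have "0 < \<epsilon> * \<eta> w" using \<epsilon> pos by simp
    ultimately show ?thesis by (simp add: q_def algebra_simps)
  qed
  moreover have "q [] = 1" using stationary_weightsD(1)[OF \<eta>] stationary_weightsD(1)[OF \<nu>] by (simp add: q_def)
  moreover have "(\<Sum>c\<in>UNIV. q (w @ [c])) = q w" "(\<Sum>c\<in>UNIV. q (c # w)) = q w" for w
    using stationary_weightsD(3,4)[OF \<eta>, of w] stationary_weightsD(3,4)[OF \<nu>, of w]
    by (auto simp: q_def sum_subtractf sum_distrib_left[symmetric])
  ultimately have "stationary_weights UNIV (markov_extension n q)" by (intro markov_extension_stationary n)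
  moreover have "markov_extension n q w - \<eta> w = - \<epsilon> * (\<nu> w - \<eta> w)" if "w \<in> words UNIV n" for w
    using that by (simp add: markov_extension_eq words_def q_def algebra_simps)
  ultimately show ?thesis using \<epsilon> by blast
qed

section \<open>Locally constant potentials\<close>

text \<open>A Birkhoff sum of a function of \<open>n\<close> letters, restricted to windows inside
  the word so that it depends on the word alone.\<close>

definition window_sum :: "nat \<Rightarrow> ('a list \<Rightarrow> real) \<Rightarrow> 'a list \<Rightarrow> real" where
  "window_sum n g I = (\<Sum>i | i + n \<le> length I. g (take n (drop i I)))"

lemma finite_window [simp]: "finite {i. i + n \<le> (m::nat)}"
  by (rule finite_subset[of _ "{..m}"]) auto

text \<open>The windows of a concatenation lie in \<open>I\<close>, lie in \<open>J\<close>, or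
  straddle the seam; the straddling ones \<open>?R\<close> are few. The intersection of
  \<open>?C\<close> and \<open>?B\<close> accounts for \<open>n = 0\<close>, when the empty window
  at the seam is counted on both sides.\<close>

lemma quasi_additive_window_sum:
  fixes g :: "'a::finite list \<Rightarrow> real"
  shows "quasi_additive (window_sum n g)"
proof (rule quasi_additiveI)
  fix I J :: "'a list"
  define G where "G = (\<Sum>v\<in>words UNIV n. \<bar>g v\<bar>)"
  have G: "\<bar>g v\<bar> \<le> G" if "v \<in> words UNIV n" for v
    unfolding G_def using that by (intro member_le_sum) auto
  let ?h = "\<lambda>i. g (take n (drop i (I @ J)))"
  let ?A = "{i. i + n \<le> length (I @ J)}" and ?B = "{i. i + n \<le> length I}"
  let ?C = "(+) (length I) ` {k. k + n \<le> length J}"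
  let ?R = "?A - ?B - (?C - ?B)"
  have "window_sum n g (I @ J) = sum ?h ?B + sum ?h (?A - ?B)"
    unfolding window_sum_def by (subst sum.subset_diff[of ?B ?A]) (auto simp: add.commute)
  also have "sum ?h (?A - ?B) = sum ?h (?C - ?B) + sum ?h ?R"
    by (subst sum.subset_diff[of "?C - ?B" "?A - ?B"]) (auto simp: add.commute)
  also have "sum ?h ?B = window_sum n g I"
    unfolding window_sum_def by (intro sum.cong refl) auto
  finally have A: "window_sum n g (I @ J) = window_sum n g I + sum ?h (?C - ?B) + sum ?h ?R" by simp
  have C: "sum ?h ?C = window_sum n g J"
    unfolding window_sum_def by (subst sum.reindex) (auto simp: inj_on_def)
  have "sum ?h ?C = sum ?h (?C - ?B) + sum ?h (?C \<inter> ?B)"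
    by (subst sum.Int_Diff[of ?C _ ?B]) auto
  then have eq: "window_sum n g (I @ J) - window_sum n g I - window_sum n g J = sum ?h ?R - sum ?h (?C \<inter> ?B)"
    using A C by simp
  have small: "\<bar>sum ?h X\<bar> \<le> real (Suc n) * G" if X: "X \<subseteq> ?A" "X \<subseteq> {length I - n..length I}" for X
  proof -
    have "\<bar>sum ?h X\<bar> \<le> (\<Sum>i\<in>X. \<bar>?h i\<bar>)" by (rule sum_abs)
    also have "\<dots> \<le> (\<Sum>i\<in>X. G)"
      using X(1) by (intro sum_mono G) (auto simp: words_def)
    also have "\<dots> = real (card X) * G" by simp
    also have "card X \<le> card {length I - n..length I}" using X(2) by (intro card_mono) auto
    then have "real (card X) * G \<le> real (Suc n) * G"
      by (intro mult_right_mono) (auto simp: G_def sum_nonneg)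
    finally show ?thesis .
  qed
  have "?R \<subseteq> {length I - n..length I}"
  proof
    fix i assume i: "i \<in> ?R"
    have "i < length I"
    proof (rule ccontr)
      assume "\<not> i < length I"
      then have "i = length I + (i - length I)" "(i - length I) + n \<le> length J" using i by auto
      then show False using i by blast
    qed
    then show "i \<in> {length I - n..length I}" using i by auto
  qed
  then have "\<bar>sum ?h ?R\<bar> \<le> real (Suc n) * G" by (rule small[rotated]) blast
  moreover have "\<bar>sum ?h (?C \<inter> ?B)\<bar> \<le> real (Suc n) * G" by (rule small) auto
  ultimately show "\<bar>window_sum n g (I @ J) - window_sum n g I - window_sum n g J\<bar> \<le> 2 * (real (Suc n) * G)"
    unfolding eq using abs_triangle_ineq4[of "sum ?h ?R" "sum ?h (?C \<inter> ?B)"] by linarith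
qed

text \<open>By stationarity each of the \<open>Suc m - n\<close> windows contributes the same
  average, and this count is asymptotic to m.\<close>

lemma window_sum_average:
  fixes g :: "'a::finite list \<Rightarrow> real"
  assumes \<nu>: "stationary_weights UNIV \<nu>"
  shows "(\<lambda>m. (\<Sum>I\<in>words UNIV m. \<nu> I * window_sum n g I) / m) \<longlonglongrightarrow> (\<Sum>v\<in>words UNIV n. g v * \<nu> v)"
proof -
  let ?L = "\<Sum>v\<in>words UNIV n. g v * \<nu> v"
  have single: "(\<Sum>I\<in>words UNIV m. \<nu> I * g (take n (drop i I))) = ?L" if im: "i + n \<le> m" for i m
  proof -
    define l where "l = m - i - n"
    have m: "m = i + (n + l)" using im by (simp add: l_def)
    have "(\<Sum>I\<in>words UNIV m. \<nu> I * g (take n (drop i I)))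
      = (\<Sum>A\<in>words UNIV i. \<Sum>v\<in>words UNIV n. \<Sum>B\<in>words UNIV l. g v * \<nu> (A @ v @ B))"
      unfolding m sum_words_append by (intro sum.cong refl) (auto simp: words_def mult.commute)
    also have "\<dots> = (\<Sum>A\<in>words UNIV i. \<Sum>v\<in>words UNIV n. g v * \<nu> (A @ v))"
      using stationary_weights_append_right[OF \<nu>, of "_ @ _"]
      by (intro sum.cong refl) (simp add: sum_distrib_left[symmetric])
    also have "\<dots> = (\<Sum>v\<in>words UNIV n. g v * (\<Sum>A\<in>words UNIV i. \<nu> (A @ v)))"
      by (subst sum.swap) (simp add: sum_distrib_left)
    also have "\<dots> = ?L" using stationary_weights_append_left[OF \<nu>] by simp
    finally show ?thesis .
  qed
  have card: "card {i. i + n \<le> m} = Suc m - n" for m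
  proof -
    have "{i. i + n \<le> m} = {..<Suc m - n}" by auto
    then show ?thesis by simp
  qed
  have sum: "(\<Sum>I\<in>words UNIV m. \<nu> I * window_sum n g I) = real (Suc m - n) * ?L" for m
  proof -
    have "(\<Sum>I\<in>words UNIV m. \<nu> I * window_sum n g I)
      = (\<Sum>I\<in>words UNIV m. \<Sum>i | i + n \<le> m. \<nu> I * g (take n (drop i I)))"
      by (intro sum.cong refl) (simp add: window_sum_def words_def sum_distrib_left)
    also have "\<dots> = (\<Sum>i | i + n \<le> m. ?L)"
      by (subst sum.swap) (intro sum.cong refl single, simp)
    finally show ?thesis by (simp add: card)
  qed
  have "(\<lambda>m. ?L - (real n - 1) * ?L / m) \<longlonglongrightarrow> ?L - 0"
    by (intro tendsto_diff tendsto_const lim_const_over_n)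
  moreover have "\<forall>\<^sub>F m in sequentially. ?L - (real n - 1) * ?L / m = (\<Sum>I\<in>words UNIV m. \<nu> I * window_sum n g I) / m"
    using eventually_ge_at_top[of "n + 1"]
  proof eventually_elim
    case (elim m)
    then have "real (Suc m - n) = real m - (real n - 1)" by (simp add: of_nat_diff)
    then show ?case using elim by (simp only: sum left_diff_distrib diff_divide_distrib) simp
  qed
  ultimately show ?thesis using Lim_transform_eventually by force
qed

section \<open>Maximizers of the weighted entropy rate\<close>

text \<open>At the limit 0, where ln is not continuous, x ln x is dominated by 2 sqrt x; this
  follows from ln y \<le> y - 1 at y = 1 / sqrt x.\<close>

lemma tendsto_xlnx:
  fixes p :: "nat \<Rightarrow> real"
  assumes lim: "p \<longlonglongrightarrow> l" and p: "\<And>n. 0 \<le> p n" "\<And>n. p n \<le> 1"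
  shows "(\<lambda>n. p n * ln (p n)) \<longlonglongrightarrow> l * ln l"
proof (cases "l = 0")
  case False
  then show ?thesis by (intro tendsto_mult lim tendsto_ln)
next
  case True
  have le: "norm (p n * ln (p n)) \<le> 2 * sqrt (p n)" for n
  proof (cases "p n = 0")
    case False
    then have pos: "0 < p n" "0 < sqrt (p n)" using p(1)[of n] by auto
    have "ln (1 / sqrt (p n)) \<le> 1 / sqrt (p n) - 1" using pos by (intro ln_le_minus_one) simp
    then have "- ln (sqrt (p n)) \<le> 1 / sqrt (p n)" using pos by (simp add: ln_div)
    then have "- ln (p n) \<le> 2 / sqrt (p n)" using pos by (simp add: ln_sqrt)
    then have "p n * - ln (p n) \<le> p n * (2 / sqrt (p n))" using pos by (intro mult_left_mono) auto
    also have "\<dots> = 2 * sqrt (p n)" using pos real_sqrt_mult_self[of "p n"] by (simp add: field_simps)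
    finally have "p n * - ln (p n) \<le> 2 * sqrt (p n)" .
    moreover have "0 \<le> p n * - ln (p n)" using pos p(2)[of n] by (intro mult_nonneg_nonneg) auto
    ultimately show ?thesis by (simp add: abs_mult)
  qed simp
  have "(\<lambda>n. 2 * sqrt (p n)) \<longlonglongrightarrow> 2 * sqrt 0" using lim True by (intro tendsto_intros) simp
  then have "(\<lambda>n. p n * ln (p n)) \<longlonglongrightarrow> 0"
    by (intro Lim_null_comparison[OF always_eventually[OF allI[OF le]]]) simp
  then show ?thesis using True by simp
qed

lemma word_entropy_tendsto:
  fixes p :: "nat \<Rightarrow> 'a::finite list \<Rightarrow> real"
  assumes "\<And>k. stationary_weights UNIV (p k)" "\<And>w. (\<lambda>k. p k w) \<longlonglongrightarrow> q w"
  shows "(\<lambda>k. word_entropy UNIV (p k) m) \<longlonglongrightarrow> word_entropy UNIV q m"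
  unfolding word_entropy_def
  using stationary_weightsD(2)[OF assms(1)] stationary_weights_le_1[OF assms(1) finite]
  by (intro tendsto_minus tendsto_sum tendsto_xlnx assms(2)) auto

lemma weighted_rate_concave:
  fixes f :: "'a::finite \<Rightarrow> 'd::finite"
  assumes p: "stationary_weights UNIV p" and q: "stationary_weights UNIV q" and t: "0 \<le> t" "t \<le> 1"
    and ab: "a \<ge> 0" "b \<ge> 0"
  shows "t * weighted_rate a b f p + (1 - t) * weighted_rate a b f q
    \<le> weighted_rate a b f (\<lambda>w. t * p w + (1 - t) * q w)"
proof -
  have "t * weighted_rate a b f p + (1 - t) * weighted_rate a b f q
    = a * (t * entropy_rate UNIV p + (1 - t) * entropy_rate UNIV q)
      + b * (t * entropy_rate UNIV (push_weights f p) + (1 - t) * entropy_rate UNIV (push_weights f q))"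
    by (simp add: weighted_rate_def algebra_simps)
  also have "\<dots> \<le> weighted_rate a b f (\<lambda>w. t * p w + (1 - t) * q w)"
    unfolding weighted_rate_def push_weights_convex using ab
    by (intro add_mono mult_left_mono entropy_rate_concave push_weights_stationary p q t finite) auto
  finally show ?thesis .
qed

lemma exists_weighted_rate_maximizer:
  fixes f :: "'a::finite \<Rightarrow> 'd::finite" and \<eta> :: "'a list \<Rightarrow> real"
  assumes ab: "a \<ge> 0" "b \<ge> 0" and \<eta>: "stationary_weights UNIV \<eta>"
  obtains \<nu> where "stationary_weights UNIV \<nu>" "\<And>I. I \<in> X \<Longrightarrow> \<nu> I = \<eta> I"
    "\<And>p. stationary_weights UNIV p \<Longrightarrow> (\<And>I. I \<in> X \<Longrightarrow> p I = \<eta> I) \<Longrightarrow> weighted_rate a b f p \<le> weighted_rate a b f \<nu>"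
proof -
  define S where "S = {p. stationary_weights UNIV p \<and> (\<forall>I\<in>X. p I = \<eta> I)}"
  let ?F = "weighted_rate a b f"
  define H where "H = Sup (?F ` S)"
  have S_ne: "?F ` S \<noteq> {}" using \<eta> by (auto simp: S_def)
  have "?F p \<le> a * card (words (UNIV :: 'a set) 1) + b * card (words (UNIV :: 'd set) 1)" if "p \<in> S" for p
    unfolding weighted_rate_def using that ab
    by (intro add_mono mult_left_mono entropy_rate_le_card push_weights_stationary) (auto simp: S_def)
  then have bdd: "bdd_above (?F ` S)" by (auto intro!: bdd_aboveI2)
  have "\<exists>p\<in>S. H - 1 / real (Suc k) < ?F p" for k
    using less_cSup_iff[OF S_ne bdd, of "H - 1 / real (Suc k)"] by (auto simp: H_def)
  then obtain p where p: "\<And>k. p k \<in> S" "\<And>k. H - 1 / real (Suc k) < ?F (p k)" by metis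
  have ps: "stationary_weights UNIV (p k)" for k using p(1)[of k] by (simp add: S_def)
  obtain r \<nu> where r: "strict_mono r" and \<nu>: "stationary_weights UNIV \<nu>" and lim: "\<And>w. (\<lambda>k. p (r k) w) \<longlonglongrightarrow> \<nu> w"
    using stationary_weights_seq_compact[of p] ps by blast
  have \<nu>X: "\<nu> I = \<eta> I" if "I \<in> X" for I
    using lim[of I] p(1) that by (auto simp: S_def LIMSEQ_const_iff)
  have lim_push: "(\<lambda>k. push_weights f (p (r k)) J) \<longlonglongrightarrow> push_weights f \<nu> J" for J
    unfolding push_weights_def by (intro tendsto_sum lim)
  have "(\<lambda>k. H - 1 / real (Suc k)) \<longlonglongrightarrow> H - 0"
    by (intro tendsto_diff tendsto_const LIMSEQ_Suc[OF lim_1_over_n])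
  from LIMSEQ_subseq_LIMSEQ[OF this r] have limH: "(\<lambda>k. H - 1 / real (Suc (r k))) \<longlonglongrightarrow> H" by (simp add: o_def)
  \<comment> \<open>At a fixed block length \<open>m\<close> the entropies dominate the rates and
    converge along the subsequence. Letting \<open>m\<close> grow only afterwards gives upper
    semicontinuity of the rate.\<close>
  have up: "H \<le> a * (word_entropy UNIV \<nu> m / m) + b * (word_entropy UNIV (push_weights f \<nu>) m / m)" if m: "m \<ge> 1" for m
  proof (rule LIMSEQ_le[OF limH])
    show "(\<lambda>k. a * (word_entropy UNIV (p (r k)) m / m) + b * (word_entropy UNIV (push_weights f (p (r k))) m / m))
      \<longlonglongrightarrow> a * (word_entropy UNIV \<nu> m / m) + b * (word_entropy UNIV (push_weights f \<nu>) m / m)"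
      using m by (intro tendsto_add tendsto_mult tendsto_const tendsto_divide word_entropy_tendsto ps lim lim_push
          push_weights_stationary) auto
    have "H - 1 / real (Suc (r k)) \<le> a * (word_entropy UNIV (p (r k)) m / m) + b * (word_entropy UNIV (push_weights f (p (r k))) m / m)" for k
    proof -
      have "?F (p (r k)) \<le> a * (word_entropy UNIV (p (r k)) m / m) + b * (word_entropy UNIV (push_weights f (p (r k))) m / m)"
        unfolding weighted_rate_def using ab m
        by (intro add_mono mult_left_mono entropy_rate_le ps push_weights_stationary finite) auto
      then show ?thesis using p(2)[of "r k"] by linarith
    qed
    then show "\<exists>N. \<forall>k\<ge>N. H - 1 / real (Suc (r k)) \<le> a * (word_entropy UNIV (p (r k)) m / m) + b * (word_entropy UNIV (push_weights f (p (r k))) m / m)"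
      by blast
  qed
  have "(\<lambda>m. a * (word_entropy UNIV \<nu> m / m) + b * (word_entropy UNIV (push_weights f \<nu>) m / m)) \<longlonglongrightarrow> ?F \<nu>"
    unfolding weighted_rate_def
    by (intro tendsto_add tendsto_mult tendsto_const entropy_rate_tendsto push_weights_stationary \<nu> finite)
  then have "H \<le> ?F \<nu>" by (rule LIMSEQ_le_const) (use up in blast)
  moreover have "?F p \<le> H" if "p \<in> S" for p unfolding H_def using bdd that by (intro cSup_upper) auto
  ultimately have "?F p \<le> ?F \<nu>" if "p \<in> S" for p using that order_trans by blast
  then show ?thesis using that[of \<nu>] \<nu> \<nu>X by (auto simp: S_def)
qed

section \<open>The potential and its weighted equilibrium state\<close>

lemma open_prefix_set: "open (prefix_set N W :: (nat \<Rightarrow> 'a::discrete_topology) set)"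
  unfolding prefix_set_eq_UN using open_cylinder by blast

lemma continuous_on_prefix_function:
  fixes h :: "'a::discrete_topology list \<Rightarrow> 'b::topological_space"
  shows "continuous_on UNIV (\<lambda>x. h (map x [0..<m]))"
  unfolding continuous_on_open_vimage[OF open_UNIV]
proof (intro allI impI)
  fix B :: "'b set"
  have "(\<lambda>x. h (map x [0..<m])) -` B \<inter> UNIV = prefix_set m (h -` B)"
    by (auto simp: prefix_set_def)
  then show "open ((\<lambda>x. h (map x [0..<m])) -` B \<inter> UNIV)"
    using open_prefix_set by metis
qed

lemma integral_prefix_function:
  fixes M :: "(nat \<Rightarrow> 'a::{finite, discrete_topology}) measure" and h :: "'a list \<Rightarrow> real"
  assumes "M \<in> invariant_measures left_shift"
  shows "(\<integral>x. h (map x [0..<m]) \<partial>M) = (\<Sum>I\<in>words UNIV m. weights M I * h I)"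
proof -
  note M = invariant_measuresD[OF assms]
  interpret prob_space M by (rule M(2))
  have cyl: "cylinder I \<in> sets M" for I :: "'a list" by (rule cylinder_in_sets[OF M(1)])
  have eq: "h (map x [0..<m]) = (\<Sum>I\<in>words UNIV m. h I * indicator (cylinder I) x)" for x :: "nat \<Rightarrow> 'a"
  proof -
    have "(\<Sum>I\<in>words UNIV m. h I * indicator (cylinder I) x) = (\<Sum>I\<in>words UNIV m. if I = map x [0..<m] then h I else 0)"
      by (intro sum.cong refl) (auto simp: indicator_def in_cylinder_iff words_def)
    moreover have "map x [0..<m] \<in> words UNIV m" by (simp add: words_def)
    ultimately show ?thesis by (simp add: sum.delta)
  qed
  have "(\<integral>x. h (map x [0..<m]) \<partial>M) = (\<Sum>I\<in>words UNIV m. \<integral>x. h I * indicator (cylinder I) x \<partial>M)"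
    unfolding eq using cyl
    by (intro Bochner_Integration.integral_sum integrable_mult_right integrable_real_indicator)
       (auto simp: emeasure_eq_measure)
  also have "\<dots> = (\<Sum>I\<in>words UNIV m. weights M I * h I)"
    using cyl M(5) by (intro sum.cong refl) (simp add: weights_def)
  finally show ?thesis .
qed

section \<open>Factor maps and the passage between measures and weights\<close>

lemma one_block_factor_mapD:
  fixes \<pi> :: "(nat \<Rightarrow> 'a::topological_space) \<Rightarrow> (nat \<Rightarrow> 'd::topological_space)"
  assumes "one_block_factor_map \<pi>"
  obtains f where "\<And>x i. \<pi> x i = f (x i)" "surj f" "continuous_on UNIV \<pi>" "\<pi> \<circ> left_shift = left_shift \<circ> \<pi>"
proof -
  obtain f where f: "\<And>x i. \<pi> x i = f (x i)" using assms by (auto simp: one_block_factor_map_def)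
  have "surj f"
    unfolding surj_def
  proof
    fix d
    obtain x where "\<pi> x = (\<lambda>_. d)" using assms unfolding one_block_factor_map_def by (metis surjD)
    then have "d = f (x 0)" using f[of x 0] by simp
    then show "\<exists>c. d = f c" by blast
  qed
  show ?thesis
    by (rule that[OF f \<open>surj f\<close>]) (use assms in \<open>simp_all add: one_block_factor_map_def\<close>)
qed

lemma distr_factor_invariant:
  fixes \<pi> :: "(nat \<Rightarrow> 'a::topological_space) \<Rightarrow> (nat \<Rightarrow> 'd::topological_space)"
  assumes M: "M \<in> invariant_measures left_shift" and cont: "continuous_on UNIV \<pi>"
    and comm: "\<pi> \<circ> left_shift = left_shift \<circ> \<pi>"
  shows "distr M borel \<pi> \<in> invariant_measures left_shift"
proof -
  note inv = invariant_measuresD[OF M]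
  have \<pi>: "\<pi> \<in> measurable borel borel" by (rule borel_measurable_continuous_onI[OF cont])
  have ms: "measurable M borel = measurable borel borel" by (rule measurable_cong_sets[OF inv(1) refl])
  have \<pi>M: "\<pi> \<in> measurable M borel" and TM: "left_shift \<in> measurable M borel"
    using \<pi> measurable_left_shift unfolding ms by auto
  have "distr (distr M borel \<pi>) borel left_shift = distr M borel (left_shift \<circ> \<pi>)"
    by (rule distr_distr[OF measurable_left_shift \<pi>M])
  also have "\<dots> = distr (distr M borel left_shift) borel \<pi>"
    unfolding comm[symmetric] by (rule distr_distr[OF \<pi> TM, symmetric])
  also have "\<dots> = distr M borel \<pi>" unfolding inv(4) ..
  finally show ?thesis
    using prob_space.prob_space_distr[OF inv(2) \<pi>M] measurable_left_shift by (simp add: invariant_measures_def)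
qed

lemma weighted_entropy_eq:
  fixes \<pi> :: "(nat \<Rightarrow> 'a::{finite, discrete_topology}) \<Rightarrow> (nat \<Rightarrow> 'd::{finite, discrete_topology})"
  assumes M: "M \<in> invariant_measures left_shift" and cont: "continuous_on UNIV \<pi>"
    and comm: "\<pi> \<circ> left_shift = left_shift \<circ> \<pi>" and f: "\<And>x i. \<pi> x i = f (x i)"
  shows "weighted_entropy a b \<pi> M = ereal (weighted_rate a b f (weights M))"
  unfolding weighted_entropy_def measure_entropy_left_shift[OF M]
    measure_entropy_left_shift[OF distr_factor_invariant[OF M cont comm]]
    weights_distr_letterwise[OF invariant_measuresD(1,3)[OF M] cont f] weighted_rate_def
  by simp

lemma fully_supported_if_weights_pos:
  fixes M :: "(nat \<Rightarrow> 'a::{finite, discrete_topology}) measure"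
  assumes M: "sets M = sets borel" "finite_measure M" and pos: "\<And>I. 0 < weights M I"
  shows "fully_supported M"
  unfolding fully_supported_def
proof (intro allI impI)
  fix U :: "(nat \<Rightarrow> 'a) set" assume U: "open U \<and> U \<noteq> {}"
  then obtain x where "x \<in> U" by blast
  then obtain n where "cylinder (map x [0..<n]) \<subseteq> U" using open_contains_cylinder U by blast
  then have "weights M (map x [0..<n]) \<le> measure M U"
    unfolding weights_def using U M by (intro finite_measure.finite_measure_mono) auto
  then show "0 < measure M U" using pos[of "map x [0..<n]"] by linarith
qed

lemma quasi_bernoulli_if_weights:
  assumes "C > 0" "\<And>I. 0 < weights M I" "\<And>I J. weights M (I @ J) \<le> C * (weights M I * weights M J)"
    "\<And>I J. weights M I * weights M J \<le> C * weights M (I @ J)"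
  shows "quasi_bernoulli M"
  unfolding quasi_bernoulli_def weights_def[symmetric]
proof (intro exI[of _ C] conjI allI impI)
  fix I J
  have pos: "0 < weights M I * weights M J" using assms(2) by simp
  show "1 / C \<le> weights M (I @ J) / (weights M I * weights M J)"
    using assms(1,4) pos by (simp add: pos_le_divide_eq pos_divide_le_eq mult.commute)
  show "weights M (I @ J) / (weights M I * weights M J) \<le> C"
    using assms(3) pos by (simp add: pos_divide_le_eq)
qed (rule assms(1))

text \<open>The potential at level \<open>m\<close> is constant on cylinders of length
  \<open>m\<close>, so bounded distortion holds with constant one, and its averages are sums over
  words.\<close>

definition word_potential :: "('a list \<Rightarrow> real) \<Rightarrow> nat \<Rightarrow> (nat \<Rightarrow> 'a) \<Rightarrow> real" where
  "word_potential s m x = exp (s (map x [0..<m]))"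

lemma almost_additive_word_potential:
  fixes s :: "'a::discrete_topology list \<Rightarrow> real"
  assumes "quasi_additive s"
  shows "almost_additive left_shift (word_potential s)"
proof -
  obtain K where K: "\<And>I J. \<bar>s (I @ J) - s I - s J\<bar> \<le> K" using assms unfolding quasi_additive_def by blast
  have cont: "continuous_on UNIV (word_potential s m)" for m
    unfolding word_potential_def[abs_def] by (rule continuous_on_prefix_function)
  have bounds: "1 / exp K * word_potential s n x * word_potential s m ((left_shift ^^ n) x) \<le> word_potential s (n + m) x"
    "word_potential s (n + m) x \<le> exp K * word_potential s n x * word_potential s m ((left_shift ^^ n) x)" for x n m
  proof -
    let ?I = "map x [0..<n]" and ?J = "map ((left_shift ^^ n) x) [0..<m]"
    have split: "map x [0..<n + m] = ?I @ ?J"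
      by (intro nth_equalityI) (auto simp: nth_append shift_power)
    have "exp (- K + s ?I + s ?J) \<le> exp (s (?I @ ?J))" "exp (s (?I @ ?J)) \<le> exp (K + s ?I + s ?J)"
      using K[of ?I ?J] by (auto intro!: exp_le_cancel_iff[THEN iffD2])
    moreover have "1 / exp K = exp (- K)" by (simp add: exp_minus inverse_eq_divide)
    ultimately show "1 / exp K * word_potential s n x * word_potential s m ((left_shift ^^ n) x) \<le> word_potential s (n + m) x"
      "word_potential s (n + m) x \<le> exp K * word_potential s n x * word_potential s m ((left_shift ^^ n) x)"
      unfolding word_potential_def split by (simp_all only: exp_add[symmetric])
  qed
  have "0 < word_potential s m x" for m x by (simp add: word_potential_def)
  then show ?thesis unfolding almost_additive_def using cont bounds exp_gt_zero[of K] by blast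
qed

lemma bounded_distortion_word_potential: "bounded_distortion (word_potential s)"
  unfolding bounded_distortion_def
proof (intro exI[of _ 1] conjI allI impI ballI)
  fix n and I :: "'a list" and x y assume "length I = n" "x \<in> cylinder I" "y \<in> cylinder I"
  then have "word_potential s n x = word_potential s n y" by (auto simp: word_potential_def in_cylinder_iff)
  then show "1 / 1 * word_potential s n y \<le> word_potential s n x" "word_potential s n x \<le> 1 * word_potential s n y"
    by simp_all
qed simp

lemma potential_average_word_potential:
  fixes M :: "(nat \<Rightarrow> 'a::{finite, discrete_topology}) measure"
  assumes M: "M \<in> invariant_measures left_shift"
    and lim: "(\<lambda>n. (\<Sum>I\<in>words UNIV n. weights M I * s I) / n) \<longlonglongrightarrow> l"
  shows "potential_average (word_potential s) M = l"
  unfolding potential_average_def word_potential_def ln_exp integral_prefix_function[OF M] using lim by (rule limI)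

lemma ereal_Sup_attained:
  fixes F :: "'b \<Rightarrow> real"
  assumes "x \<in> A" "\<And>y. y \<in> A \<Longrightarrow> F y \<le> F x" "\<And>y. y \<in> A \<Longrightarrow> G y = ereal (F y)"
  shows "(SUP y\<in>A. G y) = ereal (F x)"
  using assms by (intro SUP_eqI) (auto intro: order_trans[of _ "G x"])

theorem theorem1p4:
  fixes \<pi> :: "(nat \<Rightarrow> 'a::{finite, discrete_topology}) \<Rightarrow> (nat \<Rightarrow> 'd::{finite, discrete_topology})"
    and a b :: real
    and \<eta> :: "(nat \<Rightarrow> 'a) measure"
    and n :: nat
  assumes "one_block_factor_map \<pi>"
    and "a > 0" and "b \<ge> 0"
    and "\<eta> \<in> invariant_measures left_shift" and "fully_supported \<eta>"
    and "n \<ge> 1"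
  shows "(\<exists>!\<mu>. maximizes_weighted_entropy a b \<pi> \<eta> n \<mu>) \<and>
    (\<forall>\<mu>. maximizes_weighted_entropy a b \<pi> \<eta> n \<mu> \<longrightarrow>
      (\<exists>\<phi>. almost_additive left_shift \<phi> \<and> bounded_distortion \<phi> \<and>
        (\<forall>\<nu>. weighted_equilibrium_state a b \<pi> \<phi> \<nu> \<longleftrightarrow> \<nu> = \<mu>)) \<and>
      fully_supported \<mu> \<and> quasi_bernoulli \<mu>)"
proof -
  obtain f where f: "\<And>x i. \<pi> x i = f (x i)" "surj f" and cont: "continuous_on UNIV \<pi>"
    and comm: "\<pi> \<circ> left_shift = left_shift \<circ> \<pi>"
    using one_block_factor_mapD[OF assms(1)] by blast
  note a = assms(2) and b = assms(3) and \<eta> = assms(4)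
  let ?I = "invariant_measures left_shift :: (nat \<Rightarrow> 'a) measure set"
  let ?F = "weighted_rate a b f" and ?w = "weights \<eta>" and ?W = "words (UNIV :: 'a set) n"
  note \<eta>_stat = weights_stationary[OF \<eta>]
  have \<eta>_pos: "0 < ?w I" for I
    using assms(5) open_cylinder[of I] cylinder_nonempty[of I] by (auto simp: fully_supported_def weights_def)
  have we: "weighted_entropy a b \<pi> M = ereal (?F (weights M))" if "M \<in> ?I" for M
    by (rule weighted_entropy_eq[OF that cont comm f(1)])
  have mem: "M \<in> measures_with_marginal \<eta> n \<longleftrightarrow> M \<in> ?I \<and> (\<forall>I\<in>?W. weights M I = ?w I)" for M
    by (auto simp: measures_with_marginal_def weights_def words_def)
  obtain \<nu>0 where \<nu>0: "stationary_weights UNIV \<nu>0" "\<And>I. I \<in> ?W \<Longrightarrow> \<nu>0 I = ?w I"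
    and max: "\<And>p. stationary_weights UNIV p \<Longrightarrow> (\<And>I. I \<in> ?W \<Longrightarrow> p I = ?w I) \<Longrightarrow> ?F p \<le> ?F \<nu>0"
    using exists_weighted_rate_maximizer[of a b ?w ?W f] a b \<eta>_stat by auto
  have "\<exists>g. \<forall>p\<in>Collect (stationary_weights UNIV). ?F p + (\<Sum>I\<in>?W. g I * (p I - ?w I)) \<le> ?F \<nu>0"
  proof (rule lagrange_multipliers)
    fix p assume "p \<in> Collect (stationary_weights (UNIV :: 'a set))"
    then show "\<exists>q\<in>Collect (stationary_weights UNIV). \<exists>\<epsilon>>0. \<forall>I\<in>?W. q I - ?w I = - \<epsilon> * (p I - ?w I)"
      using stationary_marginals_relative_interior[OF assms(6) \<eta>_stat \<eta>_pos] by blast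
  next
    fix p q :: "'a list \<Rightarrow> real" and t :: real
    assume "p \<in> Collect (stationary_weights UNIV)" "q \<in> Collect (stationary_weights UNIV)" and t: "0 \<le> t" "t \<le> 1"
    then have pq: "stationary_weights UNIV p" "stationary_weights UNIV q" by auto
    show "(\<lambda>I. t * p I + (1 - t) * q I) \<in> Collect (stationary_weights UNIV)"
      using stationary_weights_convex[OF pq t] by simp
    show "t * ?F p + (1 - t) * ?F q \<le> ?F (\<lambda>I. t * p I + (1 - t) * q I)"
      using weighted_rate_concave[OF pq t, of a b f] a b by simp
  qed (use max in auto)
  then obtain g where g: "\<And>p. stationary_weights UNIV p \<Longrightarrow> ?F p + (\<Sum>I\<in>?W. g I * (p I - ?w I)) \<le> ?F \<nu>0" by blast
  define L where "L p = (\<Sum>I\<in>?W. g I * p I)" for p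
  have g': "L p + ?F p \<le> L ?w + ?F \<nu>0" if "stationary_weights UNIV p" for p
    using g[OF that] by (simp add: L_def right_diff_distrib sum_subtractf)
  let ?s = "window_sum n g"
  have L: "(\<lambda>m. (\<Sum>I\<in>words UNIV m. p I * ?s I) / m) \<longlonglongrightarrow> L p" if "stationary_weights UNIV p" for p
    unfolding L_def by (rule window_sum_average[OF that])
  obtain \<mu> C where \<mu>: "stationary_weights UNIV \<mu>" and C: "C > 0" and \<mu>_pos: "\<And>I. 0 < \<mu> I"
    and qb: "\<And>I J. \<mu> (I @ J) \<le> C * (\<mu> I * \<mu> J)" "\<And>I J. \<mu> I * \<mu> J \<le> C * \<mu> (I @ J)"
    and le: "\<And>p. stationary_weights UNIV p \<Longrightarrow> L p + ?F p \<le> L \<mu> + ?F \<mu>"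
    and unique: "\<And>p. stationary_weights UNIV p \<Longrightarrow> L p + ?F p = L \<mu> + ?F \<mu> \<Longrightarrow> p = \<mu>"
    using exists_unique_weighted_equilibrium[OF f(2) quasi_additive_window_sum a b L] by blast
  \<comment> \<open>A feasible \<open>p\<close> has the same energy \<open>L\<close> as
    \<open>\<eta>\<close>. If its rate is maximal, it reaches the bound \<open>g'\<close>, which
    \<open>\<mu>\<close> cannot exceed, so \<open>p\<close> is an equilibrium state too.\<close>
  have eq_\<mu>: "p = \<mu>" if p: "stationary_weights UNIV p" "\<And>I. I \<in> ?W \<Longrightarrow> p I = ?w I" "?F p = ?F \<nu>0" for p
  proof (rule unique[OF p(1)])
    have "L p = L ?w" unfolding L_def using p(2) by (intro sum.cong) auto
    then show "L p + ?F p = L \<mu> + ?F \<mu>" using g'[OF \<mu>] le[OF p(1)] p(3) by linarith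
  qed
  \<comment> \<open>Only here does \<open>\<mu>\<close>, found without the constraint, turn out to
    have the prescribed marginal.\<close>
  have \<nu>0_eq: "\<nu>0 = \<mu>" using \<nu>0 by (intro eq_\<mu>) auto
  obtain M where M: "M \<in> ?I" "weights M = \<mu>" using exists_measure_of_weights[OF \<mu>] by blast
  have M_eqI: "N = M" if "N \<in> ?I" "weights N = \<mu>" for N
    using that M invariant_measuresD[OF that(1)] invariant_measuresD[OF M(1)]
    by (intro prob_measure_eqI_weights) auto
  have M_mem: "M \<in> measures_with_marginal \<eta> n" unfolding mem using M \<nu>0(2) \<nu>0_eq by auto
  have F_le: "?F (weights N) \<le> ?F (weights M)" if "N \<in> measures_with_marginal \<eta> n" for N
    unfolding M(2) \<nu>0_eq[symmetric] using that weights_stationary mem by (intro max) auto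
  have Sup: "(SUP N\<in>measures_with_marginal \<eta> n. weighted_entropy a b \<pi> N) = ereal (?F (weights M))"
    by (rule ereal_Sup_attained[where F = "\<lambda>N. ?F (weights N)", OF M_mem F_le]) (auto simp: mem intro: we)
  have max_iff: "maximizes_weighted_entropy a b \<pi> \<eta> n N \<longleftrightarrow> N = M" for N
  proof
    assume "N = M"
    then show "maximizes_weighted_entropy a b \<pi> \<eta> n N"
      unfolding maximizes_weighted_entropy_def Sup using M_mem we[OF M(1)] by simp
  next
    assume "maximizes_weighted_entropy a b \<pi> \<eta> n N"
    then have N: "N \<in> ?I" "\<And>I. I \<in> ?W \<Longrightarrow> weights N I = ?w I" "weighted_entropy a b \<pi> N = ereal (?F (weights M))"
      unfolding maximizes_weighted_entropy_def Sup mem by auto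
    then have "?F (weights N) = ?F \<nu>0" using we[OF N(1)] M(2) \<nu>0_eq by simp
    then have "weights N = \<mu>" using weights_stationary[OF N(1)] N(2) by (intro eq_\<mu>)
    then show "N = M" by (rule M_eqI[OF N(1)])
  qed
  let ?\<phi> = "word_potential ?s"
  have energy: "ereal (potential_average ?\<phi> N) + weighted_entropy a b \<pi> N = ereal (L (weights N) + ?F (weights N))"
    if "N \<in> ?I" for N
    using potential_average_word_potential[OF that L[OF weights_stationary[OF that]]] we[OF that] by simp
  have pressure: "weighted_pressure a b \<pi> ?\<phi> = ereal (L \<mu> + ?F \<mu>)"
    unfolding weighted_pressure_def M(2)[symmetric]
    by (rule ereal_Sup_attained[where F = "\<lambda>N. L (weights N) + ?F (weights N)", OF M(1)])
       (use le weights_stationary M(2) energy in auto)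
  have state: "weighted_equilibrium_state a b \<pi> ?\<phi> \<nu> \<longleftrightarrow> \<nu> = M" for \<nu>
  proof
    assume "\<nu> = M"
    then show "weighted_equilibrium_state a b \<pi> ?\<phi> \<nu>"
      unfolding weighted_equilibrium_state_def pressure using M energy[OF M(1)] by simp
  next
    assume "weighted_equilibrium_state a b \<pi> ?\<phi> \<nu>"
    then have \<nu>: "\<nu> \<in> ?I" "L (weights \<nu>) + ?F (weights \<nu>) = L \<mu> + ?F \<mu>"
      unfolding weighted_equilibrium_state_def pressure using energy by auto
    then have "weights \<nu> = \<mu>" by (intro unique weights_stationary)
    then show "\<nu> = M" by (rule M_eqI[OF \<nu>(1)])
  qed
  have "fully_supported M"
    using M \<mu>_pos invariant_measuresD[OF M(1)] by (intro fully_supported_if_weights_pos) auto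
  moreover have "quasi_bernoulli M"
    by (rule quasi_bernoulli_if_weights[OF C]) (simp_all only: M(2) \<mu>_pos qb)
  moreover have "almost_additive left_shift ?\<phi>" "bounded_distortion ?\<phi>"
    by (rule almost_additive_word_potential[OF quasi_additive_window_sum], rule bounded_distortion_word_potential)
  ultimately show ?thesis unfolding max_iff using state by blast
qed

end
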